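(* Let $d_1,d_2\ge1$ be integers, let $K\in\widetilde{\mathcal A}_0'(\mathbf C^{d_2}\times\mathbf C^{d_1})$, $s\in\overline{\mathbf R_\flat}$, and let $T$ be the linear and continuous map from $\mathcal A_0(\mathbf C^{d_1})$ to $\mathcal A_0'(\mathbf C^{d_2})$ given by $$F\mapsto TF=\big(z_2\mapsto\langle K(z_2,\cdot),F\rangle_{A^2(\mathbf C^{d_1})}\big).$$ Then the following is true: (1) if $K\in\widetilde{\mathcal A}_s(\mathbf C^{d_2}\times\mathbf C^{d_1})$, then $T$ extends uniquely to a linear and continuous map from $\mathcal A_s'(\mathbf C^{d_1})$ to $\mathcal A_s(\mathbf C^{d_2})$; (2) if $K\in\widetilde{\mathcal A}_s'(\mathbf C^{d_2}\times\mathbf C^{d_1})$, then $T$ extends uniquely to a linear and continuous map from $\mathcal A_s(\mathbf C^{d_1})$ to $\mathcal A_s'(\mathbf C^{d_2})$. The same holds true for $s\in\mathbf R_\flat$ if $\mathcal A_s$, $\widetilde{\mathcal A}_s$, $\mathcal A_s'$ and $\widetilde{\mathcal A}_s'$ (those with index $s$) are replaced by $\mathcal A_{0,s}$, $\widetilde{\mathcal A}_{0,s}$, $\mathcal A_{0,s}'$ and $\widetilde{\mathcal A}_{0,s}'$, respectively, at each occurrence.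
   Context: Index sets: $\mathbf N=\{0,1,2,\dots\}$; $\mathbf R_\flat=\mathbf R_+\cup\{\flat_\sigma : \sigma>0\}$ with formal symbols $\flat_\sigma$, and $\overline{\mathbf R_\flat}=\mathbf R_\flat\cup\{0\}$. Sequence spaces: for $s\in\mathbf R_\flat$, $r>0$, $\alpha\in\mathbf N^n$ let $\vartheta_{r,s}(\alpha)=e^{r|\alpha|^{1/(2s)}}$ if $s\in\mathbf R_+$ and $\vartheta_{r,s}(\alpha)=r^{|\alpha|}(\alpha!)^{1/(2\sigma)}$ if $s=\flat_\sigma$. For a weight $\vartheta>0$ on $\mathbf N^n$ let $\ell^p_{[\vartheta]}(\mathbf N^n)$ be the Banach space of complex sequences $c$ with $\|c\,\vartheta\|_{\ell^p}<\infty$. Fix any $p\in[1,\infty]$ (the spaces below do not depend on it). For $s\in\mathbf R_\flat$: $\ell_{0,s}(\mathbf N^n)=\bigcap_{r>0}\ell^p_{[\vartheta_{r,s}]}(\mathbf N^n)$ and $\ell_s'(\mathbf N^n)=\bigcap_{r>0}\ell^p_{[1/\vartheta_{r,s}]}(\mathbf N^n)$ with projective limit topologies; $\ell_s(\mathbf N^n)=\bigcup_{r>0}\ell^p_{[\vartheta_{r,s}]}(\mathbf N^n)$ and $\ell_{0,s}'(\mathbf N^n)=\bigcup_{r>0}\ell^p_{[1/\vartheta_{r,s}]}(\mathbf N^n)$ with inductive limit topologies. $\ell_0'(\mathbf N^n)$ is the space of all complex sequences on $\mathbf N^n$, with the topology of the seminorms $c\mapsto\|\{c_\alpha\}_{|\alpha|\le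 N}\|_{\ell^p}$, $N\ge0$; $\ell_0(\mathbf N^n)$ is the space of finitely supported sequences with the inductive limit topology of the finite-dimensional spaces $\{c : c_\alpha=0 \text{ for } |\alpha|>N\}$. Power series spaces: $e_\alpha(z)=z^\alpha/\sqrt{\alpha!}$. The spaces $\mathcal A_{0,s}(\mathbf C^n)$, $\mathcal A_s(\mathbf C^n)$, $\mathcal A_s'(\mathbf C^n)$, $\mathcal A_{0,s}'(\mathbf C^n)$ consist of all formal power series $F=\sum_\alpha c(F,\alpha)e_\alpha$ with $\{c(F,\alpha)\}$ in $\ell_{0,s}(\mathbf N^n)$, $\ell_s(\mathbf N^n)$, $\ell_s'(\mathbf N^n)$, $\ell_{0,s}'(\mathbf N^n)$ respectively, with topologies transported from the sequence spaces. The spaces $\widetilde{\mathcal A}_{0,s},\widetilde{\mathcal A}_s,\widetilde{\mathcal A}_s',\widetilde{\mathcal A}_{0,s}'$ on $\mathbf C^{d_2}\times\mathbf C^{d_1}$ consist of all formal series $K(z_2,z_1)=\sum c_K(\alpha_2,\alpha_1)e_{\alpha_2}(z_2)e_{\alpha_1}(\overline{z_1})$, $(\alpha_2,\alpha_1)\in\mathbf N^{d_2}\times\mathbf N^{d_1}$, with $c_K$ in $\ell_{0,s},\ell_s,\ell_s',\ell_{0,s}'$ on $\mathbf N^{d_2+d_1}$, respectively. Pairing: $\langle F,G\rangle_{A^2(\mathbf C^d)}=\int_{\mathbf C^d}F(z)G(z)\,d\mu(z)$, with $d\mu(z)=\pi^{-d}e^{-|z|^2}d\lambda(z)$ and $d\lambda$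 Lebesgue measure, extended by duality. The formula $TF=(z_2\mapsto\langle K(z_2,\cdot),F\rangle_{A^2(\mathbf C^{d_1})})$ means $(TF,G)_{A^2(\mathbf C^{d_2})}=(K,G\otimes\overline F)_{A^2(\mathbf C^{d_2}\times\mathbf C^{d_1})}$ for $F\in\mathcal A_0(\mathbf C^{d_1})$, $G\in\mathcal A_0(\mathbf C^{d_2})$ (with $(\cdot,\cdot)_{A^2}$ the extension of the sesquilinear form $\int F\overline G\,d\mu$); in terms of coefficients, $c(TF,\alpha_2)=\sum_{\alpha_1}c_K(\alpha_2,\alpha_1)c(F,\alpha_1)$. *)

theory Defs
  imports "HOL-Analysis.Analysis"
begin

section \<open>Indices and multi-indices\<close>

text \<open>
  A dimension is the cardinality of a finite type \<open>'d\<close>, so it is at least 1. Multi-indices in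
  \<open>N^d\<close> are functions \<open>'d \<Rightarrow> nat\<close>, points of \<open>C^d\<close> are of type \<open>complex ^ 'd\<close>, and
  \<open>N^(d2 + d1)\<close> is \<open>'d2 + 'd1 \<Rightarrow> nat\<close>.
\<close>

text \<open>
  \<open>Flat \<sigma>\<close> is the formal symbol written as a flat sign with subscript \<open>\<sigma>\<close>. The constructors are
  total in their argument; positivity is imposed by the sets below.
\<close>

datatype flat_index = Zero | Reg real | Flat real

definition R_flat :: "flat_index set"
  where "R_flat = Reg ` {0<..} \<union> Flat ` {0<..}"

definition R_flat_bar :: "flat_index set"
  where "R_flat_bar = insert Zero R_flat"

definition mi_abs :: "('n::finite \<Rightarrow> nat) \<Rightarrow> nat"
  where "mi_abs \<alpha> = (\<Sum>i\<in>UNIV. \<alpha> i)"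

definition mi_fact :: "('n::finite \<Rightarrow> nat) \<Rightarrow> real"
  where "mi_fact \<alpha> = (\<Prod>i\<in>UNIV. fact (\<alpha> i))"

text \<open>The weight is left unspecified at \<open>Zero\<close>, where no weight is used.\<close>

primrec weight :: "flat_index \<Rightarrow> real \<Rightarrow> ('n::finite \<Rightarrow> nat) \<Rightarrow> real" where
  "weight (Reg s) r = (\<lambda>\<alpha>. exp (r * real (mi_abs \<alpha>) powr (1 / (2 * s))))"
| "weight (Flat \<sigma>) r = (\<lambda>\<alpha>. r ^ mi_abs \<alpha> * mi_fact \<alpha> powr (1 / (2 * \<sigma>)))"


section \<open>Locally convex topologies on spaces of complex families\<close>

text \<open>
  A topological vector space is given by a topology on a set of complex families
  \<open>'a \<Rightarrow> complex\<close>; its underlying set is the \<open>topspace\<close>, its linear structure is pointwise.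
\<close>

definition seminorm_topology ::
    "('a \<Rightarrow> complex) set \<Rightarrow> (('a \<Rightarrow> complex) \<Rightarrow> real) set \<Rightarrow> ('a \<Rightarrow> complex) topology"
  where "seminorm_topology X P = topology (\<lambda>U. U \<subseteq> X \<and>
    (\<forall>x\<in>U. \<exists>Q e. finite Q \<and> Q \<subseteq> P \<and> 0 < e \<and>
       {y \<in> X. \<forall>q\<in>Q. q (\<lambda>i. y i - x i) < e} \<subseteq> U))"

definition absolutely_convex :: "('a \<Rightarrow> complex) set \<Rightarrow> bool"
  where "absolutely_convex V \<longleftrightarrow>
    (\<forall>x\<in>V. \<forall>y\<in>V. \<forall>a b. norm a + norm b \<le> 1 \<longrightarrow> (\<lambda>i. a * x i + b * y i) \<in> V)"

text \<open>
  The inductive limit in the category of locally convex spaces, i.e. the finest locally convex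
  topology on the union for which all the inclusions are continuous: a base of neighbourhoods of
  0 consists of the absolutely convex sets that meet every step in a neighbourhood of 0 there.
\<close>

definition inductive_topology ::
    "'i set \<Rightarrow> ('i \<Rightarrow> ('a \<Rightarrow> complex) topology) \<Rightarrow> ('a \<Rightarrow> complex) topology"
  where "inductive_topology I T = topology (\<lambda>U. U \<subseteq> (\<Union>i\<in>I. topspace (T i)) \<and>
    (\<forall>x\<in>U. \<exists>V \<subseteq> (\<Union>i\<in>I. topspace (T i)). absolutely_convex V \<and>
       (\<forall>i\<in>I. \<exists>W. openin (T i) W \<and> (\<lambda>_. 0) \<in> W \<and> W \<subseteq> V) \<and>
       (\<forall>v\<in>V. (\<lambda>i. x i + v i) \<in> U)))"

lemma istopology_nbhd_base:
  assumes "\<And>x V V'. N x V \<Longrightarrow> N x V' \<Longrightarrow> \<exists>V''. N x V'' \<and> V'' \<subseteq> V \<inter> V'"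
  shows "istopology (\<lambda>U. U \<subseteq> X \<and> (\<forall>x\<in>U. \<exists>V. N x V \<and> V \<subseteq> U))"
  unfolding istopology_def
proof (intro conjI allI impI ballI)
  fix S T x
  assume S: "S \<subseteq> X \<and> (\<forall>x\<in>S. \<exists>V. N x V \<and> V \<subseteq> S)"
    and T: "T \<subseteq> X \<and> (\<forall>x\<in>T. \<exists>V. N x V \<and> V \<subseteq> T)" and x: "x \<in> S \<inter> T"
  from S x obtain V where V: "N x V" "V \<subseteq> S" by auto
  from T x obtain V' where V': "N x V'" "V' \<subseteq> T" by auto
  from assms[OF V(1) V'(1)] obtain V'' where V'': "N x V''" "V'' \<subseteq> V \<inter> V'" by auto
  have "V'' \<subseteq> S \<inter> T" using V(2) V'(2) V''(2) by auto
  with V''(1) show "\<exists>V. N x V \<and> V \<subseteq> S \<inter> T" by auto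
next
  fix \<K> x
  assume K: "\<forall>S\<in>\<K>. S \<subseteq> X \<and> (\<forall>x\<in>S. \<exists>V. N x V \<and> V \<subseteq> S)" and "x \<in> \<Union>\<K>"
  then obtain S where S: "S \<in> \<K>" "x \<in> S" by auto
  with K obtain V where V: "N x V" "V \<subseteq> S" by metis
  then have "V \<subseteq> \<Union>\<K>" using S(1) by auto
  with V(1) show "\<exists>V. N x V \<and> V \<subseteq> \<Union>\<K>" by auto
qed auto

lemma openin_seminorm_topology:
  "openin (seminorm_topology X P) U \<longleftrightarrow> U \<subseteq> X \<and>
    (\<forall>x\<in>U. \<exists>Q e. finite Q \<and> Q \<subseteq> P \<and> 0 < e \<and>
       {y \<in> X. \<forall>q\<in>Q. q (\<lambda>i. y i - x i) < e} \<subseteq> U)"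
proof -
  define N where "N x V \<longleftrightarrow> (\<exists>Q e. finite Q \<and> Q \<subseteq> P \<and> 0 < e \<and>
       V = {y \<in> X. \<forall>q\<in>Q. q (\<lambda>i. y i - x i) < e})" for x V
  define L where "L = (\<lambda>U. U \<subseteq> X \<and> (\<forall>x\<in>U. \<exists>V. N x V \<and> V \<subseteq> U))"
  have L: "L U \<longleftrightarrow> U \<subseteq> X \<and> (\<forall>x\<in>U. \<exists>Q e. finite Q \<and> Q \<subseteq> P \<and> 0 < e \<and>
       {y \<in> X. \<forall>q\<in>Q. q (\<lambda>i. y i - x i) < e} \<subseteq> U)" for U
    unfolding L_def N_def by (intro conj_cong ball_cong refl iffI; elim exE conjE; intro exI conjI; simp)
  have "istopology L"
    unfolding L_def
  proof (rule istopology_nbhd_base)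
    fix x V V' assume "N x V" "N x V'"
    then obtain Q e Q' e' where
        "finite Q" "Q \<subseteq> P" "0 < e" and V: "V = {y \<in> X. \<forall>q\<in>Q. q (\<lambda>i. y i - x i) < e}"
      and "finite Q'" "Q' \<subseteq> P" "0 < e'" and V': "V' = {y \<in> X. \<forall>q\<in>Q'. q (\<lambda>i. y i - x i) < e'}"
      unfolding N_def by (elim exE conjE)
    then have "N x {y \<in> X. \<forall>q\<in>Q \<union> Q'. q (\<lambda>i. y i - x i) < min e e'}"
      unfolding N_def by (intro exI[of _ "Q \<union> Q'"] exI[of _ "min e e'"]) simp
    moreover have "{y \<in> X. \<forall>q\<in>Q \<union> Q'. q (\<lambda>i. y i - x i) < min e e'} \<subseteq> V \<inter> V'"
      unfolding V V' by auto
    ultimately show "\<exists>V''. N x V'' \<and> V'' \<subseteq> V \<inter> V'" by (intro exI conjI)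
  qed
  moreover have "seminorm_topology X P = topology L"
    unfolding seminorm_topology_def by (rule arg_cong[of _ _ topology], rule ext, rule L[symmetric])
  ultimately show ?thesis
    by (simp only: topology_inverse' L)
qed

lemma openin_inductive_topology:
  "openin (inductive_topology I T) U \<longleftrightarrow> U \<subseteq> (\<Union>i\<in>I. topspace (T i)) \<and>
    (\<forall>x\<in>U. \<exists>V \<subseteq> (\<Union>i\<in>I. topspace (T i)). absolutely_convex V \<and>
       (\<forall>i\<in>I. \<exists>W. openin (T i) W \<and> (\<lambda>_. 0) \<in> W \<and> W \<subseteq> V) \<and>
       (\<forall>v\<in>V. (\<lambda>i. x i + v i) \<in> U))"
proof -
  define X where "X = (\<Union>i\<in>I. topspace (T i))"
  define B where "B V \<longleftrightarrow> V \<subseteq> X \<and> absolutely_convex V \<and>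
     (\<forall>i\<in>I. \<exists>W. openin (T i) W \<and> (\<lambda>_. 0) \<in> W \<and> W \<subseteq> V)" for V
  define N where "N x Y \<longleftrightarrow> (\<exists>V. B V \<and> Y = (\<lambda>v i. x i + v i) ` V)" for x Y
  define L where "L = (\<lambda>U. U \<subseteq> X \<and> (\<forall>x\<in>U. \<exists>Y. N x Y \<and> Y \<subseteq> U))"
  have L: "L U \<longleftrightarrow> U \<subseteq> X \<and> (\<forall>x\<in>U. \<exists>V \<subseteq> X. absolutely_convex V \<and>
       (\<forall>i\<in>I. \<exists>W. openin (T i) W \<and> (\<lambda>_. 0) \<in> W \<and> W \<subseteq> V) \<and>
       (\<forall>v\<in>V. (\<lambda>i. x i + v i) \<in> U))" for U
  proof -
    have "(\<exists>Y. N x Y \<and> Y \<subseteq> U) \<longleftrightarrow> (\<exists>V. B V \<and> (\<forall>v\<in>V. (\<lambda>i. x i + v i) \<in> U))" for x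
      unfolding N_def image_subset_iff[symmetric] by metis
    then show ?thesis
      unfolding L_def B_def by (simp only: conj_assoc)
  qed
  have B_Int: "B (V \<inter> V')" if "B V" "B V'" for V V'
    unfolding B_def
  proof (intro conjI ballI)
    show "V \<inter> V' \<subseteq> X" using that by (auto simp: B_def)
    show "absolutely_convex (V \<inter> V')"
      using that by (simp add: B_def absolutely_convex_def)
  next
    fix i assume i: "i \<in> I"
    from that(1) i obtain W where W: "openin (T i) W" "(\<lambda>_. 0) \<in> W" "W \<subseteq> V"
      unfolding B_def by metis
    from that(2) i obtain W' where W': "openin (T i) W'" "(\<lambda>_. 0) \<in> W'" "W' \<subseteq> V'"
      unfolding B_def by metis
    show "\<exists>W. openin (T i) W \<and> (\<lambda>_. 0) \<in> W \<and> W \<subseteq> V \<inter> V'"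
      using W W' by (intro exI[of _ "W \<inter> W'"]) auto
  qed
  have "istopology L"
    unfolding L_def
  proof (rule istopology_nbhd_base)
    fix x Y Y' assume "N x Y" "N x Y'"
    then obtain V V' where "B V" "B V'"
        and Y: "Y = (\<lambda>v i. x i + v i) ` V" "Y' = (\<lambda>v i. x i + v i) ` V'"
      unfolding N_def by (elim exE conjE)
    then have "N x ((\<lambda>v i. x i + v i) ` (V \<inter> V'))"
      unfolding N_def using B_Int by (intro exI[of _ "V \<inter> V'"]) simp
    moreover have "(\<lambda>v i. x i + v i) ` (V \<inter> V') \<subseteq> Y \<inter> Y'"
      unfolding Y by (rule image_Int_subset)
    ultimately show "\<exists>Y''. N x Y'' \<and> Y'' \<subseteq> Y \<inter> Y'" by (intro exI conjI)
  qed
  moreover have "inductive_topology I T = topology L"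
    unfolding inductive_topology_def X_def[symmetric]
    by (rule arg_cong[of _ _ topology], rule ext, rule L[symmetric])
  ultimately show ?thesis
    by (simp only: topology_inverse' L X_def[symmetric])
qed

definition linear_continuous ::
    "('a \<Rightarrow> complex) topology \<Rightarrow> ('b \<Rightarrow> complex) topology \<Rightarrow>
     (('a \<Rightarrow> complex) \<Rightarrow> ('b \<Rightarrow> complex)) \<Rightarrow> bool"
  where "linear_continuous X Y S \<longleftrightarrow>
    (\<forall>F\<in>topspace X. \<forall>G\<in>topspace X. \<forall>a b.
       S (\<lambda>i. a * F i + b * G i) = (\<lambda>j. a * S F j + b * S G j)) \<and>
    continuous_map X Y S"

text \<open>
  \<open>T\<close> is only relevant on the set \<open>D\<close>. As functions in HOL are total, a map with domain
  \<open>topspace X\<close> is taken to be \<open>undefined\<close> outside, so that \<open>\<exists>!\<close> expresses uniqueness of the map.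
\<close>

definition extends_uniquely ::
    "('a \<Rightarrow> complex) set \<Rightarrow> (('a \<Rightarrow> complex) \<Rightarrow> ('b \<Rightarrow> complex)) \<Rightarrow>
     ('a \<Rightarrow> complex) topology \<Rightarrow> ('b \<Rightarrow> complex) topology \<Rightarrow> bool"
  where "extends_uniquely D T X Y \<longleftrightarrow> D \<subseteq> topspace X \<and>
    (\<exists>!S. S \<in> extensional (topspace X) \<and> linear_continuous X Y S \<and> (\<forall>F\<in>D. S F = T F))"


section \<open>Sequence spaces\<close>

definition in_lp :: "ereal \<Rightarrow> ('a \<Rightarrow> complex) \<Rightarrow> bool"
  where "in_lp p c \<longleftrightarrow> (if p = \<infinity> then bounded (range c)
    else (\<lambda>i. norm (c i) powr real_of_ereal p) summable_on UNIV)"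

definition lp_norm :: "ereal \<Rightarrow> ('a \<Rightarrow> complex) \<Rightarrow> real"
  where "lp_norm p c = (if p = \<infinity> then (SUP i. norm (c i))
    else (\<Sum>\<^sub>\<infinity>i. norm (c i) powr real_of_ereal p) powr (1 / real_of_ereal p))"

definition wlp :: "ereal \<Rightarrow> ('a \<Rightarrow> real) \<Rightarrow> ('a \<Rightarrow> complex) set"
  where "wlp p w = {c. in_lp p (\<lambda>i. c i * of_real (w i))}"

definition wlp_norm :: "ereal \<Rightarrow> ('a \<Rightarrow> real) \<Rightarrow> ('a \<Rightarrow> complex) \<Rightarrow> real"
  where "wlp_norm p w c = lp_norm p (\<lambda>i. c i * of_real (w i))"

definition wlp_topology :: "ereal \<Rightarrow> ('a \<Rightarrow> real) \<Rightarrow> ('a \<Rightarrow> complex) topology"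
  where "wlp_topology p w = seminorm_topology (wlp p w) {wlp_norm p w}"

text \<open>
  \<open>ell0\<close>, \<open>ell\<close>, \<open>ell_dual\<close>, \<open>ell0_dual\<close> are the spaces with subscript \<open>0,s\<close>, subscript \<open>s\<close>, subscript
  \<open>s\<close> and a prime, subscript \<open>0,s\<close> and a prime, respectively. The first and the last are
  only used for \<open>s \<in> R_flat\<close>.
\<close>

definition ell0 :: "ereal \<Rightarrow> flat_index \<Rightarrow> (('n::finite \<Rightarrow> nat) \<Rightarrow> complex) topology"
  where "ell0 p s = seminorm_topology (\<Inter>r\<in>{0<..}. wlp p (weight s r))
    ((\<lambda>r. wlp_norm p (weight s r)) ` {0<..})"

text \<open>
  For \<open>s = Zero\<close> the steps are finite-dimensional, and any norm, here the \<open>\<ell>\<^sup>p\<close> norm, gives their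
  topology.
\<close>

definition ell :: "ereal \<Rightarrow> flat_index \<Rightarrow> (('n::finite \<Rightarrow> nat) \<Rightarrow> complex) topology"
  where "ell p s = (if s = Zero
    then inductive_topology (UNIV :: nat set)
      (\<lambda>N. seminorm_topology {c. \<forall>\<alpha>. mi_abs \<alpha> > N \<longrightarrow> c \<alpha> = 0} {lp_norm p})
    else inductive_topology {0<..} (\<lambda>r. wlp_topology p (weight s r)))"

definition truncate_mi :: "nat \<Rightarrow> (('n::finite \<Rightarrow> nat) \<Rightarrow> complex) \<Rightarrow> (('n \<Rightarrow> nat) \<Rightarrow> complex)"
  where "truncate_mi N c = (\<lambda>\<alpha>. if mi_abs \<alpha> \<le> N then c \<alpha> else 0)"

definition ell_dual :: "ereal \<Rightarrow> flat_index \<Rightarrow> (('n::finite \<Rightarrow> nat) \<Rightarrow> complex) topology"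
  where "ell_dual p s = (if s = Zero
    then seminorm_topology UNIV (range (\<lambda>N c. lp_norm p (truncate_mi N c)))
    else seminorm_topology (\<Inter>r\<in>{0<..}. wlp p (\<lambda>\<alpha>. 1 / weight s r \<alpha>))
      ((\<lambda>r. wlp_norm p (\<lambda>\<alpha>. 1 / weight s r \<alpha>)) ` {0<..}))"

definition ell0_dual :: "ereal \<Rightarrow> flat_index \<Rightarrow> (('n::finite \<Rightarrow> nat) \<Rightarrow> complex) topology"
  where "ell0_dual p s = inductive_topology {0<..} (\<lambda>r. wlp_topology p (\<lambda>\<alpha>. 1 / weight s r \<alpha>))"


section \<open>Power series spaces\<close>

text \<open>
  A formal power series is the family of its coefficients with respect to the monomials \<open>z^\<alpha>\<close>;
  \<open>coef F \<alpha>\<close> is its coefficient with respect to \<open>e\<^sub>\<alpha>(z) = z^\<alpha> / sqrt (\<alpha>!)\<close>.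
\<close>

type_synonym 'd pseries = "('d \<Rightarrow> nat) \<Rightarrow> complex"

definition coef :: "'d::finite pseries \<Rightarrow> ('d \<Rightarrow> nat) \<Rightarrow> complex"
  where "coef F \<alpha> = F \<alpha> * of_real (sqrt (mi_fact \<alpha>))"

definition A0_space :: "ereal \<Rightarrow> flat_index \<Rightarrow> 'd::finite pseries topology"
  where "A0_space p s = pullback_topology UNIV coef (ell0 p s)"

definition A_space :: "ereal \<Rightarrow> flat_index \<Rightarrow> 'd::finite pseries topology"
  where "A_space p s = pullback_topology UNIV coef (ell p s)"

definition A_space_dual :: "ereal \<Rightarrow> flat_index \<Rightarrow> 'd::finite pseries topology"
  where "A_space_dual p s = pullback_topology UNIV coef (ell_dual p s)"

definition A0_space_dual :: "ereal \<Rightarrow> flat_index \<Rightarrow> 'd::finite pseries topology"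
  where "A0_space_dual p s = pullback_topology UNIV coef (ell0_dual p s)"

text \<open>
  A kernel is a formal power series in \<open>z\<^sub>2\<close> and the conjugate of \<open>z\<^sub>1\<close>, given by its coefficients
  \<open>K \<alpha>\<^sub>2 \<alpha>\<^sub>1\<close> with respect to \<open>z\<^sub>2^\<alpha>\<^sub>2 (cnj z\<^sub>1)^\<alpha>\<^sub>1\<close>; \<open>kcoef K (\<alpha>\<^sub>2, \<alpha>\<^sub>1)\<close> is the coefficient with
  respect to \<open>e\<^bsub>\<alpha>\<^sub>2\<^esub>(z\<^sub>2) e\<^bsub>\<alpha>\<^sub>1\<^esub>(cnj z\<^sub>1)\<close>, where the pair is encoded as one multi-index on \<open>'d2 + 'd1\<close>.
\<close>

type_synonym ('d2, 'd1) kernel = "('d2 \<Rightarrow> nat) \<Rightarrow> ('d1 \<Rightarrow> nat) \<Rightarrow> complex"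

definition kcoef :: "('d2::finite, 'd1::finite) kernel \<Rightarrow> ('d2 + 'd1 \<Rightarrow> nat) \<Rightarrow> complex"
  where "kcoef K \<gamma> =
    K (\<gamma> \<circ> Inl) (\<gamma> \<circ> Inr) * of_real (sqrt (mi_fact (\<gamma> \<circ> Inl)) * sqrt (mi_fact (\<gamma> \<circ> Inr)))"

definition At0 :: "ereal \<Rightarrow> flat_index \<Rightarrow> ('d2::finite, 'd1::finite) kernel topology"
  where "At0 p s = pullback_topology UNIV kcoef (ell0 p s)"

definition At :: "ereal \<Rightarrow> flat_index \<Rightarrow> ('d2::finite, 'd1::finite) kernel topology"
  where "At p s = pullback_topology UNIV kcoef (ell p s)"

definition At_dual :: "ereal \<Rightarrow> flat_index \<Rightarrow> ('d2::finite, 'd1::finite) kernel topology"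
  where "At_dual p s = pullback_topology UNIV kcoef (ell_dual p s)"

definition At0_dual :: "ereal \<Rightarrow> flat_index \<Rightarrow> ('d2::finite, 'd1::finite) kernel topology"
  where "At0_dual p s = pullback_topology UNIV kcoef (ell0_dual p s)"


section \<open>The sesquilinear form\<close>

text \<open>
  On \<open>C^d\<close>, a real vector space of dimension \<open>2d\<close>, the density is \<open>\<pi>^(-d) exp (-|z|^2)\<close>. The
  product \<open>C^d2 \<times> C^d1\<close> is also covered.
\<close>

definition gauss :: "'a::euclidean_space measure"
  where "gauss = density lborel
    (\<lambda>z. ennreal (pi powr (- (real DIM('a) / 2)) * exp (- (norm z)\<^sup>2)))"

definition monom_eval :: "('d::finite \<Rightarrow> nat) \<Rightarrow> complex ^ 'd \<Rightarrow> complex"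
  where "monom_eval \<alpha> z = (\<Prod>i\<in>UNIV. (z $ i) ^ \<alpha> i)"

text \<open>Evaluation of finitely supported series, i.e. of polynomials.\<close>

definition peval :: "'d::finite pseries \<Rightarrow> complex ^ 'd \<Rightarrow> complex"
  where "peval F z = (\<Sum>\<alpha> | F \<alpha> \<noteq> 0. F \<alpha> * monom_eval \<alpha> z)"

definition keval :: "('d2::finite, 'd1::finite) kernel \<Rightarrow> (complex ^ 'd2) \<times> (complex ^ 'd1) \<Rightarrow> complex"
  where "keval K = (\<lambda>(z2, z1). \<Sum>(\<alpha>2, \<alpha>1) | K \<alpha>2 \<alpha>1 \<noteq> 0.
    K \<alpha>2 \<alpha>1 * monom_eval \<alpha>2 z2 * cnj (monom_eval \<alpha>1 z1))"

definition truncate_kernel :: "nat \<Rightarrow> ('d2::finite, 'd1::finite) kernel \<Rightarrow> ('d2, 'd1) kernel"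
  where "truncate_kernel N K = (\<lambda>\<alpha>2 \<alpha>1. if mi_abs \<alpha>2 + mi_abs \<alpha>1 \<le> N then K \<alpha>2 \<alpha>1 else 0)"

definition A2_form :: "('a::euclidean_space \<Rightarrow> complex) \<Rightarrow> ('a \<Rightarrow> complex) \<Rightarrow> complex"
  where "A2_form F G = (LINT z|gauss. F z * cnj (G z))"

text \<open>
  The extension of the form to a formal series in the first and a polynomial (function) in the
  second argument: the truncations of the series are polynomials that converge to it in the
  topology of the space of all formal series, so that the continuous extension is this limit. The
  sequence is eventually constant, as the monomials are orthogonal for the Gaussian measure.
\<close>

definition A2_pair :: "'d::finite pseries \<Rightarrow> (complex ^ 'd \<Rightarrow> complex) \<Rightarrow> complex"
  where "A2_pair F G = lim (\<lambda>N. A2_form (peval (truncate_mi N F)) G)"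

definition A2_kpair ::
    "('d2::finite, 'd1::finite) kernel \<Rightarrow> ((complex ^ 'd2) \<times> (complex ^ 'd1) \<Rightarrow> complex) \<Rightarrow> complex"
  where "A2_kpair K G = lim (\<lambda>N. A2_form (keval (truncate_kernel N K)) G)"

definition tensor_conj ::
    "'d2::finite pseries \<Rightarrow> 'd1::finite pseries \<Rightarrow> (complex ^ 'd2) \<times> (complex ^ 'd1) \<Rightarrow> complex"
  where "tensor_conj G F = (\<lambda>(z2, z1). peval G z2 * cnj (peval F z1))"

end

theory Submission
  imports Defs "HOL-Probability.Distributions" "HOL-Real_Asymp.Real_Asymp"
begin

text \<open>
  All spaces are projective or inductive limits of weighted sequence spaces whose weights form a
  nuclear family: the quotient of the weights for two parameters \<open>r < r'\<close> is summable. Hence the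
  \<open>\<ell>\<^sup>p\<close> norms can be bounded below by weighted suprema and above by weighted \<open>\<ell>\<^sup>1\<close> norms, after a
  change of the parameter. On coefficients, \<open>T\<close> is the infinite matrix given by \<open>K\<close>, and it maps
  the space with weight \<open>w\<close> to the one with weight \<open>w'\<close> as soon as the sum of
  \<open>|K(\<beta>, \<alpha>)| w'(\<beta>) / w(\<alpha>)\<close> is finite. The growth condition on \<open>K\<close> gives this for one pair of
  parameters when the source is a projective and the target an inductive limit, and for all pairs
  in the opposite situation, because the weights on \<open>N^(d2 + d1)\<close> are comparable to products of
  weights on the factors. Uniqueness holds as the finitely supported series are dense and the
  coordinates are continuous.
\<close>

section \<open>Locally convex topologies\<close>

text \<open>The two kinds of limit behave oppositely. An open set of an inductive limit contains,
  around each of its points, a translated ball of any chosen step, so a map from a projective into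
  an inductive limit is continuous once it is bounded from one seminorm to one step. A map out of an
  inductive limit needs, for every seminorm of the target, an absolutely convex neighbourhood that
  is controlled on all steps at once. Such neighbourhoods are cut out by weighted
  \<open>\<ell>\<^sup>1\<close> norms of the image, whose subadditivity is immediate. The index
  \<open>Zero\<close> has no family of weights. It enters the same scheme with indicator weights for
  the truncation seminorms and the constant weight 1 on the finite-dimensional steps. The matrix of
  \<open>T\<close> is hidden in a hypothesis on Gaussian pairings. A monomial as test function
  isolates one coefficient, because distinct monomials are orthogonal and \<open>z^\<alpha>\<close>
  has squared norm \<open>\<alpha>!\<close>. These moments come from integrating derivatives along
  lines parallel to the axes, without polar coordinates.\<close>

definition lin_subspace :: "('a \<Rightarrow> complex) set \<Rightarrow> bool"
  where "lin_subspace S \<longleftrightarrow> (\<lambda>_. 0) \<in> S \<and>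
    (\<forall>x\<in>S. \<forall>y\<in>S. \<forall>a b. (\<lambda>i. a * x i + b * y i) \<in> S)"

definition linear_map_on ::
    "('a \<Rightarrow> complex) set \<Rightarrow> (('a \<Rightarrow> complex) \<Rightarrow> ('b \<Rightarrow> complex)) \<Rightarrow> bool"
  where "linear_map_on S L \<longleftrightarrow>
    (\<forall>x\<in>S. \<forall>y\<in>S. \<forall>a b. L (\<lambda>i. a * x i + b * y i) = (\<lambda>j. a * L x j + b * L y j))"

lemma lin_subspace_zero: "lin_subspace S \<Longrightarrow> (\<lambda>_. 0) \<in> S"
  and lin_subspace_comb: "lin_subspace S \<Longrightarrow> x \<in> S \<Longrightarrow> y \<in> S \<Longrightarrow> (\<lambda>i. a * x i + b * y i) \<in> S"
  unfolding lin_subspace_def by blast+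

lemma lin_subspace_add: "(\<lambda>i. x i + y i) \<in> S" if "lin_subspace S" "x \<in> S" "y \<in> S"
  using lin_subspace_comb[OF that, of 1 1] by simp

lemma lin_subspace_diff: "(\<lambda>i. x i - y i) \<in> S" if "lin_subspace S" "x \<in> S" "y \<in> S"
  using lin_subspace_comb[OF that, of 1 "-1"] by simp

lemma linear_map_on_diff:
  assumes "linear_map_on S L" "x \<in> S" "y \<in> S"
  shows "L (\<lambda>i. x i - y i) = (\<lambda>j. L x j - L y j)"
proof -
  have "L (\<lambda>i. 1 * x i + (-1) * y i) = (\<lambda>j. 1 * L x j + (-1) * L y j)"
    using assms unfolding linear_map_on_def by blast
  then show ?thesis by simp
qed

lemma linear_map_on_add:
  assumes "linear_map_on S L" "x \<in> S" "y \<in> S"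
  shows "L (\<lambda>i. x i + y i) = (\<lambda>j. L x j + L y j)"
proof -
  have "L (\<lambda>i. 1 * x i + 1 * y i) = (\<lambda>j. 1 * L x j + 1 * L y j)"
    using assms unfolding linear_map_on_def by blast
  then show ?thesis by simp
qed

text \<open>Triangle inequality and scaling bound in one formula: it is what makes the sets
  \<open>n v < e\<close> with \<open>0 < e\<close> absolutely convex.\<close>

definition subadditive_on :: "('a \<Rightarrow> complex) set \<Rightarrow> (('a \<Rightarrow> complex) \<Rightarrow> real) \<Rightarrow> bool"
  where "subadditive_on S n \<longleftrightarrow>
    (\<forall>x\<in>S. \<forall>y\<in>S. \<forall>a b. n (\<lambda>i. a * x i + b * y i) \<le> norm a * n x + norm b * n y)"

lemma subadditive_on_add:
  assumes "subadditive_on S n" "x \<in> S" "y \<in> S"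
  shows "n (\<lambda>i. x i + y i) \<le> n x + n y"
proof -
  have "n (\<lambda>i. 1 * x i + 1 * y i) \<le> norm (1::complex) * n x + norm (1::complex) * n y"
    using assms unfolding subadditive_on_def by blast
  then show ?thesis by simp
qed

lemma subadditive_on_zero:
  assumes "subadditive_on S n" "(\<lambda>_. 0) \<in> S"
  shows "n (\<lambda>_. 0) \<le> 0"
  using assms(1)[unfolded subadditive_on_def, rule_format, OF assms(2) assms(2), of 0 0] by simp

lemma topspace_seminorm_topology: "topspace (seminorm_topology X P) = X"
proof (rule antisym)
  show "topspace (seminorm_topology X P) \<subseteq> X"
    by (rule conjunct1[OF openin_topspace[of "seminorm_topology X P", unfolded openin_seminorm_topology]])
  have "openin (seminorm_topology X P) X"
    unfolding openin_seminorm_topology by (intro conjI ballI exI[of _ "{}"] exI[of _ 1]) auto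
  then show "X \<subseteq> topspace (seminorm_topology X P)" by (rule openin_subset)
qed

lemma topspace_inductive_topology:
  assumes "lin_subspace (\<Union>i\<in>I. topspace (T i))" "\<And>i. i \<in> I \<Longrightarrow> (\<lambda>_. 0) \<in> topspace (T i)"
  shows "topspace (inductive_topology I T) = (\<Union>i\<in>I. topspace (T i))" (is "_ = ?X")
proof (rule antisym)
  show "topspace (inductive_topology I T) \<subseteq> ?X"
    by (rule conjunct1[OF openin_topspace[of "inductive_topology I T", unfolded openin_inductive_topology]])
  have "openin (inductive_topology I T) ?X"
    unfolding openin_inductive_topology
  proof (intro conjI ballI subset_refl, rule exI[of _ ?X], intro conjI ballI subset_refl)
    show "absolutely_convex ?X"
      unfolding absolutely_convex_def using lin_subspace_comb[OF assms(1)] by blast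
    show "\<exists>W. openin (T i) W \<and> (\<lambda>_. 0) \<in> W \<and> W \<subseteq> ?X" if "i \<in> I" for i
      using assms(2) that by (intro exI[of _ "topspace (T i)"]) auto
    show "(\<lambda>i. x i + v i) \<in> ?X" if "x \<in> ?X" "v \<in> ?X" for x v
      using that by (rule lin_subspace_add[OF assms(1)])
  qed
  then show "?X \<subseteq> topspace (inductive_topology I T)" by (rule openin_subset)
qed

text \<open>The half of the description of the inductive limit that serves maps into it and density.
  The radius \<open>e\<close> depends on the chosen step.\<close>

lemma inductive_topology_neighbourhood:
  assumes "openin (inductive_topology I (\<lambda>i. seminorm_topology (S i) {q i})) U" "x \<in> U" "i \<in> I"
  obtains e where "0 < e" "\<And>v. v \<in> S i \<Longrightarrow> q i v < e \<Longrightarrow> (\<lambda>a. x a + v a) \<in> U"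
proof -
  obtain V where V: "\<forall>i\<in>I. \<exists>W. openin (seminorm_topology (S i) {q i}) W \<and> (\<lambda>_. 0) \<in> W \<and> W \<subseteq> V"
      "\<forall>v\<in>V. (\<lambda>a. x a + v a) \<in> U"
    using assms(1,2) unfolding openin_inductive_topology by meson
  obtain W where W: "openin (seminorm_topology (S i) {q i}) W" "(\<lambda>_. 0) \<in> W" "W \<subseteq> V"
    using V(1) assms(3) by blast
  then obtain Q e where Q: "Q \<subseteq> {q i}" "0 < e" and
      sub: "{y \<in> S i. \<forall>p\<in>Q. p (\<lambda>a. y a - 0) < e} \<subseteq> W"
    unfolding openin_seminorm_topology by meson
  show ?thesis
  proof (rule that[OF Q(2)])
    fix v assume "v \<in> S i" "q i v < e"
    then have "v \<in> W" using Q(1) by (intro subsetD[OF sub]) auto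
    with W V show "(\<lambda>a. x a + v a) \<in> U" by blast
  qed
qed

text \<open>The half that serves maps out of the limit. Subadditivity makes the set where all
  \<open>n\<close> in \<open>Q\<close> are below \<open>e\<close> absolutely convex, and the bounds
  by \<open>M * q i\<close> make it a neighbourhood of 0 in each step; \<open>M\<close> may depend
  on the step. A finite set \<open>Q\<close> is allowed because a basic neighbourhood in a
  projective target involves finitely many seminorms.\<close>

lemma openin_inductive_topologyI:
  assumes sub: "U \<subseteq> X" and X: "X = (\<Union>i\<in>I. S i)" "lin_subspace X" "\<And>i. i \<in> I \<Longrightarrow> lin_subspace (S i)"
    and n: "\<And>x. x \<in> U \<Longrightarrow> \<exists>Q e. finite Q \<and> 0 < e \<and> (\<forall>n\<in>Q. subadditive_on X n \<and>
        (\<forall>i\<in>I. \<exists>M\<ge>0. \<forall>v\<in>S i. n v \<le> M * q i v)) \<and>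
        (\<forall>v\<in>X. (\<forall>n\<in>Q. n v < e) \<longrightarrow> (\<lambda>a. x a + v a) \<in> U)"
  shows "openin (inductive_topology I (\<lambda>i. seminorm_topology (S i) {q i})) U"
  unfolding openin_inductive_topology topspace_seminorm_topology
proof (intro conjI ballI)
  show "U \<subseteq> (\<Union>i\<in>I. S i)" using sub X by simp
  fix x assume "x \<in> U"
  from n[OF this] obtain Q e where Q12: "finite Q" "0 < e"
      and Qn: "\<forall>n\<in>Q. subadditive_on X n \<and> (\<forall>i\<in>I. \<exists>M\<ge>0. \<forall>v\<in>S i. n v \<le> M * q i v)"
      and QU: "\<forall>v\<in>X. (\<forall>n\<in>Q. n v < e) \<longrightarrow> (\<lambda>a. x a + v a) \<in> U"
    by (elim exE conjE)
  have bd: "\<exists>M\<ge>0. \<forall>v\<in>S i. n v \<le> M * q i v" if "n \<in> Q" "i \<in> I" for n i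
    using bspec[OF Qn that(1)] that(2) by simp
  have Q3: "subadditive_on X n" if "n \<in> Q" for n
    using bspec[OF Qn that] by simp
  note Q = Q12 Q3
  define V where "V = {v\<in>X. \<forall>n\<in>Q. n v < e}"
  show "\<exists>V\<subseteq>\<Union> (S ` I). absolutely_convex V \<and>
      (\<forall>i\<in>I. \<exists>W. openin (seminorm_topology (S i) {q i}) W \<and> (\<lambda>_. 0) \<in> W \<and> W \<subseteq> V) \<and>
      (\<forall>v\<in>V. (\<lambda>i. x i + v i) \<in> U)"
  proof (rule exI[of _ V], intro conjI ballI)
    show "V \<subseteq> \<Union> (S ` I)" unfolding V_def X(1) by blast
    show "absolutely_convex V"
      unfolding absolutely_convex_def
    proof (intro ballI allI impI)
      fix y z and a b :: complex assume y: "y \<in> V" and z: "z \<in> V" and ab: "norm a + norm b \<le> 1"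
      have "n (\<lambda>i. a * y i + b * z i) < e" if "n \<in> Q" for n
      proof -
        \<comment> \<open>The maximum with 0 makes \<open>m\<close> nonnegative by construction, so
          that \<open>norm a + norm b \<le> 1\<close> may be multiplied by it.\<close>
        define m where "m = max 0 (max (n y) (n z))"
        have m: "m < e" "0 \<le> m" using y z that Q(2) unfolding V_def m_def by auto
        have "n (\<lambda>i. a * y i + b * z i) \<le> norm a * n y + norm b * n z"
          using Q(3)[OF that] y z unfolding subadditive_on_def V_def by blast
        also have "\<dots> \<le> norm a * m + norm b * m"
          unfolding m_def by (intro add_mono mult_left_mono) auto
        also have "\<dots> \<le> m" using mult_right_mono[OF ab m(2)] by (simp add: distrib_right)
        finally show ?thesis using m(1) by simp
      qed
      then show "(\<lambda>i. a * y i + b * z i) \<in> V"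
        using y z lin_subspace_comb[OF X(2)] unfolding V_def by blast
    qed
    show "(\<lambda>i. x i + v i) \<in> U" if "v \<in> V" for v
      using that QU unfolding V_def by simp
    fix i assume i: "i \<in> I"
    define W where "W = {v\<in>S i. \<forall>n\<in>Q. n v < e}"
    have sX: "S i \<subseteq> X" using i unfolding X(1) by blast
    have "openin (seminorm_topology (S i) {q i}) W"
      unfolding openin_seminorm_topology
    proof (intro conjI ballI)
      show "W \<subseteq> S i" unfolding W_def by blast
      fix y assume y: "y \<in> W"
      have "\<exists>d>0. \<forall>z\<in>S i. q i (\<lambda>a. z a - y a) < d \<longrightarrow> n z < e" if "n \<in> Q" for n
      proof -
        obtain M where M0: "0 \<le> M" and M: "\<And>v. v \<in> S i \<Longrightarrow> n v \<le> M * q i v" using bd[OF \<open>n \<in> Q\<close> i] by blast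
        have ny: "n y < e" using y that unfolding W_def by blast
        \<comment> \<open>The denominator \<open>1 + M\<close> is positive even for
          \<open>M = 0\<close>, and it makes \<open>M * d < e - n y\<close> strict.\<close>
        define d where "d = (e - n y) / (1 + M)"
        have d: "d > 0" unfolding d_def using ny M0 by simp
        have "n z < e" if z: "z \<in> S i" "q i (\<lambda>a. z a - y a) < d" for z
        proof -
          have yz: "(\<lambda>a. z a - y a) \<in> S i" using y z X(3)[OF i] unfolding W_def
            by (intro lin_subspace_diff) auto
          have "n z = n (\<lambda>a. y a + (z a - y a))" by simp
          also have "\<dots> \<le> n y + n (\<lambda>a. z a - y a)"
            using yz y sX unfolding W_def by (intro subadditive_on_add[OF Q(3)[OF \<open>n \<in> Q\<close>]]) auto
          also have "n (\<lambda>a. z a - y a) < e - n y"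
          proof -
            have "n (\<lambda>a. z a - y a) \<le> M * q i (\<lambda>a. z a - y a)" by (rule M[OF yz])
            also have "\<dots> \<le> M * d" using z M0 by (intro mult_left_mono) auto
            also have "\<dots> < (1 + M) * d" using d by (simp add: distrib_right)
            also have "\<dots> = e - n y" unfolding d_def using M0 by simp
            finally show ?thesis .
          qed
          finally show "n z < e" by simp
        qed
        then show ?thesis using d by blast
      qed
      then obtain d where d: "\<And>n. n \<in> Q \<Longrightarrow> 0 < d n"
          "\<And>n z. n \<in> Q \<Longrightarrow> z \<in> S i \<Longrightarrow> q i (\<lambda>a. z a - y a) < d n \<Longrightarrow> n z < e"
        by metis
      define d0 where "d0 = Min (insert 1 (d ` Q))"
      have d0: "0 < d0" "\<And>n. n \<in> Q \<Longrightarrow> d0 \<le> d n"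
        unfolding d0_def using Q(1) d(1) by auto
      show "\<exists>Q e. finite Q \<and> Q \<subseteq> {q i} \<and> 0 < e \<and> {z \<in> S i. \<forall>p\<in>Q. p (\<lambda>a. z a - y a) < e} \<subseteq> W"
        using d0 d(2) unfolding W_def by (intro exI[of _ "{q i}"] exI[of _ d0]) force
    qed
    moreover have "(\<lambda>_. 0) \<in> W"
    proof -
      have z: "(\<lambda>_. 0) \<in> S i" using X(3)[OF i] by (rule lin_subspace_zero)
      have "n (\<lambda>_. 0) \<le> 0" if "n \<in> Q" for n
        using subadditive_on_zero[OF Q(3)[OF that]] z sX by blast
      then show ?thesis using z Q(2) unfolding W_def by force
    qed
    moreover have "W \<subseteq> V" using sX unfolding W_def V_def by blast
    ultimately show "\<exists>W. openin (seminorm_topology (S i) {q i}) W \<and> (\<lambda>_. 0) \<in> W \<and> W \<subseteq> V"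
      by blast
  qed
qed

section \<open>Finitely supported sequences: density and continuity of coordinates\<close>

definition finite_support :: "('a \<Rightarrow> complex) set"
  where "finite_support = {x. finite {a. x a \<noteq> 0}}"

definition restr :: "'a set \<Rightarrow> ('a \<Rightarrow> complex) \<Rightarrow> 'a \<Rightarrow> complex"
  where "restr A x = (\<lambda>a. if a \<in> A then x a else 0)"

lemma restr_finite_support: "finite A \<Longrightarrow> restr A x \<in> finite_support"
  unfolding finite_support_def restr_def by (auto elim: rev_finite_subset)

text \<open>The weighted \<open>\<ell>\<^sup>1\<close> distance from \<open>x\<close> to its
  restriction to \<open>A\<close> is the total sum minus the partial sum over \<open>A\<close>. The
  claim is phrased with the filter of finite sets so that finitely many seminorms can be treated
  together.\<close>

lemma eventually_tail_less:
  fixes x :: "'a \<Rightarrow> complex"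
  assumes "(\<lambda>a. norm (x a) * w a) summable_on UNIV" and "0 < e"
  shows "\<forall>\<^sub>F A in finite_subsets_at_top UNIV.
    (\<lambda>a. norm (restr A x a - x a) * w a) summable_on UNIV \<and>
    (\<Sum>\<^sub>\<infinity>a. norm (restr A x a - x a) * w a) < e"
proof -
  define f where "f a = norm (x a) * w a" for a
  have f: "f summable_on UNIV" using assms(1) unfolding f_def .
  have tail: "(\<lambda>a. norm (restr A x a - x a) * w a) summable_on UNIV \<and>
      (\<Sum>\<^sub>\<infinity>a. norm (restr A x a - x a) * w a) = infsum f UNIV - sum f A" if "finite A" for A
  proof -
    have *: "norm (restr A x a - x a) * w a = (if a \<in> A then 0 else f a)" for a
      by (simp add: restr_def f_def)
    have fA: "f summable_on (- A)" using f by (rule summable_on_subset_banach) simp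
    have "infsum f (A \<union> - A) = infsum f A + infsum f (- A)"
      using fA \<open>finite A\<close> by (intro infsum_Un_disjoint) auto
    then have "infsum f (- A) = infsum f UNIV - sum f A" using \<open>finite A\<close> by simp
    moreover have "(\<lambda>a. if a \<in> A then 0 else f a) summable_on UNIV \<longleftrightarrow> f summable_on (- A)"
      by (rule summable_on_cong_neutral) auto
    moreover have "(\<Sum>\<^sub>\<infinity>a. if a \<in> A then 0 else f a) = infsum f (- A)"
      by (rule infsum_cong_neutral) auto
    ultimately show ?thesis using fA unfolding * by simp
  qed
  have "(sum f \<longlongrightarrow> infsum f UNIV) (finite_subsets_at_top UNIV)"
    using f by (rule infsum_tendsto)
  then have "\<forall>\<^sub>F A in finite_subsets_at_top UNIV. dist (sum f A) (infsum f UNIV) < e"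
    using assms(2) by (rule tendstoD)
  moreover have "\<forall>\<^sub>F A in finite_subsets_at_top UNIV. finite (A :: 'a set)"
    by (rule eventually_finite_subsets_at_top_weakI)
  ultimately show ?thesis
    by eventually_elim (use tail in \<open>auto simp: dist_real_def\<close>)
qed

text \<open>
  The functional \<open>q i\<close> is only controlled by a weighted supremum and a weighted \<open>\<ell>\<^sup>1\<close> norm. It need
  not be known to satisfy the triangle inequality, so that Minkowski's inequality is avoided.
\<close>

locale weighted_steps =
  fixes I :: "'i set" and S :: "'i \<Rightarrow> ('a \<Rightarrow> complex) set"
    and q :: "'i \<Rightarrow> ('a \<Rightarrow> complex) \<Rightarrow> real" and w :: "'i \<Rightarrow> 'a \<Rightarrow> real"
  assumes step_subspace: "i \<in> I \<Longrightarrow> lin_subspace (S i)"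
    and w_nonneg: "i \<in> I \<Longrightarrow> 0 \<le> w i a"
    and coord_le: "i \<in> I \<Longrightarrow> x \<in> S i \<Longrightarrow> norm (x a) * w i a \<le> q i x"
    and le_l1: "i \<in> I \<Longrightarrow> x \<in> S i \<Longrightarrow> (\<lambda>a. norm (x a) * w i a) summable_on UNIV \<Longrightarrow>
      q i x \<le> (\<Sum>\<^sub>\<infinity>a. norm (x a) * w i a)"
begin

lemma q_nonneg:
  assumes "i \<in> I" "x \<in> S i" shows "0 \<le> q i x"
proof -
  have "0 \<le> norm (x undefined) * w i undefined" using w_nonneg[OF assms(1)] by simp
  also have "\<dots> \<le> q i x" by (rule coord_le[OF assms])
  finally show ?thesis .
qed

end

text \<open>
  A single weight may vanish somewhere: the seminorms of the space of all sequences are the norms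
  of truncations.
\<close>

locale projective_steps = weighted_steps I S q w
  for I :: "'i set" and S :: "'i \<Rightarrow> ('a \<Rightarrow> complex) set" and q and w +
  assumes w_pos: "\<exists>i\<in>I. 0 < w i a"
    and nuclear: "i \<in> I \<Longrightarrow> \<exists>j\<in>I. \<forall>x\<in>S j. (\<lambda>a. norm (x a) * w i a) summable_on UNIV"
    and step_l1: "i \<in> I \<Longrightarrow> (\<lambda>a. norm (x a) * w i a) summable_on UNIV \<Longrightarrow> x \<in> S i"
begin

abbreviation "limit_space \<equiv> \<Inter>i\<in>I. S i"

abbreviation "limit_topology \<equiv> seminorm_topology limit_space (q ` I)"

lemma limit_subspace: "lin_subspace limit_space"
  unfolding lin_subspace_def
proof (intro conjI ballI allI INT_I)
  show "(\<lambda>_. 0) \<in> S i" if "i \<in> I" for i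
    by (rule lin_subspace_zero[OF step_subspace[OF that]])
  show "(\<lambda>c. a * x c + b * y c) \<in> S i"
    if "x \<in> limit_space" "y \<in> limit_space" "i \<in> I" for x y a b i
    using that by (intro lin_subspace_comb[OF step_subspace]) simp_all
qed

lemma finite_support_limit: "finite_support \<subseteq> limit_space"
proof safe
  fix x :: "'a \<Rightarrow> complex" and i assume "x \<in> finite_support" and i: "i \<in> I"
  then have "(\<lambda>a. norm (x a) * w i a) summable_on {a. x a \<noteq> 0}"
    unfolding finite_support_def by simp
  also have "?this \<longleftrightarrow> (\<lambda>a. norm (x a) * w i a) summable_on UNIV"
    by (rule summable_on_cong_neutral) auto
  finally show "x \<in> S i" by (rule step_l1[OF i])
qed

text \<open>On the limit space \<open>nuclear\<close> makes all the weighted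
  \<open>\<ell>\<^sup>1\<close> norms finite, and by \<open>le_l1\<close> they dominate
  \<open>q i\<close>; hence truncations approximate. This works although finite sequences need not
  be dense in a single step, for instance for \<open>p = \<infinity>\<close>.\<close>

lemma dense:
  assumes "openin limit_topology U" "x \<in> U"
  shows "\<exists>y\<in>finite_support. y \<in> U"
proof -
  obtain Q e where Q: "finite Q" "Q \<subseteq> q ` I" "0 < e"
      and sub: "{y \<in> limit_space. \<forall>p\<in>Q. p (\<lambda>a. y a - x a) < e} \<subseteq> U"
    using assms unfolding openin_seminorm_topology by meson
  have xX: "x \<in> limit_space"
    using openin_subset[OF assms(1)] assms(2) unfolding topspace_seminorm_topology by blast
  have "\<forall>\<^sub>F A in finite_subsets_at_top UNIV. p (\<lambda>a. restr A x a - x a) < e" if p: "p \<in> Q" for p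
  proof -
    obtain i where i: "i \<in> I" "p = q i" using p Q(2) by blast
    obtain j where j: "j \<in> I" "\<And>x. x \<in> S j \<Longrightarrow> (\<lambda>a. norm (x a) * w i a) summable_on UNIV"
      using nuclear[OF i(1)] by blast
    have "(\<lambda>a. norm (x a) * w i a) summable_on UNIV" using j xX by blast
    from eventually_tail_less[OF this Q(3)] show ?thesis
    proof eventually_elim
      case (elim A)
      then have "q i (\<lambda>a. restr A x a - x a) \<le> (\<Sum>\<^sub>\<infinity>a. norm (restr A x a - x a) * w i a)"
        using le_l1[OF i(1) step_l1[OF i(1)]] by simp
      with elim i(2) show ?case by simp
    qed
  qed
  then have "\<forall>\<^sub>F A in finite_subsets_at_top UNIV. \<forall>p\<in>Q. p (\<lambda>a. restr A x a - x a) < e"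
    using Q(1) by (intro eventually_ball_finite) auto
  moreover have "\<forall>\<^sub>F A in finite_subsets_at_top UNIV. finite (A :: 'a set)"
    by (rule eventually_finite_subsets_at_top_weakI)
  ultimately have "\<forall>\<^sub>F A in finite_subsets_at_top UNIV. restr A x \<in> finite_support \<inter> U"
  proof eventually_elim
    case (elim A)
    have "restr A x \<in> finite_support" using elim(2) by (rule restr_finite_support)
    with elim(1) finite_support_limit show ?case
      by (intro IntI subsetD[OF sub]) auto
  qed
  from eventually_happens'[OF finite_subsets_at_top_neq_bot this] show ?thesis by blast
qed

text \<open>Coordinates separate points, so their continuity does the work of a Hausdorff property
  of the target. The index \<open>i\<close> must depend on \<open>a\<close>, since a single weight
  may vanish there.\<close>

lemma continuous_coordinate: "continuous_map limit_topology euclidean (\<lambda>x. x a)"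
  unfolding continuous_map topspace_seminorm_topology openin_seminorm_topology
proof (intro conjI allI impI ballI)
  fix U x assume U: "openin euclidean (U :: complex set)" and x: "x \<in> {x \<in> limit_space. x a \<in> U}"
  obtain e where e: "0 < e" "ball (x a) e \<subseteq> U"
    using U x by (auto simp: open_contains_ball)
  obtain i where i: "i \<in> I" "0 < w i a" using w_pos by blast
  show "\<exists>Q e. finite Q \<and> Q \<subseteq> q ` I \<and> 0 < e \<and>
      {y \<in> limit_space. \<forall>p\<in>Q. p (\<lambda>a. y a - x a) < e} \<subseteq> {x \<in> limit_space. x a \<in> U}"
  proof (rule exI[of _ "{q i}"], rule exI[of _ "e * w i a"], intro conjI subsetI)
    show "finite {q i}" "0 < e * w i a" using i e by auto
    show "p \<in> q ` I" if "p \<in> {q i}" for p using that i by blast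
    fix y assume y: "y \<in> {y \<in> limit_space. \<forall>p\<in>{q i}. p (\<lambda>a. y a - x a) < e * w i a}"
    have "(\<lambda>a. y a - x a) \<in> S i"
      using lin_subspace_diff[OF limit_subspace, of y x] x y i by blast
    from coord_le[OF i(1) this, of a] y have "norm (y a - x a) * w i a < e * w i a" by simp
    then have "y a \<in> ball (x a) e" using i(2) by (simp add: dist_norm norm_minus_commute)
    from subsetD[OF e(2) this] y show "y \<in> {x \<in> limit_space. x a \<in> U}" by blast
  qed
qed auto

end

text \<open>Each step has to control every coordinate, hence the weights are strictly positive.
  \<open>nuclear\<close> passes to a step that still contains \<open>x\<close> and in which its
  weighted \<open>\<ell>\<^sup>1\<close> norm is finite; \<open>step_restr\<close> then keeps the
  truncations of \<open>x\<close> in that same step, where the error can be measured.\<close>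

locale inductive_steps = weighted_steps I S q w
  for I :: "'i set" and S :: "'i \<Rightarrow> ('a \<Rightarrow> complex) set" and q and w +
  assumes w_pos: "i \<in> I \<Longrightarrow> 0 < w i a"
    and directed: "i \<in> I \<Longrightarrow> j \<in> I \<Longrightarrow> \<exists>k\<in>I. S i \<union> S j \<subseteq> S k"
    and nuclear: "i \<in> I \<Longrightarrow> x \<in> S i \<Longrightarrow>
      \<exists>j\<in>I. x \<in> S j \<and> (\<lambda>a. norm (x a) * w j a) summable_on UNIV"
    and step_restr: "i \<in> I \<Longrightarrow> x \<in> S i \<Longrightarrow> finite A \<Longrightarrow> restr A x \<in> S i"
    and step_finite_support: "x \<in> finite_support \<Longrightarrow> \<exists>i\<in>I. x \<in> S i"
begin

abbreviation "limit_space \<equiv> \<Union>i\<in>I. S i"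

abbreviation "limit_topology \<equiv> inductive_topology I (\<lambda>i. seminorm_topology (S i) {q i})"

lemma limit_subspace: "lin_subspace limit_space"
  unfolding lin_subspace_def
proof (intro conjI ballI allI)
  show "(\<lambda>_. 0) \<in> limit_space"
    using step_finite_support[of "\<lambda>_. 0"] by (simp add: finite_support_def)
  fix x y a b assume "x \<in> limit_space" "y \<in> limit_space"
  then obtain i j where ij: "i \<in> I" "x \<in> S i" "j \<in> I" "y \<in> S j" by blast
  then obtain k where "k \<in> I" "x \<in> S k" "y \<in> S k" using directed[of i j] by blast
  then show "(\<lambda>c. a * x c + b * y c) \<in> limit_space"
    using lin_subspace_comb[OF step_subspace[of k]] by (intro UN_I)
qed

lemma topspace_limit: "topspace limit_topology = limit_space"
  using topspace_inductive_topology[where I = I and T = "\<lambda>i. seminorm_topology (S i) {q i}"] limit_subspace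
    lin_subspace_zero[OF step_subspace]
  by (simp add: topspace_seminorm_topology)

lemma finite_support_limit: "finite_support \<subseteq> limit_space"
  using step_finite_support by blast

text \<open>One step suffices here: the approximation takes place in a step in which
  \<open>x\<close> has finite weighted \<open>\<ell>\<^sup>1\<close> norm, and \<open>U\<close>
  contains a translated ball of that step.\<close>

lemma dense:
  assumes "openin limit_topology U" "x \<in> U"
  shows "\<exists>y\<in>finite_support. y \<in> U"
proof -
  have "x \<in> limit_space" using openin_subset[OF assms(1)] assms(2) unfolding topspace_limit by blast
  then obtain j where j: "j \<in> I" "x \<in> S j" "(\<lambda>a. norm (x a) * w j a) summable_on UNIV"
    using nuclear by blast
  obtain e where e: "0 < e" "\<And>v. v \<in> S j \<Longrightarrow> q j v < e \<Longrightarrow> (\<lambda>a. x a + v a) \<in> U"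
    using inductive_topology_neighbourhood[OF assms j(1)] by blast
  have "\<forall>\<^sub>F A in finite_subsets_at_top UNIV. finite (A :: 'a set)"
    by (rule eventually_finite_subsets_at_top_weakI)
  with eventually_tail_less[OF j(3) e(1)]
  have "\<forall>\<^sub>F A in finite_subsets_at_top UNIV. restr A x \<in> finite_support \<inter> U"
  proof eventually_elim
    case (elim A)
    have "(\<lambda>a. restr A x a - x a) \<in> S j"
      using step_restr[OF j(1,2) elim(2)] j(2) by (intro lin_subspace_diff[OF step_subspace[OF j(1)]])
    moreover from this have "q j (\<lambda>a. restr A x a - x a) < e"
      using le_l1[OF j(1)] elim(1) by fastforce
    ultimately have "(\<lambda>a. x a + (restr A x a - x a)) \<in> U" by (rule e(2))
    then show ?case using restr_finite_support[OF elim(2)] by simp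
  qed
  from eventually_happens'[OF finite_subsets_at_top_neq_bot this] show ?thesis by blast
qed

text \<open>On step \<open>i\<close> the coordinate is bounded by \<open>1 / w i a\<close> times
  \<open>q i\<close>. These constants need not be uniform in \<open>i\<close>.\<close>

lemma continuous_coordinate: "continuous_map limit_topology euclidean (\<lambda>x. x a)"
  unfolding continuous_map topspace_limit
proof (intro conjI allI impI)
  fix U assume U: "openin euclidean (U :: complex set)"
  show "openin limit_topology {x \<in> limit_space. x a \<in> U}"
  proof (rule openin_inductive_topologyI[of _ limit_space])
    fix x assume x: "x \<in> {x \<in> limit_space. x a \<in> U}"
    obtain e where e: "0 < e" "ball (x a) e \<subseteq> U"
      using U x by (auto simp: open_contains_ball)
    have sub: "subadditive_on limit_space (\<lambda>v. norm (v a))"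
      unfolding subadditive_on_def by (auto intro!: norm_triangle_le simp: norm_mult)
    have bd: "\<exists>M\<ge>0. \<forall>v\<in>S i. norm (v a) \<le> M * q i v" if "i \<in> I" for i
      using coord_le[OF that, of _ a] w_pos[OF that, of a]
      by (intro exI[of _ "1 / w i a"]) (auto simp: field_simps)
    have nb: "(\<lambda>a. x a + v a) \<in> {x \<in> limit_space. x a \<in> U}"
      if v: "v \<in> limit_space" "norm (v a) < e" for v
    proof (rule CollectI, rule conjI)
      show "(\<lambda>a. x a + v a) \<in> limit_space"
        using x v(1) by (intro lin_subspace_add[OF limit_subspace]) simp_all
      show "x a + v a \<in> U"
        by (rule subsetD[OF e(2)]) (use v(2) in \<open>simp add: dist_norm\<close>)
    qed
    show "\<exists>Q e. finite Q \<and> 0 < e \<and>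
        (\<forall>n\<in>Q. subadditive_on limit_space n \<and> (\<forall>i\<in>I. \<exists>M\<ge>0. \<forall>v\<in>S i. n v \<le> M * q i v)) \<and>
        (\<forall>v\<in>limit_space. (\<forall>n\<in>Q. n v < e) \<longrightarrow> (\<lambda>a. x a + v a) \<in> {x \<in> limit_space. x a \<in> U})"
    proof (rule exI[of _ "{\<lambda>v. norm (v a)}"], rule exI[of _ e], intro conjI ballI impI)
      show "\<exists>M\<ge>0. \<forall>v\<in>S i. n v \<le> M * q i v" if "n \<in> {\<lambda>v. norm (v a)}" "i \<in> I" for n i
        using that bd by simp
      show "(\<lambda>a. x a + v a) \<in> {x \<in> limit_space. x a \<in> U}"
        if "v \<in> limit_space" "\<forall>n\<in>{\<lambda>v. norm (v a)}. n v < e" for v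
        using that by (intro nb) simp_all
    qed (use sub e(1) in simp_all)
  qed (blast, rule refl, rule limit_subspace, rule step_subspace)
qed simp

end

section \<open>Operators given by infinite matrices\<close>

definition kernel_op :: "('b \<Rightarrow> 'a \<Rightarrow> complex) \<Rightarrow> ('a \<Rightarrow> complex) \<Rightarrow> 'b \<Rightarrow> complex"
  where "kernel_op k x = (\<lambda>b. \<Sum>\<^sub>\<infinity>a. k b a * x a)"

text \<open>Where \<open>w\<close> vanishes the quotient by \<open>w a\<close> is 0, hence the first assumption.\<close>

lemma kernel_op_bound:
  assumes zero: "\<And>a b. w a = 0 \<Longrightarrow> k b a = 0"
    and w: "\<And>a. 0 \<le> w a" and w': "\<And>b. 0 \<le> w' b"
    and sm: "(\<lambda>(b, a). norm (k b a) * w' b / w a) summable_on UNIV"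
    and x: "\<And>a. norm (x a) * w a \<le> B"
  shows kernel_op_row_summable: "\<And>b. 0 < w' b \<Longrightarrow> (\<lambda>a. norm (k b a * x a)) summable_on UNIV"
    and kernel_op_summable: "(\<lambda>b. norm (kernel_op k x b) * w' b) summable_on UNIV"
    and kernel_op_infsum_le: "(\<Sum>\<^sub>\<infinity>b. norm (kernel_op k x b) * w' b)
      \<le> B * (\<Sum>\<^sub>\<infinity>(b, a). norm (k b a) * w' b / w a)"
proof -
  define g where "g = (\<lambda>(b, a). norm (k b a) * w' b / w a)"
  define h where "h b a = norm (k b a * x a) * w' b" for b a
  have hnn: "0 \<le> h b a" for b a unfolding h_def using w' by simp
  have hg: "h b a \<le> B * g (b, a)" for b a
  proof (cases "w a = 0")
    case True
    then show ?thesis unfolding h_def g_def using zero by simp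
  next
    case False
    then have "0 < w a" using w[of a] by simp
    then have "norm (x a) \<le> B / w a" using x[of a] by (simp add: field_simps)
    then have "(norm (k b a) * w' b) * norm (x a) \<le> (norm (k b a) * w' b) * (B / w a)"
      using w' by (intro mult_left_mono) auto
    then show ?thesis unfolding h_def g_def by (simp add: norm_mult ac_simps)
  qed
  have gB: "(\<lambda>z. B * g z) summable_on UNIV"
    using sm unfolding g_def by (rule summable_on_cmult_right)
  have h: "(\<lambda>(b, a). h b a) summable_on UNIV"
    by (rule summable_on_comparison_test[OF gB]) (use hg hnn in auto)
  then have hS: "(\<lambda>(b, a). h b a) summable_on (SIGMA b:UNIV. UNIV)" by simp
  have row: "h b summable_on UNIV" for b
    using summable_on_SigmaD1[OF hS, of b] by simp
  \<comment> \<open>The weighted row \<open>h b\<close> gives information on the row itself only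
    where \<open>w' b\<close> is positive. Where \<open>w' b = 0\<close>, the left side of the
    estimate \<open>le\<close> is 0.\<close>
  show r: "(\<lambda>a. norm (k b a * x a)) summable_on UNIV" if "0 < w' b" for b
    using row[of b] that unfolding h_def by (subst (asm) summable_on_cmult_left') auto
  have le: "norm (kernel_op k x b) * w' b \<le> infsum (h b) UNIV" for b
  proof (cases "w' b = 0")
    case True
    then show ?thesis using hnn by (simp add: infsum_nonneg)
  next
    case False
    then have pos: "0 < w' b" using w'[of b] by simp
    have "norm (kernel_op k x b) * w' b \<le> (\<Sum>\<^sub>\<infinity>a. norm (k b a * x a)) * w' b"
      unfolding kernel_op_def using pos by (intro mult_right_mono norm_infsum_bound r) auto
    also have "\<dots> = infsum (h b) UNIV"
      unfolding h_def by (rule infsum_cmult_left'[symmetric])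
    finally show ?thesis .
  qed
  have hrows: "(\<lambda>b. infsum (h b) UNIV) summable_on UNIV"
    using summable_on_SigmaD[OF hS] row by simp
  show sL: "(\<lambda>b. norm (kernel_op k x b) * w' b) summable_on UNIV"
    by (rule summable_on_comparison_test[OF hrows]) (use le w' in auto)
  have "(\<Sum>\<^sub>\<infinity>b. norm (kernel_op k x b) * w' b) \<le> (\<Sum>\<^sub>\<infinity>b. infsum (h b) UNIV)"
    by (rule infsum_mono[OF sL hrows le])
  also have "\<dots> = infsum (\<lambda>(b, a). h b a) UNIV"
    using infsum_Sigma_banach[OF hS] by simp
  also have "\<dots> \<le> (\<Sum>\<^sub>\<infinity>z. B * g z)"
    by (rule infsum_mono[OF h gB]) (use hg in auto)
  also have "\<dots> = B * infsum g UNIV" by (rule infsum_cmult_right')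
  finally show "(\<Sum>\<^sub>\<infinity>b. norm (kernel_op k x b) * w' b)
      \<le> B * (\<Sum>\<^sub>\<infinity>(b, a). norm (k b a) * w' b / w a)" unfolding g_def .
qed

text \<open>A divergent infinite sum is 0 by convention, which would break additivity; absolute
  convergence of every row excludes this.\<close>

lemma kernel_op_linear:
  assumes "\<And>b x. x \<in> X \<Longrightarrow> (\<lambda>a. norm (k b a * x a)) summable_on UNIV"
  shows "linear_map_on X (kernel_op k)"
  unfolding linear_map_on_def
proof (intro ballI allI ext)
  fix x y c d b assume "x \<in> X" "y \<in> X"
  then have x: "(\<lambda>a. k b a * x a) summable_on UNIV" and y: "(\<lambda>a. k b a * y a) summable_on UNIV"
    using assms by (auto intro: abs_summable_summable)
  have "kernel_op k (\<lambda>a. c * x a + d * y a) b = (\<Sum>\<^sub>\<infinity>a. c * (k b a * x a) + d * (k b a * y a))"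
    unfolding kernel_op_def by (simp add: algebra_simps)
  also have "\<dots> = (\<Sum>\<^sub>\<infinity>a. c * (k b a * x a)) + (\<Sum>\<^sub>\<infinity>a. d * (k b a * y a))"
    using x y by (intro infsum_add summable_on_cmult_right)
  also have "\<dots> = c * kernel_op k x b + d * kernel_op k y b"
    unfolding kernel_op_def by (simp add: infsum_cmult_right')
  finally show "kernel_op k (\<lambda>a. c * x a + d * y a) b = c * kernel_op k x b + d * kernel_op k y b" .
qed

text \<open>The chain is: \<open>coord_le\<close> bounds the entries of \<open>x\<close> by
  \<open>q i x\<close>, the matrix turns this into a weighted \<open>\<ell>\<^sup>1\<close> bound of
  the image, and \<open>le_l1\<close> bounds \<open>q' j\<close> by that. So \<open>q' j\<close> of
  the image is at most \<open>M * q i x\<close>, and a ball of step \<open>j\<close> inside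
  \<open>U\<close> pulls back to a neighbourhood given by the single seminorm
  \<open>q i\<close>.\<close>

lemma linear_continuous_projective_inductive:
  fixes S :: "'i \<Rightarrow> ('a \<Rightarrow> complex) set" and S' :: "'j \<Rightarrow> ('b \<Rightarrow> complex) set"
  assumes P: "projective_steps I S q w" and N: "inductive_steps J S' q' w'"
    and i: "i \<in> I" and j: "j \<in> J"
    and zero: "\<And>a b. w i a = 0 \<Longrightarrow> k b a = 0"
    and sm: "(\<lambda>(b, a). norm (k b a) * w' j b / w i a) summable_on UNIV"
    and maps: "\<And>x. x \<in> (\<Inter>i\<in>I. S i) \<Longrightarrow> kernel_op k x \<in> S' j"
  shows "linear_continuous (seminorm_topology (\<Inter>i\<in>I. S i) (q ` I))
    (inductive_topology J (\<lambda>j. seminorm_topology (S' j) {q' j})) (kernel_op k)"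
proof -
  interpret P: projective_steps I S q w by (rule P)
  interpret N: inductive_steps J S' q' w' by (rule N)
  define M where "M = (\<Sum>\<^sub>\<infinity>(b, a). norm (k b a) * w' j b / w i a)"
  have M: "0 \<le> M" unfolding M_def using P.w_nonneg[OF i] N.w_nonneg[OF j]
    by (intro infsum_nonneg) auto
  have kb: "0 < w' j b \<Longrightarrow> (\<lambda>a. norm (k b a * x a)) summable_on UNIV"
      "(\<lambda>b. norm (kernel_op k x b) * w' j b) summable_on UNIV"
      "(\<Sum>\<^sub>\<infinity>b. norm (kernel_op k x b) * w' j b) \<le> q i x * M" if "x \<in> S i" for x b
    unfolding M_def
    using kernel_op_bound[where w = "w i" and w' = "w' j" and k = k,
        OF _ P.w_nonneg[OF i] N.w_nonneg[OF j] sm P.coord_le[OF i that]] zero by simp_all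
  have bound: "q' j (kernel_op k x) \<le> M * q i x" if x: "x \<in> P.limit_space" for x
  proof -
    have xi: "x \<in> S i" using x i by blast
    have "q' j (kernel_op k x) \<le> (\<Sum>\<^sub>\<infinity>b. norm (kernel_op k x b) * w' j b)"
      using kb(2)[OF xi] by (intro N.le_l1[OF j maps[OF x]])
    also have "\<dots> \<le> q i x * M" by (rule kb(3)[OF xi])
    finally show ?thesis by (simp add: mult.commute)
  qed
  have lin: "linear_map_on P.limit_space (kernel_op k)"
  proof (rule kernel_op_linear)
    fix x b assume "x \<in> P.limit_space"
    then have "x \<in> S i" using i by blast
    then show "(\<lambda>a. norm (k b a * x a)) summable_on UNIV"
      using kb(1) N.w_pos[OF j] by blast
  qed
  have "continuous_map P.limit_topology N.limit_topology (kernel_op k)"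
    unfolding continuous_map topspace_seminorm_topology N.topspace_limit
  proof (intro conjI allI impI)
    show "kernel_op k ` P.limit_space \<subseteq> N.limit_space" using maps j by blast
    fix U assume U: "openin N.limit_topology U"
    show "openin P.limit_topology {x \<in> P.limit_space. kernel_op k x \<in> U}"
      unfolding openin_seminorm_topology
    proof (intro conjI ballI)
      fix x assume x: "x \<in> {x \<in> P.limit_space. kernel_op k x \<in> U}"
      obtain e where e: "0 < e" "\<And>v. v \<in> S' j \<Longrightarrow> q' j v < e \<Longrightarrow> (\<lambda>b. kernel_op k x b + v b) \<in> U"
        using inductive_topology_neighbourhood[OF U _ j] x by blast
      show "\<exists>Q e. finite Q \<and> Q \<subseteq> q ` I \<and> 0 < e \<and>
          {y \<in> P.limit_space. \<forall>p\<in>Q. p (\<lambda>a. y a - x a) < e} \<subseteq> {x \<in> P.limit_space. kernel_op k x \<in> U}"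
      proof (rule exI[of _ "{q i}"], rule exI[of _ "e / (1 + M)"], intro conjI subsetI)
        show "p \<in> q ` I" if "p \<in> {q i}" for p using that i by blast
        show "0 < e / (1 + M)" using e M by simp
        fix y assume y: "y \<in> {y \<in> P.limit_space. \<forall>p\<in>{q i}. p (\<lambda>a. y a - x a) < e / (1 + M)}"
        have yx: "(\<lambda>a. y a - x a) \<in> P.limit_space"
          using x y by (intro lin_subspace_diff[OF P.limit_subspace]) auto
        have yxi: "(\<lambda>a. y a - x a) \<in> S i" using yx i by blast
        have "q' j (kernel_op k (\<lambda>a. y a - x a)) \<le> M * q i (\<lambda>a. y a - x a)" by (rule bound[OF yx])
        also have "\<dots> \<le> (1 + M) * q i (\<lambda>a. y a - x a)"
          using P.q_nonneg[OF i yxi] by (simp add: distrib_right)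
        also have "\<dots> < e" using y M by (simp add: field_simps)
        finally have "(\<lambda>b. kernel_op k x b + kernel_op k (\<lambda>a. y a - x a) b) \<in> U"
          using maps[OF yx] by (intro e(2))
        moreover have "kernel_op k (\<lambda>a. y a - x a) = (\<lambda>b. kernel_op k y b - kernel_op k x b)"
          using x y by (intro linear_map_on_diff[OF lin]) auto
        ultimately show "y \<in> {x \<in> P.limit_space. kernel_op k x \<in> U}" using y by simp
      qed simp
    qed blast
  qed
  with lin show ?thesis
    unfolding linear_continuous_def topspace_seminorm_topology linear_map_on_def by blast
qed

text \<open>
  The sets \<open>A i\<close> serve the finitely supported sequences, where nothing is known about the growth
  of the matrix and only its entries with column in \<open>A i\<close> act on step \<open>i\<close>.
\<close>

lemma linear_continuous_inductive_projective:
  fixes S :: "'i \<Rightarrow> ('a \<Rightarrow> complex) set" and S' :: "'j \<Rightarrow> ('b \<Rightarrow> complex) set"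
  assumes N: "inductive_steps I S q w" and P: "projective_steps J S' q' w'"
    and supp: "\<And>i x a. i \<in> I \<Longrightarrow> x \<in> S i \<Longrightarrow> a \<notin> A i \<Longrightarrow> x a = 0"
    and sm: "\<And>i j. i \<in> I \<Longrightarrow> j \<in> J \<Longrightarrow>
      (\<lambda>(b, a). norm (k b a) * w' j b / w i a) summable_on (UNIV \<times> A i)"
  shows "linear_continuous (inductive_topology I (\<lambda>i. seminorm_topology (S i) {q i}))
    (seminorm_topology (\<Inter>j\<in>J. S' j) (q' ` J)) (kernel_op k)"
proof -
  interpret N: inductive_steps I S q w by (rule N)
  interpret P: projective_steps J S' q' w' by (rule P)
  have kb: "0 < w' j b \<Longrightarrow> (\<lambda>a. norm (k b a * x a)) summable_on UNIV"
      "(\<lambda>b. norm (kernel_op k x b) * w' j b) summable_on UNIV"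
      "(\<Sum>\<^sub>\<infinity>b. norm (kernel_op k x b) * w' j b) \<le>
        q i x * (\<Sum>\<^sub>\<infinity>(b, a)\<in>UNIV \<times> A i. norm (k b a) * w' j b / w i a)"
    if "i \<in> I" "j \<in> J" "x \<in> S i" for i j x b
  proof -
    \<comment> \<open>On step \<open>i\<close> the entries with column outside \<open>A i\<close>
      multiply zeros of \<open>x\<close>. Erasing them changes neither the image of \<open>x\<close>
      nor the sum over \<open>A i\<close>, and turns \<open>sm\<close> into the hypothesis of
      \<open>kernel_op_bound\<close>.\<close>
    define k' where "k' b a = (if a \<in> A i then k b a else 0)" for b a
    have k': "k' b a * x a = k b a * x a" for a b
      using supp[OF that(1,3), of a] by (auto simp: k'_def)
    have "k' b a = 0" if "w i a = 0" for a b using N.w_pos[OF \<open>i \<in> I\<close>, of a] that by simp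
    moreover have "(\<lambda>(b, a). norm (k' b a) * w' j b / w i a) summable_on UNIV \<longleftrightarrow>
        (\<lambda>(b, a). norm (k b a) * w' j b / w i a) summable_on (UNIV \<times> A i)"
      by (rule summable_on_cong_neutral) (auto simp: k'_def split: if_splits)
    moreover have "(\<Sum>\<^sub>\<infinity>(b, a). norm (k' b a) * w' j b / w i a) =
        (\<Sum>\<^sub>\<infinity>(b, a)\<in>UNIV \<times> A i. norm (k b a) * w' j b / w i a)"
      by (rule infsum_cong_neutral) (auto simp: k'_def split: if_splits)
    moreover have "kernel_op k' x = kernel_op k x" by (simp add: kernel_op_def k')
    ultimately show "0 < w' j b \<Longrightarrow> (\<lambda>a. norm (k b a * x a)) summable_on UNIV"
      "(\<lambda>b. norm (kernel_op k x b) * w' j b) summable_on UNIV"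
      "(\<Sum>\<^sub>\<infinity>b. norm (kernel_op k x b) * w' j b) \<le>
        q i x * (\<Sum>\<^sub>\<infinity>(b, a)\<in>UNIV \<times> A i. norm (k b a) * w' j b / w i a)"
      using kernel_op_bound[where w = "w i" and w' = "w' j" and k = k' and x = x,
          OF _ N.w_nonneg[OF that(1)] P.w_nonneg[OF that(2)] _ N.coord_le[OF that(1,3)]] sm[OF that(1,2)]
      unfolding k' by simp_all
  qed
  have maps: "kernel_op k x \<in> S' j" if x: "x \<in> N.limit_space" and j: "j \<in> J" for x j
  proof -
    obtain i where i: "i \<in> I" "x \<in> S i" using x by blast
    show ?thesis using j i by (intro P.step_l1 kb(2))
  qed
  \<comment> \<open>These weighted \<open>\<ell>\<^sup>1\<close> norms of the image dominate
    \<open>q' j\<close> and are subadditive, so they can replace it in defining absolutely convex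
    neighbourhoods.\<close>
  define n where "n j x = (\<Sum>\<^sub>\<infinity>b. norm (kernel_op k x b) * w' j b)" for j x
  have summ: "(\<lambda>b. norm (kernel_op k x b) * w' j b) summable_on UNIV"
    if x: "x \<in> N.limit_space" and j: "j \<in> J" for x j
  proof -
    obtain i where "i \<in> I" "x \<in> S i" using x by blast
    then show ?thesis using j by (intro kb(2))
  qed
  have q'n: "q' j (kernel_op k x) \<le> n j x" if "x \<in> N.limit_space" "j \<in> J" for x j
    unfolding n_def using that by (intro P.le_l1 maps summ)
  have lin: "linear_map_on N.limit_space (kernel_op k)"
  proof (rule kernel_op_linear)
    fix x b assume "x \<in> N.limit_space"
    then obtain i where i: "i \<in> I" "x \<in> S i" by blast
    obtain j where j: "j \<in> J" "0 < w' j b" using P.w_pos by blast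
    show "(\<lambda>a. norm (k b a * x a)) summable_on UNIV"
      using i j by (intro kb(1))
  qed
  have sub: "subadditive_on N.limit_space (n j)" if j: "j \<in> J" for j
    unfolding subadditive_on_def
  proof (intro ballI allI)
    fix x y c d assume x: "x \<in> N.limit_space" and y: "y \<in> N.limit_space"
    have L: "kernel_op k (\<lambda>a. c * x a + d * y a) = (\<lambda>b. c * kernel_op k x b + d * kernel_op k y b)"
      using lin x y unfolding linear_map_on_def by blast
    have xy: "(\<lambda>a. c * x a + d * y a) \<in> N.limit_space"
      by (rule lin_subspace_comb[OF N.limit_subspace x y])
    have sx: "(\<lambda>b. norm c * (norm (kernel_op k x b) * w' j b)) summable_on UNIV"
      and sy: "(\<lambda>b. norm d * (norm (kernel_op k y b) * w' j b)) summable_on UNIV"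
      using summ[OF x j] summ[OF y j] by (auto intro: summable_on_cmult_right)
    have "n j (\<lambda>a. c * x a + d * y a) \<le>
        (\<Sum>\<^sub>\<infinity>b. norm c * (norm (kernel_op k x b) * w' j b) + norm d * (norm (kernel_op k y b) * w' j b))"
      unfolding n_def
    proof (rule infsum_mono[OF summ[OF xy j] summable_on_add[OF sx sy]])
      fix b
      have "norm (kernel_op k (\<lambda>a. c * x a + d * y a) b) \<le>
          norm c * norm (kernel_op k x b) + norm d * norm (kernel_op k y b)"
        unfolding L by (metis norm_mult norm_triangle_ineq)
      from mult_right_mono[OF this P.w_nonneg[OF j]]
      show "norm (kernel_op k (\<lambda>a. c * x a + d * y a) b) * w' j b \<le>
          norm c * (norm (kernel_op k x b) * w' j b) + norm d * (norm (kernel_op k y b) * w' j b)"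
        by (simp add: algebra_simps)
    qed
    also have "\<dots> = norm c * n j x + norm d * n j y"
      unfolding n_def infsum_add[OF sx sy] by (simp add: infsum_cmult_right')
    finally show "n j (\<lambda>a. c * x a + d * y a) \<le> norm c * n j x + norm d * n j y" .
  qed
  have bd: "\<exists>M\<ge>0. \<forall>v\<in>S i. n j v \<le> M * q i v" if i: "i \<in> I" and j: "j \<in> J" for i j
  proof (intro exI conjI ballI)
    show "0 \<le> (\<Sum>\<^sub>\<infinity>(b, a)\<in>UNIV \<times> A i. norm (k b a) * w' j b / w i a)"
      using N.w_nonneg[OF i] P.w_nonneg[OF j] by (intro infsum_nonneg) auto
    show "n j v \<le> (\<Sum>\<^sub>\<infinity>(b, a)\<in>UNIV \<times> A i. norm (k b a) * w' j b / w i a) * q i v" if "v \<in> S i" for v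
      using kb(3)[OF i j that] unfolding n_def by (simp add: mult.commute)
  qed
  have "continuous_map N.limit_topology P.limit_topology (kernel_op k)"
    unfolding continuous_map topspace_seminorm_topology N.topspace_limit
  proof (intro conjI allI impI)
    show "kernel_op k ` N.limit_space \<subseteq> P.limit_space" using maps by blast
    fix U assume U: "openin P.limit_topology U"
    show "openin N.limit_topology {x \<in> N.limit_space. kernel_op k x \<in> U}"
    proof (rule openin_inductive_topologyI[of _ N.limit_space])
      fix x assume x: "x \<in> {x \<in> N.limit_space. kernel_op k x \<in> U}"
      then have "kernel_op k x \<in> U" by blast
      then obtain Q e where Q: "finite Q" "Q \<subseteq> q' ` J" "0 < e" and
          QU: "{y \<in> P.limit_space. \<forall>p\<in>Q. p (\<lambda>b. y b - kernel_op k x b) < e} \<subseteq> U"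
        using U unfolding openin_seminorm_topology by meson
      obtain J' where J': "finite J'" "J' \<subseteq> J" "Q = q' ` J'"
        using finite_subset_image[OF Q(1,2)] by blast
      show "\<exists>Q e. finite Q \<and> 0 < e \<and>
          (\<forall>n\<in>Q. subadditive_on N.limit_space n \<and> (\<forall>i\<in>I. \<exists>M\<ge>0. \<forall>v\<in>S i. n v \<le> M * q i v)) \<and>
          (\<forall>v\<in>N.limit_space. (\<forall>n\<in>Q. n v < e) \<longrightarrow>
            (\<lambda>a. x a + v a) \<in> {x \<in> N.limit_space. kernel_op k x \<in> U})"
      proof (rule exI[of _ "n ` J'"], rule exI[of _ e], intro conjI ballI impI)
        show "subadditive_on N.limit_space m" if "m \<in> n ` J'" for m
          using that J'(2) sub by blast
        show "\<exists>M\<ge>0. \<forall>v\<in>S i. m v \<le> M * q i v" if m: "m \<in> n ` J'" and i: "i \<in> I" for m i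
        proof -
          obtain j where "j \<in> J" "m = n j" using m J'(2) by blast
          then show ?thesis using bd[OF i] by simp
        qed
        fix v assume v: "v \<in> N.limit_space" and nv: "\<forall>m\<in>n ` J'. m v < e"
        have xv: "(\<lambda>a. x a + v a) \<in> N.limit_space"
          using x v by (intro lin_subspace_add[OF N.limit_subspace]) auto
        have L: "kernel_op k (\<lambda>a. x a + v a) = (\<lambda>b. kernel_op k x b + kernel_op k v b)"
          using x v by (intro linear_map_on_add[OF lin]) auto
        have "kernel_op k (\<lambda>a. x a + v a) \<in> U"
        proof (rule subsetD[OF QU], intro CollectI conjI ballI INT_I)
          show "kernel_op k (\<lambda>a. x a + v a) \<in> S' j" if "j \<in> J" for j by (rule maps[OF xv that])
          fix p assume "p \<in> Q"
          then obtain j where j: "j \<in> J'" "p = q' j" using J'(3) by blast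
          then have "q' j (kernel_op k v) \<le> n j v" using J'(2) v by (intro q'n) auto
          also have "\<dots> < e" using nv j(1) by blast
          finally show "p (\<lambda>b. kernel_op k (\<lambda>a. x a + v a) b - kernel_op k x b) < e"
            unfolding L j(2) by simp
        qed
        with xv show "(\<lambda>a. x a + v a) \<in> {x \<in> N.limit_space. kernel_op k x \<in> U}" by blast
      qed (use J' Q in auto)
    qed (blast, rule refl, rule N.limit_subspace, rule N.step_subspace)
  qed
  with lin show ?thesis
    unfolding linear_continuous_def N.topspace_limit linear_map_on_def by blast
qed

section \<open>Weighted sequence spaces\<close>

text \<open>The quotient of two weights decays like \<open>exp (- d * m powr t)\<close> for
  \<open>Reg\<close>, and like \<open>d ^ m\<close> for \<open>Flat\<close>, where the factorials
  cancel. Either decay beats the polynomial factor that pays for summing over multi-indices.\<close>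

lemma poly_exp_bounded: 
  fixes d t :: real assumes "0 < d" "0 < t"
  shows "Bseq (\<lambda>m. (1 + real m) ^ k * exp (- d * real m powr t))"
proof -
  have "(\<lambda>m. (1 + real m) ^ k * exp (- d * real m powr t)) \<longlonglongrightarrow> 0"
    using assms by real_asymp
  then show ?thesis by (intro convergent_imp_Bseq convergentI)
qed

lemma poly_geo_bounded: 
  fixes d :: real assumes "0 < d" "d < 1"
  shows "Bseq (\<lambda>m. (1 + real m) ^ k * d ^ m)"
proof -
  have "(\<lambda>m. (1 + real m) ^ k * d ^ m) \<longlonglongrightarrow> 0"
    using assms by real_asymp
  then show ?thesis by (intro convergent_imp_Bseq convergentI)
qed

section \<open>\<open>\<ell>\<^sup>p\<close> norms between the supremum and the
  \<open>\<ell>\<^sup>1\<close> norm\<close>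

lemma one_le_real_of_ereal: "1 \<le> p \<Longrightarrow> p \<noteq> \<infinity> \<Longrightarrow> 1 \<le> real_of_ereal p"
  by (cases p) auto

lemma norm_le_lp_norm:
  assumes "1 \<le> p" "in_lp p c"
  shows "norm (c i) \<le> lp_norm p c"
proof (cases "p = \<infinity>")
  case True
  then obtain B where "\<And>i. norm (c i) \<le> B" using assms(2) by (auto simp: in_lp_def bounded_iff)
  then have "bdd_above (range (\<lambda>i. norm (c i)))" by (intro bdd_aboveI2)
  then show ?thesis using True cSUP_upper[of i UNIV "\<lambda>i. norm (c i)"] by (simp add: lp_norm_def)
next
  case False
  define r where "r = real_of_ereal p"
  have r: "1 \<le> r" unfolding r_def by (rule one_le_real_of_ereal[OF assms(1) False])
  have sm: "(\<lambda>i. norm (c i) powr r) summable_on UNIV"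
    using assms(2) False by (simp add: in_lp_def r_def)
  have "norm (c i) powr r \<le> (\<Sum>\<^sub>\<infinity>i. norm (c i) powr r)"
    using finite_sum_le_infsum[OF sm, of "{i}"] by simp
  then have "(norm (c i) powr r) powr (1 / r) \<le> (\<Sum>\<^sub>\<infinity>i. norm (c i) powr r) powr (1 / r)"
    using r by (intro powr_mono2) auto
  then show ?thesis using r False by (simp add: powr_powr lp_norm_def r_def)
qed

text \<open>Every entry is at most the \<open>\<ell>\<^sup>1\<close> norm \<open>M\<close>, so for
  finite \<open>p\<close> with real value \<open>r\<close> its power is at most
  \<open>M powr (r - 1)\<close> times the entry; summing gives \<open>M powr r\<close>.\<close>

lemma in_lp_of_summable_lp_norm_le:
  assumes "1 \<le> p" and sm: "(\<lambda>i. norm (c i)) summable_on UNIV"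
  shows in_lp_of_summable: "in_lp p c" and lp_norm_le_infsum: "lp_norm p c \<le> (\<Sum>\<^sub>\<infinity>i. norm (c i))"
proof -
  define M where "M = (\<Sum>\<^sub>\<infinity>i. norm (c i))"
  have M: "norm (c i) \<le> M" for i
    unfolding M_def using finite_sum_le_infsum[OF sm, of "{i}"] by simp
  have M0: "0 \<le> M" unfolding M_def by (intro infsum_nonneg) simp
  have "in_lp p c \<and> lp_norm p c \<le> M"
  proof (cases "p = \<infinity>")
    case True
    then show ?thesis using M by (auto simp: in_lp_def lp_norm_def bounded_iff intro!: cSUP_least)
  next
    case False
    define r where "r = real_of_ereal p"
    have r: "1 \<le> r" unfolding r_def by (rule one_le_real_of_ereal[OF assms(1) False])
    have split: "x powr r = x powr (r - 1) * x" if "0 \<le> x" for x :: real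
      using that powr_add[of x "r - 1" 1] by simp
    have le: "norm (c i) powr r \<le> M powr (r - 1) * norm (c i)" for i
      unfolding split[OF norm_ge_zero] using M r by (intro mult_right_mono powr_mono2) auto
    have smM: "(\<lambda>i. M powr (r - 1) * norm (c i)) summable_on UNIV"
      using sm by (rule summable_on_cmult_right)
    have smr: "(\<lambda>i. norm (c i) powr r) summable_on UNIV"
      by (rule summable_on_comparison_test[OF smM]) (use le in auto)
    have "(\<Sum>\<^sub>\<infinity>i. norm (c i) powr r) \<le> (\<Sum>\<^sub>\<infinity>i. M powr (r - 1) * norm (c i))"
      by (rule infsum_mono[OF smr smM le])
    also have "\<dots> = M powr (r - 1) * M" unfolding M_def by (rule infsum_cmult_right')
    also have "\<dots> = M powr r" by (rule split[OF M0, symmetric])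
    finally have "(\<Sum>\<^sub>\<infinity>i. norm (c i) powr r) powr (1 / r) \<le> (M powr r) powr (1 / r)"
      using r by (intro powr_mono2) (auto intro: infsum_nonneg)
    also have "\<dots> = M" using r M0 by (simp add: powr_powr)
    finally show ?thesis using smr False by (simp add: in_lp_def lp_norm_def r_def)
  qed
  then show "in_lp p c" "lp_norm p c \<le> (\<Sum>\<^sub>\<infinity>i. norm (c i))" unfolding M_def by auto
qed

text \<open>Only membership is claimed, so the crude bound of \<open>(u + v) powr r\<close> by
  \<open>(2 * u) powr r + (2 * v) powr r\<close> is enough.\<close>

lemma in_lp_comb:
  assumes "1 \<le> p" "in_lp p x" "in_lp p y"
  shows "in_lp p (\<lambda>i. a * x i + b * y i)"
proof (cases "p = \<infinity>")
  case True
  obtain B C where "\<And>i. norm (x i) \<le> B" "\<And>i. norm (y i) \<le> C"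
    using assms(2,3) True by (auto simp: in_lp_def bounded_iff)
  then have "norm (a * x i + b * y i) \<le> norm a * B + norm b * C" for i
    by (intro norm_triangle_le add_mono) (auto simp: norm_mult intro!: mult_left_mono)
  then show ?thesis using True by (auto simp: in_lp_def bounded_iff)
next
  case False
  define r where "r = real_of_ereal p"
  have r: "1 \<le> r" unfolding r_def by (rule one_le_real_of_ereal[OF assms(1) False])
  have le: "norm (a * x i + b * y i) powr r \<le>
      (2 * norm a) powr r * norm (x i) powr r + (2 * norm b) powr r * norm (y i) powr r" for i
  proof -
    define m where "m = max (norm a * norm (x i)) (norm b * norm (y i))"
    have "norm (a * x i + b * y i) \<le> norm a * norm (x i) + norm b * norm (y i)"
      by (metis norm_mult norm_triangle_ineq)
    also have "\<dots> \<le> 2 * m" unfolding m_def by simp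
    finally have "norm (a * x i + b * y i) powr r \<le> (2 * m) powr r"
      using r by (intro powr_mono2) auto
    also have "(2 * m) powr r \<le> (2 * norm a * norm (x i)) powr r + (2 * norm b * norm (y i)) powr r"
      unfolding m_def by (auto simp: max_def mult.assoc)
    finally show ?thesis by (simp add: powr_mult)
  qed
  have "(\<lambda>i. (2 * norm a) powr r * norm (x i) powr r + (2 * norm b) powr r * norm (y i) powr r)
      summable_on UNIV"
    using assms(2,3) False by (intro summable_on_add summable_on_cmult_right) (auto simp: in_lp_def r_def)
  then have "(\<lambda>i. norm (a * x i + b * y i) powr r) summable_on UNIV"
    by (rule summable_on_comparison_test) (use le in auto)
  then show ?thesis using False by (simp add: in_lp_def r_def)
qed

lemma wlp_subspace:
  assumes "1 \<le> p" shows "lin_subspace (wlp p v)"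
  unfolding lin_subspace_def
proof (intro conjI ballI allI)
  show "(\<lambda>_. 0) \<in> wlp p v" using in_lp_of_summable[OF assms, of "\<lambda>_. 0"] by (simp add: wlp_def)
  fix x y a b assume "x \<in> wlp p v" "y \<in> wlp p v"
  then have "in_lp p (\<lambda>i. a * (x i * of_real (v i)) + b * (y i * of_real (v i)))"
    unfolding wlp_def by (intro in_lp_comb[OF assms]) auto
  then show "(\<lambda>i. a * x i + b * y i) \<in> wlp p v" unfolding wlp_def by (simp add: algebra_simps)
qed

lemma wlp_coord_le:
  assumes "1 \<le> p" "x \<in> wlp p v" "\<And>a. 0 \<le> v a"
  shows "norm (x a) * v a \<le> wlp_norm p v x"
  using norm_le_lp_norm[of p "\<lambda>i. x i * of_real (v i)" a] assms
  by (simp add: wlp_def wlp_norm_def norm_mult)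

lemma wlp_of_summable:
  assumes "1 \<le> p" "(\<lambda>a. norm (x a) * v a) summable_on UNIV" "\<And>a. 0 \<le> v a"
  shows "x \<in> wlp p v" "wlp_norm p v x \<le> (\<Sum>\<^sub>\<infinity>a. norm (x a) * v a)"
  using in_lp_of_summable_lp_norm_le[of p "\<lambda>i. x i * of_real (v i)"] assms
  by (simp_all add: wlp_def wlp_norm_def norm_mult)

lemma weighted_steps_wlp:
  assumes "1 \<le> p" "\<And>i a. i \<in> I \<Longrightarrow> 0 < v i a"
  shows "weighted_steps I (\<lambda>i. wlp p (v i)) (\<lambda>i. wlp_norm p (v i)) v"
proof unfold_locales
  have nn: "0 \<le> v i a" if "i \<in> I" for i a using assms(2)[OF that] by (rule less_imp_le)
  show "lin_subspace (wlp p (v i))" for i by (rule wlp_subspace[OF assms(1)])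
  show "0 \<le> v i a" if "i \<in> I" for i a by (rule nn[OF that])
  show "norm (x a) * v i a \<le> wlp_norm p (v i) x" if "i \<in> I" "x \<in> wlp p (v i)" for i x a
    by (rule wlp_coord_le[OF assms(1) that(2) nn[OF that(1)]])
  show "wlp_norm p (v i) x \<le> (\<Sum>\<^sub>\<infinity>a. norm (x a) * v i a)"
    if "i \<in> I" "(\<lambda>a. norm (x a) * v i a) summable_on UNIV" for i x
    by (rule wlp_of_summable(2)[OF assms(1) that(2) nn[OF that(1)]])
qed

text \<open>The entries satisfy a weighted supremum bound for every \<open>p\<close>. The summable
  quotient of the weights then turns it into an \<open>\<ell>\<^sup>1\<close> bound for the weaker
  weight.\<close>

lemma wlp_summable:
  assumes "1 \<le> p" "x \<in> wlp p v" "\<And>a. 0 < v a" "\<And>a. 0 < w a" "(\<lambda>a. w a / v a) summable_on UNIV"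
  shows "(\<lambda>a. norm (x a) * w a) summable_on UNIV"
proof (rule summable_on_comparison_test)
  show "(\<lambda>a. wlp_norm p v x * (w a / v a)) summable_on UNIV"
    using assms(5) by (rule summable_on_cmult_right)
  show "norm (x a) * w a \<le> wlp_norm p v x * (w a / v a)" for a
    using mult_right_mono[OF wlp_coord_le[OF assms(1,2), of a], of "w a / v a"]
      assms(3)[of a] assms(4)[of a] less_imp_le[OF assms(3)] by simp
  show "0 \<le> norm (x a) * w a" for a using assms(4)[of a] by simp
qed

lemma projective_steps_wlp:
  assumes "1 \<le> p" "I \<noteq> {}" "\<And>i a. i \<in> I \<Longrightarrow> 0 < v i a"
    and "\<And>i. i \<in> I \<Longrightarrow> \<exists>j\<in>I. (\<lambda>a. v i a / v j a) summable_on UNIV"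
  shows "projective_steps I (\<lambda>i. wlp p (v i)) (\<lambda>i. wlp_norm p (v i)) v"
proof -
  interpret weighted_steps I "\<lambda>i. wlp p (v i)" "\<lambda>i. wlp_norm p (v i)" v
    by (rule weighted_steps_wlp[OF assms(1,3)])
  show ?thesis
  proof unfold_locales
    show "\<exists>i\<in>I. 0 < v i a" for a using assms(2,3) by blast
    show "\<exists>j\<in>I. \<forall>x\<in>wlp p (v j). (\<lambda>a. norm (x a) * v i a) summable_on UNIV" if i: "i \<in> I" for i
    proof -
      obtain j where j: "j \<in> I" "(\<lambda>a. v i a / v j a) summable_on UNIV" using assms(4)[OF i] by blast
      with i assms(1,3) show ?thesis by (intro bexI[of _ j] ballI wlp_summable[of p _ "v j" "v i"]) auto
    qed
    show "x \<in> wlp p (v i)" if "i \<in> I" "(\<lambda>a. norm (x a) * v i a) summable_on UNIV" for i x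
      using wlp_of_summable(1)[OF assms(1) that(2)] assms(3)[OF that(1)] less_imp_le by blast
  qed
qed

lemma wlp_finite_support:
  assumes "1 \<le> p" "\<And>a. 0 \<le> v a"
  shows "finite_support \<subseteq> wlp p v"
proof
  fix x :: "'a \<Rightarrow> complex" assume "x \<in> finite_support"
  then have "(\<lambda>a. norm (x a) * v a) summable_on {a. x a \<noteq> 0}"
    unfolding finite_support_def by simp
  also have "?this \<longleftrightarrow> (\<lambda>a. norm (x a) * v a) summable_on UNIV"
    by (rule summable_on_cong_neutral) auto
  finally show "x \<in> wlp p v" using wlp_of_summable(1) assms by blast
qed

text \<open>Summable quotients give more than inclusions of the steps: they send both spaces into
  the weighted \<open>\<ell>\<^sup>1\<close> space of \<open>v k\<close>. Hence \<open>dir\<close>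
  yields directedness, and with \<open>i = j\<close> also \<open>nuclear\<close>.\<close>

lemma inductive_steps_wlp:
  assumes "1 \<le> p" "I \<noteq> {}" and pos: "\<And>i a. i \<in> I \<Longrightarrow> 0 < v i a"
    and dir: "\<And>i j. i \<in> I \<Longrightarrow> j \<in> I \<Longrightarrow>
      \<exists>k\<in>I. (\<lambda>a. v k a / v i a) summable_on UNIV \<and> (\<lambda>a. v k a / v j a) summable_on UNIV"
  shows "inductive_steps I (\<lambda>i. wlp p (v i)) (\<lambda>i. wlp_norm p (v i)) v"
proof -
  interpret weighted_steps I "\<lambda>i. wlp p (v i)" "\<lambda>i. wlp_norm p (v i)" v
    by (rule weighted_steps_wlp[OF assms(1) pos])
  have sm: "(\<lambda>a. norm (x a) * v k a) summable_on UNIV"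
    if "i \<in> I" "k \<in> I" "(\<lambda>a. v k a / v i a) summable_on UNIV" "x \<in> wlp p (v i)" for i k x
    using that pos by (intro wlp_summable[OF assms(1), of x "v i" "v k"]) auto
  have sub: "x \<in> wlp p (v k)" if "k \<in> I" "(\<lambda>a. norm (x a) * v k a) summable_on UNIV" for k x
    using wlp_of_summable(1)[OF assms(1) that(2)] pos[OF that(1)] less_imp_le by blast
  show ?thesis
  proof unfold_locales
    show "0 < v i a" if "i \<in> I" for i a by (rule pos[OF that])
    show "\<exists>k\<in>I. wlp p (v i) \<union> wlp p (v j) \<subseteq> wlp p (v k)" if ij: "i \<in> I" "j \<in> I" for i j
    proof -
      obtain k where k: "k \<in> I" "(\<lambda>a. v k a / v i a) summable_on UNIV"
          "(\<lambda>a. v k a / v j a) summable_on UNIV" using dir[OF ij] by blast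
      then show ?thesis using ij sm sub by (intro bexI[of _ k]) blast+
    qed
    show "\<exists>j\<in>I. x \<in> wlp p (v j) \<and> (\<lambda>a. norm (x a) * v j a) summable_on UNIV"
      if i: "i \<in> I" and x: "x \<in> wlp p (v i)" for i x
    proof -
      obtain k where k: "k \<in> I" "(\<lambda>a. v k a / v i a) summable_on UNIV" using dir[OF i i] by blast
      then show ?thesis using i x sm sub by (intro bexI[of _ k]) blast+
    qed
    show "restr A x \<in> wlp p (v i)" if "i \<in> I" "x \<in> wlp p (v i)" "finite A" for i x A
      using wlp_finite_support[OF assms(1), of "v i"] pos[OF that(1)] less_imp_le
        restr_finite_support[OF that(3), of x] by blast
    show "\<exists>i\<in>I. x \<in> wlp p (v i)" if "x \<in> finite_support" for x
    proof -
      obtain i where "i \<in> I" using assms(2) by blast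
      then show ?thesis using wlp_finite_support[OF assms(1), of "v i"] pos that
        by (intro bexI[of _ i]) (auto intro: less_imp_le)
    qed
  qed
qed

section \<open>Truncations: the spaces with index \<open>Zero\<close>\<close>

lemma finite_mi_abs_le: "finite {\<alpha> :: 'n::finite \<Rightarrow> nat. mi_abs \<alpha> \<le> N}"
proof (rule finite_subset)
  have "\<alpha> i \<le> mi_abs \<alpha>" for \<alpha> :: "'n \<Rightarrow> nat" and i
    unfolding mi_abs_def by (intro member_le_sum) auto
  then show "{\<alpha> :: 'n \<Rightarrow> nat. mi_abs \<alpha> \<le> N} \<subseteq> UNIV \<rightarrow>\<^sub>E {..N}"
    using order_trans by (fastforce simp: PiE_UNIV_domain)
qed (intro finite_PiE; simp)

lemma truncate_mi_summable:
  fixes x :: "('n::finite \<Rightarrow> nat) \<Rightarrow> complex"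
  shows "(\<lambda>\<alpha>. norm (truncate_mi N x \<alpha>)) summable_on UNIV"
proof -
  have "(\<lambda>\<alpha>. norm (truncate_mi N x \<alpha>)) summable_on {\<alpha>. mi_abs \<alpha> \<le> N}"
    by (intro summable_on_finite finite_mi_abs_le)
  also have "?this \<longleftrightarrow> (\<lambda>\<alpha>. norm (truncate_mi N x \<alpha>)) summable_on UNIV"
    by (rule summable_on_cong_neutral) (auto simp: truncate_mi_def)
  finally show ?thesis .
qed

text \<open>All steps are the whole space of sequences and only the seminorm varies. Its weight is
  the indicator of the multi-indices of order at most \<open>N\<close>, so the coordinate
  \<open>\<alpha>\<close> is controlled from \<open>N = mi_abs \<alpha>\<close> on.\<close>

lemma projective_steps_truncate:
  assumes "1 \<le> p"
  shows "projective_steps UNIV (\<lambda>_. UNIV) (\<lambda>N (c :: ('n::finite \<Rightarrow> nat) \<Rightarrow> complex). lp_norm p (truncate_mi N c))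
    (\<lambda>N \<alpha>. if mi_abs \<alpha> \<le> N then 1 else 0)"
proof unfold_locales
  fix N and x :: "('n \<Rightarrow> nat) \<Rightarrow> complex" and \<alpha> :: "'n \<Rightarrow> nat"
  have eq: "norm (truncate_mi N x \<alpha>) = norm (x \<alpha>) * (if mi_abs \<alpha> \<le> N then 1 else 0)" for N \<alpha> and x :: "('n \<Rightarrow> nat) \<Rightarrow> complex"
    by (simp add: truncate_mi_def)
  note t = in_lp_of_summable_lp_norm_le[OF assms truncate_mi_summable]
  show "lin_subspace (UNIV :: (('n \<Rightarrow> nat) \<Rightarrow> complex) set)" by (simp add: lin_subspace_def)
  show "norm (x \<alpha>) * (if mi_abs \<alpha> \<le> N then 1 else 0) \<le> lp_norm p (truncate_mi N x)"
    unfolding eq[symmetric] by (intro norm_le_lp_norm assms t)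
  show "lp_norm p (truncate_mi N x) \<le> (\<Sum>\<^sub>\<infinity>\<alpha>. norm (x \<alpha>) * (if mi_abs \<alpha> \<le> N then 1 else 0))"
    unfolding eq[symmetric] by (rule t)
  show "\<exists>i\<in>UNIV. 0 < (if mi_abs \<alpha> \<le> i then 1 else 0 :: real)"
    by (intro bexI[of _ "mi_abs \<alpha>"]) auto
  show "\<exists>j\<in>UNIV. \<forall>x :: ('n \<Rightarrow> nat) \<Rightarrow> complex\<in>UNIV.
      (\<lambda>\<alpha>. norm (x \<alpha>) * (if mi_abs \<alpha> \<le> N then 1 else 0)) summable_on UNIV"
    unfolding eq[symmetric] using truncate_mi_summable by blast
qed auto

lemma finite_support_bounded:
  fixes x :: "('n::finite \<Rightarrow> nat) \<Rightarrow> complex"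
  shows "x \<in> finite_support \<longleftrightarrow> (\<exists>N. \<forall>\<alpha>. mi_abs \<alpha> > N \<longrightarrow> x \<alpha> = 0)"
proof
  assume "x \<in> finite_support"
  then have fin: "finite (mi_abs ` {\<alpha>. x \<alpha> \<noteq> 0})" by (simp add: finite_support_def)
  have "mi_abs \<alpha> \<le> Max (insert 0 (mi_abs ` {\<alpha>. x \<alpha> \<noteq> 0}))" if "x \<alpha> \<noteq> 0" for \<alpha>
    using fin that by (intro Max_ge) auto
  then show "\<exists>N. \<forall>\<alpha>. mi_abs \<alpha> > N \<longrightarrow> x \<alpha> = 0" by (meson not_le)
next
  assume "\<exists>N. \<forall>\<alpha>. mi_abs \<alpha> > N \<longrightarrow> x \<alpha> = 0"
  then obtain N where "{\<alpha>. x \<alpha> \<noteq> 0} \<subseteq> {\<alpha>. mi_abs \<alpha> \<le> N}" by (auto simp: not_less[symmetric])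
  then show "x \<in> finite_support"
    unfolding finite_support_def using finite_mi_abs_le by (auto intro: finite_subset)
qed

text \<open>The constant weight 1 suffices: the sequences of a step live on a finite set, where
  \<open>\<ell>\<^sup>1\<close> sums are finite.\<close>

lemma inductive_steps_truncate:
  assumes "1 \<le> p"
  shows "inductive_steps UNIV (\<lambda>N. {c :: ('n::finite \<Rightarrow> nat) \<Rightarrow> complex. \<forall>\<alpha>. mi_abs \<alpha> > N \<longrightarrow> c \<alpha> = 0})
    (\<lambda>_. lp_norm p) (\<lambda>_ _. 1)"
proof unfold_locales
  fix N N' and x :: "('n \<Rightarrow> nat) \<Rightarrow> complex" and A :: "('n \<Rightarrow> nat) set" and \<alpha> :: "'n \<Rightarrow> nat"
  assume x: "x \<in> {c. \<forall>\<alpha>. mi_abs \<alpha> > N \<longrightarrow> c \<alpha> = 0}"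
  then have "truncate_mi N x = x" by (auto simp: truncate_mi_def)
  then have sm: "(\<lambda>\<alpha>. norm (x \<alpha>)) summable_on UNIV" using truncate_mi_summable[of N x] by simp
  note t = in_lp_of_summable_lp_norm_le[OF assms sm]
  show "norm (x \<alpha>) * 1 \<le> lp_norm p x" using norm_le_lp_norm[OF assms t(1)] by simp
  show "lp_norm p x \<le> (\<Sum>\<^sub>\<infinity>\<alpha>. norm (x \<alpha>) * 1)" using t(2) by simp
  show "\<exists>j\<in>UNIV. x \<in> {c. \<forall>\<alpha>. mi_abs \<alpha> > j \<longrightarrow> c \<alpha> = 0} \<and> (\<lambda>\<alpha>. norm (x \<alpha>) * 1) summable_on UNIV"
    using x sm by (intro bexI[of _ N]) simp_all
  show "restr A x \<in> {c. \<forall>\<alpha>. mi_abs \<alpha> > N \<longrightarrow> c \<alpha> = 0}"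
    using x by (simp add: restr_def)
next
  fix N N' :: nat
  show "lin_subspace {c :: ('n \<Rightarrow> nat) \<Rightarrow> complex. \<forall>\<alpha>. mi_abs \<alpha> > N \<longrightarrow> c \<alpha> = 0}"
    by (simp add: lin_subspace_def)
  show "\<exists>k\<in>UNIV. {c :: ('n \<Rightarrow> nat) \<Rightarrow> complex. \<forall>\<alpha>. mi_abs \<alpha> > N \<longrightarrow> c \<alpha> = 0} \<union>
      {c. \<forall>\<alpha>. mi_abs \<alpha> > N' \<longrightarrow> c \<alpha> = 0} \<subseteq> {c. \<forall>\<alpha>. mi_abs \<alpha> > k \<longrightarrow> c \<alpha> = 0}"
    by (intro bexI[of _ "max N N'"]) auto
qed (auto simp: finite_support_bounded)

section \<open>Summability over multi-indices and nuclearity of the weights\<close>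

lemma summable_on_mi_abs:
  fixes f :: "nat \<Rightarrow> real"
  assumes "\<And>m. 0 \<le> f m" and "Bseq (\<lambda>m. (1 + real m) ^ (2 * CARD('n::finite)) * f m)"
  shows "(\<lambda>\<alpha> :: 'n \<Rightarrow> nat. f (mi_abs \<alpha>)) summable_on UNIV"
proof -
  define g where "g m = 1 / (1 + real m) ^ 2" for m
  have "summable (\<lambda>n. inverse (real (Suc n) ^ 2))"
    using inverse_power_summable[of 2, where 'a = real] by (subst summable_Suc_iff) auto
  then have "summable g" unfolding g_def by (simp add: field_simps)
  moreover have g: "0 < g m" for m unfolding g_def by simp
  ultimately have gs: "g summable_on UNIV"
    by (intro summable_nonneg_imp_summable_on) (auto intro: less_imp_le)
  then have "(\<lambda>x. norm (g x)) summable_on UNIV" using g by (simp add: less_imp_le)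
  then have "(\<Sum>\<^sub>\<infinity>\<alpha>\<in>UNIV \<rightarrow>\<^sub>E UNIV. \<Prod>i\<in>(UNIV :: 'n set). g (\<alpha> i)) = (\<Prod>i\<in>(UNIV :: 'n set). infsum g UNIV)"
    by (intro infsum_prod_PiE_abs) auto
  \<comment> \<open>The product formula equates two sums without asserting that the left one
    converges. A divergent sum would be 0, so positivity of the right side proves
    convergence.\<close>
  moreover have "0 < infsum g UNIV"
  proof -
    have "0 < g 0" by (rule g)
    also have "g 0 \<le> infsum g UNIV"
      using finite_sum_le_infsum[OF gs, of "{0}"] g less_imp_le by auto
    finally show ?thesis .
  qed
  ultimately have "(\<Sum>\<^sub>\<infinity>\<alpha>. \<Prod>i\<in>(UNIV :: 'n set). g (\<alpha> i)) \<noteq> 0" by simp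
  then have gp: "(\<lambda>\<alpha>. \<Prod>i\<in>(UNIV :: 'n set). g (\<alpha> i)) summable_on UNIV"
    using infsum_not_exists by blast
  obtain B where B: "\<And>m. norm ((1 + real m) ^ (2 * CARD('n)) * f m) \<le> B"
    using assms(2) by (auto simp: Bseq_def)
  have "(\<lambda>\<alpha>. B * (\<Prod>i\<in>(UNIV :: 'n set). g (\<alpha> i))) summable_on UNIV"
    using gp by (rule summable_on_cmult_right)
  then show ?thesis
  proof (rule summable_on_comparison_test)
    fix \<alpha> :: "'n \<Rightarrow> nat"
    let ?m = "real (mi_abs \<alpha>)"
    \<comment> \<open>The origin of the exponent \<open>2 * CARD('n)\<close>: each factor of the
      summable comparison family costs at most a square of \<open>1 + ?m\<close>.\<close>
    have "(\<Prod>i\<in>(UNIV :: 'n set). (1 + real (\<alpha> i)) ^ 2) \<le> (\<Prod>i\<in>(UNIV :: 'n set). (1 + ?m) ^ 2)"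
    proof (intro prod_mono conjI power_mono)
      fix i
      have "\<alpha> i \<le> mi_abs \<alpha>" unfolding mi_abs_def by (intro member_le_sum) auto
      then show "1 + real (\<alpha> i) \<le> 1 + ?m" by simp
    qed auto
    also have "\<dots> = (1 + ?m) ^ (2 * CARD('n))" by (simp add: power_mult)
    finally have le: "(\<Prod>i\<in>(UNIV :: 'n set). (1 + real (\<alpha> i)) ^ 2) * f (mi_abs \<alpha>) \<le> B"
      using B[of "mi_abs \<alpha>"] assms(1)[of "mi_abs \<alpha>"]
      by (smt (verit) mult_right_mono real_norm_def)
    have "(\<Prod>i\<in>(UNIV :: 'n set). g (\<alpha> i)) * (\<Prod>i\<in>(UNIV :: 'n set). (1 + real (\<alpha> i)) ^ 2) = 1"
      unfolding g_def prod.distrib[symmetric] by (intro prod.neutral) simp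
    then have "f (mi_abs \<alpha>) = (\<Prod>i\<in>(UNIV :: 'n set). g (\<alpha> i)) *
        ((\<Prod>i\<in>(UNIV :: 'n set). (1 + real (\<alpha> i)) ^ 2) * f (mi_abs \<alpha>))"
      by (simp add: mult.assoc[symmetric])
    also have "\<dots> \<le> (\<Prod>i\<in>(UNIV :: 'n set). g (\<alpha> i)) * B"
      using g by (intro mult_left_mono le prod_nonneg) (auto intro: less_imp_le)
    finally show "f (mi_abs \<alpha>) \<le> B * (\<Prod>i\<in>(UNIV :: 'n set). g (\<alpha> i))" by (simp add: mult.commute)
    show "0 \<le> f (mi_abs \<alpha>)" by (rule assms(1))
  qed
qed

lemma mi_fact_pos: "0 < mi_fact \<alpha>"
  unfolding mi_fact_def by (intro prod_pos) simp

lemma weight_pos: "s \<in> R_flat \<Longrightarrow> 0 < r \<Longrightarrow> 0 < weight s r \<alpha>"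
  by (auto simp: R_flat_def less_imp_neq[OF mi_fact_pos, symmetric] intro!: mult_pos_pos)

lemma weight_ratio_summable:
  assumes "s \<in> R_flat" "0 < r" "r < r'"
  shows "(\<lambda>\<alpha> :: 'n::finite \<Rightarrow> nat. weight s r \<alpha> / weight s r' \<alpha>) summable_on UNIV"
proof -
  consider t where "s = Reg t" "0 < t" | t where "s = Flat t" "0 < t"
    using assms(1) by (auto simp: R_flat_def)
  then show ?thesis
  proof cases
    case 1
    have "weight s r \<alpha> / weight s r' \<alpha> = exp (- (r' - r) * real (mi_abs \<alpha>) powr (1 / (2 * t)))" for \<alpha> :: "'n \<Rightarrow> nat"
      unfolding 1 by (simp add: exp_diff[symmetric] algebra_simps)
    moreover have "(\<lambda>\<alpha> :: 'n \<Rightarrow> nat. exp (- (r' - r) * real (mi_abs \<alpha>) powr (1 / (2 * t)))) summable_on UNIV"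
      using 1(2) assms(3) poly_exp_bounded[of "r' - r" "1 / (2 * t)"] by (intro summable_on_mi_abs) auto
    ultimately show ?thesis by simp
  next
    case 2
    have "weight s r \<alpha> / weight s r' \<alpha> = (r / r') ^ mi_abs \<alpha>" for \<alpha> :: "'n \<Rightarrow> nat"
      unfolding 2 using mi_fact_pos[of \<alpha>] by (simp add: power_divide)
    moreover have "(\<lambda>\<alpha> :: 'n \<Rightarrow> nat. (r / r') ^ mi_abs \<alpha>) summable_on UNIV"
      using assms(2,3) by (intro summable_on_mi_abs poly_geo_bounded) auto
    ultimately show ?thesis by simp
  qed
qed

lemma mi_abs_Plus: "mi_abs \<gamma> = mi_abs (\<gamma> \<circ> Inl) + mi_abs (\<gamma> \<circ> Inr)"
  unfolding mi_abs_def UNIV_Plus_UNIV[symmetric] by (subst sum.Plus) auto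

lemma mi_fact_Plus: "mi_fact \<gamma> = mi_fact (\<gamma> \<circ> Inl) * mi_fact (\<gamma> \<circ> Inr)"
  unfolding mi_fact_def UNIV_Plus_UNIV[symmetric] by (subst prod.Plus) auto

text \<open>For \<open>Flat\<close> the weight is exactly multiplicative and \<open>c = 1\<close>.
  For \<open>Reg\<close> the exponent may lie on either side of 1, but \<open>(a + b) powr u\<close>
  and \<open>a powr u + b powr u\<close> agree up to a factor, which is absorbed into the parameter
  \<open>r\<close>.\<close>

lemma weight_Plus:
  assumes "s \<in> R_flat"
  obtains c where "1 \<le> c"
    "\<And>r (\<gamma> :: 'm::finite + 'n::finite \<Rightarrow> nat). 0 < r \<Longrightarrow> weight s r \<gamma> \<le> weight s (c * r) (\<gamma> \<circ> Inl) * weight s (c * r) (\<gamma> \<circ> Inr)"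
    "\<And>r (\<gamma> :: 'm::finite + 'n::finite \<Rightarrow> nat). 0 < r \<Longrightarrow> weight s r (\<gamma> \<circ> Inl) * weight s r (\<gamma> \<circ> Inr) \<le> weight s (c * r) \<gamma>"
proof -
  consider t where "s = Reg t" "0 < t" | t where "s = Flat t" "0 < t"
    using assms by (auto simp: R_flat_def)
  then show ?thesis
  proof cases
    case 1
    define u where "u = 1 / (2 * t)"
    have u: "0 < u" using 1(2) by (simp add: u_def)
    \<comment> \<open>\<open>2 powr u\<close> serves \<open>upper\<close>, through
      \<open>a + b \<le> 2 * max a b\<close>; the 2 serves \<open>lower\<close>, through
      monotonicity in each summand.\<close>
    define c where "c = max 2 (2 powr u)"
    have upper: "(a + b) powr u \<le> c * (a powr u + b powr u)" if "0 \<le> a" "0 \<le> b" for a b :: real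
    proof -
      have "(a + b) powr u \<le> (2 * max a b) powr u" using that u by (intro powr_mono2) auto
      also have "\<dots> = 2 powr u * max a b powr u" using that by (simp add: powr_mult)
      also have "\<dots> \<le> c * (a powr u + b powr u)"
        using that unfolding c_def by (intro mult_mono) (auto simp: max_def)
      finally show ?thesis .
    qed
    have lower: "a powr u + b powr u \<le> c * (a + b) powr u" if "0 \<le> a" "0 \<le> b" for a b :: real
    proof -
      have "a powr u \<le> (a + b) powr u" "b powr u \<le> (a + b) powr u"
        using that u by (auto intro!: powr_mono2)
      then have "a powr u + b powr u \<le> 2 * (a + b) powr u" by simp
      also have "\<dots> \<le> c * (a + b) powr u" unfolding c_def by (intro mult_right_mono) auto
      finally show ?thesis .
    qed
    show ?thesis
    proof (rule that[of c])
      show "1 \<le> c" unfolding c_def by simp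
      fix r :: real and \<gamma> :: "'m + 'n \<Rightarrow> nat" assume r: "0 < r"
      show "weight s r \<gamma> \<le> weight s (c * r) (\<gamma> \<circ> Inl) * weight s (c * r) (\<gamma> \<circ> Inr)"
        using mult_left_mono[OF upper[of "real (mi_abs (\<gamma> \<circ> Inl))" "real (mi_abs (\<gamma> \<circ> Inr))"], of r] r
        unfolding 1 weight.simps mi_abs_Plus[of \<gamma>] u_def[symmetric] exp_add[symmetric]
        by (simp add: algebra_simps)
      show "weight s r (\<gamma> \<circ> Inl) * weight s r (\<gamma> \<circ> Inr) \<le> weight s (c * r) \<gamma>"
        using mult_left_mono[OF lower[of "real (mi_abs (\<gamma> \<circ> Inl))" "real (mi_abs (\<gamma> \<circ> Inr))"], of r] r
        unfolding 1 weight.simps mi_abs_Plus[of \<gamma>] u_def[symmetric] exp_add[symmetric]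
        by (simp add: algebra_simps)
    qed
  next
    case 2
    have "weight s r \<gamma> = weight s r (\<gamma> \<circ> Inl) * weight s r (\<gamma> \<circ> Inr)" for r and \<gamma> :: "'m + 'n \<Rightarrow> nat"
      unfolding 2 weight.simps mi_abs_Plus[of \<gamma>] mi_fact_Plus[of \<gamma>]
      by (simp add: power_add powr_mult)
    then show ?thesis by (intro that[of 1]) auto
  qed
qed

section \<open>Gaussian integrals of monomials\<close>

lemma integrable_lborel_pair_mult:
  fixes f :: "'a::euclidean_space \<Rightarrow> 'c::{real_normed_field,banach,second_countable_topology}"
    and g :: "'b::euclidean_space \<Rightarrow> 'c"
  assumes "integrable lborel f" "integrable lborel g"
  shows "integrable (lborel \<Otimes>\<^sub>M lborel) (\<lambda>z. f (fst z) * g (snd z))"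
    and "(LINT z|(lborel \<Otimes>\<^sub>M lborel). f (fst z) * g (snd z)) = (LINT x|lborel. f x) * (LINT y|lborel. g y)"
proof -
  have [measurable]: "f \<in> borel_measurable borel" "g \<in> borel_measurable borel"
    using assms by (auto simp: measurable_lborel1)
  show *: "integrable (lborel \<Otimes>\<^sub>M lborel) (\<lambda>z. f (fst z) * g (snd z))"
  proof (rule lborel_pair.Fubini_integrable)
    show "integrable lborel (\<lambda>x. LINT y|lborel. norm (f (fst (x, y)) * g (snd (x, y))))"
      using assms by (simp add: norm_mult)
    show "AE x in lborel. integrable lborel (\<lambda>y. f (fst (x, y)) * g (snd (x, y)))"
      using assms(2) by simp
  qed measurable
  have "(LINT z|(lborel \<Otimes>\<^sub>M lborel). f (fst z) * g (snd z)) = (LINT x|lborel. LINT y|lborel. f x * g y)"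
    using lborel_pair.integral_fst'[OF *] by simp
  then show "(LINT z|(lborel \<Otimes>\<^sub>M lborel). f (fst z) * g (snd z)) = (LINT x|lborel. f x) * (LINT y|lborel. g y)"
    by simp
qed

text \<open>Lebesgue measure is determined by its values on boxes, and the preimage of a box is a
  rectangle. This gives access to iterated integrals over real and imaginary part.\<close>

lemma lborel_complex_eq_distr:
  "(lborel :: complex measure) = distr (lborel \<Otimes>\<^sub>M lborel) borel (\<lambda>z. Complex (fst z) (snd z))"
proof (rule lborel_eqI)
  have m[measurable]: "(\<lambda>z. Complex (fst z) (snd z)) \<in> borel_measurable (lborel \<Otimes>\<^sub>M lborel)"
    unfolding lborel_prod measurable_lborel2 by (intro borel_measurable_continuous_onI continuous_intros)
  fix l u :: complex assume lu: "\<And>b. b \<in> Basis \<Longrightarrow> l \<bullet> b \<le> u \<bullet> b"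
  have "(\<lambda>z. Complex (fst z) (snd z)) -` box l u = box (Re l) (Re u) \<times> box (Im l) (Im u)"
    by (auto simp: in_box_complex_iff)
  then have "emeasure (distr (lborel \<Otimes>\<^sub>M lborel) borel (\<lambda>z. Complex (fst z) (snd z))) (box l u) =
      emeasure lborel (box (Re l) (Re u)) * emeasure lborel (box (Im l) (Im u))"
    by (subst emeasure_distr) (auto simp: lborel.emeasure_pair_measure_Times space_pair_measure)
  also have "\<dots> = (\<Prod>b\<in>Basis. (u - l) \<bullet> b)"
    using lu[of 1] lu[of \<i>] by (simp add: Basis_complex_def ennreal_mult')
  finally show "emeasure (distr (lborel \<Otimes>\<^sub>M lborel) borel (\<lambda>z. Complex (fst z) (snd z))) (box l u) =
      ennreal (\<Prod>b\<in>Basis. (u - l) \<bullet> b)" .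
qed simp

lemma borel_measurable_vec_lambda:
  "(\<lambda>f. \<chi> i. f i) \<in> borel_measurable (Pi\<^sub>M UNIV (\<lambda>_ :: 'd::finite. lborel :: complex measure))"
proof (rule borel_measurable_euclidean_space[THEN iffD2], rule ballI)
  fix b :: "complex ^ 'd" assume "b \<in> Basis"
  then obtain i u where b: "b = axis i u" by (auto simp: Basis_vec_def)
  show "(\<lambda>f. (\<chi> i. f i) \<bullet> b) \<in> borel_measurable (Pi\<^sub>M UNIV (\<lambda>_ :: 'd. lborel :: complex measure))"
    unfolding b inner_axis by simp
qed

text \<open>The factors are kept complex, so that an integral over \<open>C^d\<close> splits into
  one complex integral per coordinate. The real basis is indexed by a coordinate together with a
  basis vector of the complex plane.\<close>

lemma lborel_complex_vec_eq_distr: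
  "(lborel :: (complex ^ 'd) measure) = distr (Pi\<^sub>M UNIV (\<lambda>_. lborel)) borel (\<lambda>f. \<chi> i. f i)"
proof (rule lborel_eqI)
  interpret product_sigma_finite "\<lambda>_ :: 'd. lborel :: complex measure" by standard
  note comp = borel_measurable_vec_lambda
  fix l u :: "complex ^ 'd" assume lu: "\<And>b. b \<in> Basis \<Longrightarrow> l \<bullet> b \<le> u \<bullet> b"
  have lui: "l $ i \<bullet> b \<le> u $ i \<bullet> b" if "b \<in> Basis" for i b
    using lu[of "axis i b"] that by (auto simp: Basis_vec_def inner_axis)
  have "(\<lambda>f. \<chi> i. f i) -` box l u \<inter> space (Pi\<^sub>M UNIV (\<lambda>_ :: 'd. lborel :: complex measure)) =
      (\<Pi>\<^sub>E i\<in>UNIV. box (l $ i) (u $ i))"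
    by (auto simp: space_PiM PiE_UNIV_domain Pi_iff mem_box Basis_vec_def inner_axis)
  then have "emeasure (distr (Pi\<^sub>M UNIV (\<lambda>_. lborel)) borel (\<lambda>f. \<chi> i. f i)) (box l u) =
      (\<Prod>i\<in>UNIV. emeasure lborel (box (l $ i) (u $ i)))"
    using comp by (subst emeasure_distr) (auto simp: emeasure_PiM)
  also have "\<dots> = (\<Prod>i\<in>UNIV. ennreal (\<Prod>b\<in>Basis. (u $ i - l $ i) \<bullet> b))"
    using lui by simp
  also have "\<dots> = ennreal (\<Prod>i\<in>UNIV. \<Prod>b\<in>Basis. (u $ i - l $ i) \<bullet> b)"
    using lui by (intro prod_ennreal prod_nonneg) (auto simp: inner_diff_left)
  also have "(\<Prod>i\<in>UNIV. \<Prod>b\<in>Basis. (u $ i - l $ i) \<bullet> b) = (\<Prod>b\<in>Basis. (u - l) \<bullet> b)"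
  proof -
    have "(\<Prod>b\<in>(Basis :: (complex ^ 'd) set). (u - l) \<bullet> b) =
        (\<Prod>(i, b)\<in>UNIV \<times> Basis. (u - l) \<bullet> axis i b)"
    proof (rule prod.reindex_cong)
      show "inj_on (\<lambda>(i, b). axis i b) (UNIV \<times> (Basis :: complex set))"
        by (auto simp: inj_on_def axis_eq_axis)
      show "Basis = (\<lambda>(i, b). axis i b) ` (UNIV \<times> (Basis :: complex set))"
        by (force simp: Basis_vec_def)
    qed auto
    then show ?thesis by (simp add: prod.cartesian_product inner_axis)
  qed
  finally show "emeasure (distr (Pi\<^sub>M UNIV (\<lambda>_. lborel)) borel (\<lambda>f. \<chi> i. f i)) (box l u) =
      ennreal (\<Prod>b\<in>Basis. (u - l) \<bullet> b)" .
qed simp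

section \<open>Gaussian moments in one complex variable\<close>

lemma integral_derivative_eq_0:
  fixes F f :: "real \<Rightarrow> complex"
  assumes "\<And>x. (F has_vector_derivative f x) (at x)" "continuous_on UNIV f" "integrable lborel f"
    and "(F \<longlongrightarrow> 0) at_top" "(F \<longlongrightarrow> 0) at_bot"
  shows "(LINT x|lborel. f x) = 0"
proof -
  have "(LBINT x=-\<infinity>..\<infinity>. f x) = 0 - 0"
  proof (rule interval_integral_FTC_integrable)
    show "set_integrable lborel (einterval (- \<infinity>) \<infinity>) f"
      using assms(3) by (simp add: set_integrable_def)
    show "((F \<circ> real_of_ereal) \<longlongrightarrow> 0) (at_right (- \<infinity>))"
      using assms(5) by (simp add: ereal_tendsto_simps)
    show "((F \<circ> real_of_ereal) \<longlongrightarrow> 0) (at_left \<infinity>)"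
      using assms(4) by (simp add: ereal_tendsto_simps)
    show "isCont f x" for x using assms(2) by (simp add: continuous_on_eq_continuous_at)
  qed (use assms(1) in auto)
  then show ?thesis by (simp add: interval_lebesgue_integral_def set_lebesgue_integral_def)
qed

text \<open>The integrand of the moment of order \<open>(a, b)\<close>, up to the factor
  \<open>1 / pi\<close>. The Gaussian is written with \<open>z * cnj z\<close>, to which the product
  rule applies directly.\<close>

definition gmon :: "nat \<Rightarrow> nat \<Rightarrow> complex \<Rightarrow> complex"
  where "gmon a b z = z ^ a * cnj z ^ b * exp (- (z * cnj z))"

lemma norm_gmon: "norm (gmon a b z) = norm z ^ (a + b) * exp (- (norm z)\<^sup>2)"
  by (simp add: gmon_def norm_mult norm_power power_add complex_norm_square[symmetric]
      del: of_real_power)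

text \<open>Half of the exponent absorbs the power of \<open>norm z\<close>; the other half remains
  integrable, over the plane and along lines.\<close>

lemma gmon_bound: "\<exists>C. \<forall>z. norm (gmon a b z) \<le> C * exp (- (norm z)\<^sup>2 / 2)"
proof -
  have "((\<lambda>x::real. x ^ (a + b) * exp (- x\<^sup>2 / 2)) \<longlongrightarrow> 0) at_top" by real_asymp
  from tendsto_norm_zero[OF this]
  have "\<forall>\<^sub>F x in at_top. norm (x ^ (a + b) * exp (- x\<^sup>2 / 2) :: real) < 1"
    by (rule order_tendstoD(2)) simp
  then obtain R where R: "\<And>x. R \<le> x \<Longrightarrow> norm (x ^ (a + b) * exp (- x\<^sup>2 / 2) :: real) < 1"
    by (auto simp: eventually_at_top_linorder)
  define C where "C = max 1 (\<bar>R\<bar> ^ (a + b))"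
  have C: "x ^ (a + b) * exp (- x\<^sup>2 / 2) \<le> C" if "0 \<le> x" for x
  proof (cases "R \<le> x")
    case True
    then show ?thesis using R[of x] that unfolding C_def by (auto simp: abs_mult)
  next
    case False
    have "x ^ (a + b) * exp (- x\<^sup>2 / 2) \<le> \<bar>R\<bar> ^ (a + b) * 1"
      using that False by (intro mult_mono power_mono) auto
    then show ?thesis unfolding C_def by simp
  qed
  have "norm (gmon a b z) \<le> C * exp (- (norm z)\<^sup>2 / 2)" for z
  proof -
    have "norm (gmon a b z) = (norm z ^ (a + b) * exp (- (norm z)\<^sup>2 / 2)) * exp (- (norm z)\<^sup>2 / 2)"
      unfolding norm_gmon mult.assoc exp_add[symmetric] by simp
    also have "\<dots> \<le> C * exp (- (norm z)\<^sup>2 / 2)" by (intro mult_right_mono C) auto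
    finally show ?thesis .
  qed
  then show ?thesis by blast
qed

lemma continuous_gmon: "continuous_on A (gmon a b)"
  unfolding gmon_def by (intro continuous_intros)

lemma gmon_measurable[measurable]: "gmon a b \<in> borel_measurable borel"
  by (rule borel_measurable_continuous_onI[OF continuous_gmon])

lemma integrable_exp_half_square: "integrable lborel (\<lambda>x::real. exp (- x\<^sup>2 / 2))"
proof -
  have "integrable lborel (\<lambda>x. sqrt (2 * pi) * std_normal_density x)" by simp
  then show ?thesis by (simp add: std_normal_density_def)
qed

lemma integral_exp_square: "integrable lborel (\<lambda>x::real. exp (- x\<^sup>2))"
    "(LINT x|lborel. exp (- x\<^sup>2)) = sqrt pi"
proof -
  have eq: "exp (- x\<^sup>2) = sqrt pi * normal_density 0 (1 / sqrt 2) x" for x :: real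
    by (simp add: normal_density_def power_divide)
  show "integrable lborel (\<lambda>x::real. exp (- x\<^sup>2))" unfolding eq by simp
  show "(LINT x|lborel. exp (- x\<^sup>2)) = sqrt pi" unfolding eq by simp
qed

lemma integrable_gmon: "integrable lborel (gmon a b)"
proof -
  obtain C where C: "\<And>z. norm (gmon a b z) \<le> C * exp (- (norm z)\<^sup>2 / 2)" using gmon_bound by blast
  have "integrable (lborel \<Otimes>\<^sub>M lborel) (\<lambda>z. exp (- (fst z)\<^sup>2 / 2) * exp (- (snd z)\<^sup>2 / 2) :: real)"
    by (rule integrable_lborel_pair_mult(1)[OF integrable_exp_half_square integrable_exp_half_square])
  also have "(\<lambda>z. exp (- (fst z)\<^sup>2 / 2) * exp (- (snd z)\<^sup>2 / 2) :: real) =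
      (\<lambda>z. exp (- (norm (Complex (fst z) (snd z)))\<^sup>2 / 2))"
    by (auto simp: exp_add[symmetric] cmod_power2 field_simps)
  finally have "integrable (lborel :: complex measure) (\<lambda>z. exp (- (norm z)\<^sup>2 / 2))"
    unfolding lborel_complex_eq_distr
    by (subst integrable_distr_eq) (auto intro!: borel_measurable_continuous_onI continuous_intros simp: lborel_prod)
  then have "integrable (lborel :: complex measure) (\<lambda>z. C * exp (- (norm z)\<^sup>2 / 2))" by simp
  then show ?thesis
  proof (rule Bochner_Integration.integrable_bound)
    show "AE z in lborel. norm (gmon a b z) \<le> norm (C * exp (- (norm z)\<^sup>2 / 2))"
      using C by (intro AE_I2) (metis abs_ge_self order_trans real_norm_def)
  qed simp
qed

text \<open>The chain rule with Wirtinger derivatives: \<open>\<omega>\<close> multiplies the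
  derivative in \<open>z\<close>, \<open>cnj \<omega>\<close> the one in the conjugate variable. The
  truncated \<open>a - 1\<close> and \<open>b - 1\<close> at 0 are harmless, as their coefficients
  vanish there.\<close>

lemma gmon_along_line:
  fixes \<zeta> :: "real \<Rightarrow> complex"
  assumes "(\<zeta> has_vector_derivative \<omega>) (at t)"
  shows "((\<lambda>t. gmon a b (\<zeta> t)) has_vector_derivative
    (of_nat a * \<omega> * gmon (a - 1) b (\<zeta> t) + of_nat b * cnj \<omega> * gmon a (b - 1) (\<zeta> t)
      - cnj \<omega> * gmon (a + 1) b (\<zeta> t) - \<omega> * gmon a (b + 1) (\<zeta> t))) (at t)"
proof -
  have c: "((\<lambda>t. cnj (\<zeta> t)) has_vector_derivative cnj \<omega>) (at t)"
    using assms by (rule has_vector_derivative_cnj)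
  have pw: "((\<lambda>t. f t ^ n) has_vector_derivative d * (of_nat n * f t ^ (n - 1))) (at t)"
    if "(f has_vector_derivative d) (at t)" for f :: "real \<Rightarrow> complex" and d n
    using field_vector_diff_chain_at[OF that DERIV_power[OF DERIV_ident, of n "f t"]]
    by (simp add: o_def mult.commute)
  have e: "((\<lambda>t. exp (- (\<zeta> t * cnj (\<zeta> t)))) has_vector_derivative
      (- (\<zeta> t * cnj \<omega> + \<omega> * cnj (\<zeta> t))) * exp (- (\<zeta> t * cnj (\<zeta> t)))) (at t)"
    using field_vector_diff_chain_at[OF has_vector_derivative_minus[OF has_vector_derivative_mult[OF assms c]] DERIV_exp]
    by (simp add: o_def)
  show ?thesis
    unfolding gmon_def
    using has_vector_derivative_mult[OF has_vector_derivative_mult[OF pw[OF assms, of a] pw[OF c, of b]] e]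
    by (rule back_subst[of "\<lambda>D. (_ has_vector_derivative D) (at t)"]) (simp add: algebra_simps)
qed

lemma gmon_tendsto_0:
  assumes "filterlim (\<lambda>t. norm (\<zeta> t)) at_top F"
  shows "((\<lambda>t. gmon a b (\<zeta> t)) \<longlongrightarrow> 0) F"
proof -
  have "((\<lambda>x::real. x ^ (a + b) * exp (- x\<^sup>2)) \<longlongrightarrow> 0) at_top" by real_asymp
  from filterlim_compose[OF this assms] show ?thesis
    by (intro tendsto_norm_zero_cancel[of "\<lambda>t. gmon a b (\<zeta> t)"]) (simp add: norm_gmon)
qed

lemma gmon_integrable_line:
  assumes "\<And>t. (norm (\<zeta> t))\<^sup>2 \<ge> t\<^sup>2" "continuous_on UNIV \<zeta>"
  shows "integrable lborel (\<lambda>t. gmon a b (\<zeta> t))"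
proof -
  obtain C where C: "\<And>z. norm (gmon a b z) \<le> C * exp (- (norm z)\<^sup>2 / 2)" using gmon_bound by blast
  have C0: "0 \<le> C" using order_trans[OF norm_ge_zero C[of 0]] by simp
  show ?thesis
  proof (rule Bochner_Integration.integrable_bound)
    show "integrable lborel (\<lambda>t. C * exp (- t\<^sup>2 / 2))" using integrable_exp_half_square by simp
    have "norm (gmon a b (\<zeta> t)) \<le> norm (C * exp (- t\<^sup>2 / 2))" for t
    proof -
      have "norm (gmon a b (\<zeta> t)) \<le> C * exp (- (norm (\<zeta> t))\<^sup>2 / 2)" by (rule C)
      also have "\<dots> \<le> C * exp (- t\<^sup>2 / 2)" using assms(1)[of t] C0 by (intro mult_left_mono) auto
      finally show ?thesis using C0 by simp
    qed
    then show "AE t in lborel. norm (gmon a b (\<zeta> t)) \<le> norm (C * exp (- t\<^sup>2 / 2))" by (intro AE_I2)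
    show "(\<lambda>t. gmon a b (\<zeta> t)) \<in> borel_measurable lborel"
      unfolding measurable_lborel2
      by (intro borel_measurable_continuous_onI continuous_on_compose2[OF continuous_gmon assms(2)]) auto
  qed
qed

text \<open>The derivative of \<open>gmon a b\<close> in the direction \<open>\<omega>\<close>, as
  found in \<open>gmon_along_line\<close>.\<close>

definition dgmon :: "complex \<Rightarrow> nat \<Rightarrow> nat \<Rightarrow> complex \<Rightarrow> complex"
  where "dgmon \<omega> a b z = of_nat a * \<omega> * gmon (a - 1) b z + of_nat b * cnj \<omega> * gmon a (b - 1) z
      - cnj \<omega> * gmon (a + 1) b z - \<omega> * gmon a (b + 1) z"

text \<open>The lower bound on \<open>norm (\<zeta> t)\<close> gives both integrability along the
  line and vanishing boundary terms.\<close>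

lemma integral_dgmon_line:
  assumes "\<And>t. (\<zeta> has_vector_derivative \<omega>) (at t)" "\<And>t. (norm (\<zeta> t))\<^sup>2 \<ge> t\<^sup>2"
  shows "(LINT t|lborel. dgmon \<omega> a b (\<zeta> t)) = 0"
proof (rule integral_derivative_eq_0)
  have cont: "continuous_on UNIV \<zeta>"
    using assms(1) by (intro continuous_at_imp_continuous_on ballI has_vector_derivative_continuous)
  show "((\<lambda>t. gmon a b (\<zeta> t)) has_vector_derivative dgmon \<omega> a b (\<zeta> t)) (at t)" for t
    unfolding dgmon_def by (rule gmon_along_line[OF assms(1)])
  show "continuous_on UNIV (\<lambda>t. dgmon \<omega> a b (\<zeta> t))"
    unfolding dgmon_def
    by (intro continuous_intros continuous_on_compose2[OF continuous_gmon cont]) auto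
  show "integrable lborel (\<lambda>t. dgmon \<omega> a b (\<zeta> t))"
    unfolding dgmon_def
    by (intro Bochner_Integration.integrable_diff Bochner_Integration.integrable_add
        integrable_mult_right gmon_integrable_line assms(2) cont)
  have ge: "\<bar>t\<bar> \<le> norm (\<zeta> t)" for t
    using assms(2)[of t] by (metis abs_ge_zero norm_ge_zero power2_abs power2_le_imp_le)
  have "filterlim (\<lambda>t::real. \<bar>t\<bar>) at_top at_top" "filterlim (\<lambda>t::real. \<bar>t\<bar>) at_top at_bot"
    by real_asymp+
  then show "((\<lambda>t. gmon a b (\<zeta> t)) \<longlongrightarrow> 0) at_top" "((\<lambda>t. gmon a b (\<zeta> t)) \<longlongrightarrow> 0) at_bot"
    using ge by (auto intro!: gmon_tendsto_0 elim: filterlim_at_top_mono)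
qed

lemma integrable_dgmon: "integrable lborel (dgmon \<omega> a b)"
  unfolding dgmon_def
  by (intro Bochner_Integration.integrable_diff Bochner_Integration.integrable_add
      integrable_mult_right integrable_gmon)

text \<open>The two directions are the partial derivatives in the real and the imaginary part.
  Fubini is applied with the variable of differentiation inside, where the integral is already
  0.\<close>

lemma integral_dgmon:
  assumes "\<omega> = 1 \<or> \<omega> = \<i>"
  shows "(LINT z|lborel. dgmon \<omega> a b z) = 0"
proof -
  have m[measurable]: "(\<lambda>z. Complex (fst z) (snd z)) \<in> borel_measurable (lborel \<Otimes>\<^sub>M lborel)"
    unfolding lborel_prod measurable_lborel2 by (intro borel_measurable_continuous_onI continuous_intros)
  have d[measurable]: "dgmon \<omega> a b \<in> borel_measurable borel"
    using integrable_dgmon by (metis borel_measurable_integrable measurable_lborel2)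
  define D where "D z = dgmon \<omega> a b (Complex (fst z) (snd z))" for z
  have "integrable (lborel :: complex measure) (dgmon \<omega> a b)" by (rule integrable_dgmon)
  then have int: "integrable (lborel \<Otimes>\<^sub>M lborel) D"
    unfolding D_def by (subst (asm) lborel_complex_eq_distr, subst (asm) integrable_distr_eq) auto
  have "(LINT z|lborel. dgmon \<omega> a b z) = (LINT z|(lborel \<Otimes>\<^sub>M lborel). D z)"
    unfolding D_def by (subst lborel_complex_eq_distr, subst integral_distr) auto
  also have "\<dots> = 0"
  proof (cases "\<omega> = 1")
    case True
    have "(LINT z|(lborel \<Otimes>\<^sub>M lborel). D z) = (LINT y|lborel. LINT x|lborel. D (x, y))"
      using lborel_pair.integral_snd[of "\<lambda>x y. D (x, y)"] int by simp
    moreover have "(LINT x|lborel. D (x, y)) = 0" for y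
      unfolding D_def True fst_conv snd_conv
    proof (rule integral_dgmon_line)
      show "((\<lambda>x. Complex x y) has_vector_derivative 1) (at t)" for t
        by (auto simp: has_vector_derivative_complex_iff intro!: derivative_eq_intros)
    qed (simp add: cmod_power2)
    ultimately show ?thesis by simp
  next
    case False
    then have \<omega>: "\<omega> = \<i>" using assms by simp
    have "(LINT z|(lborel \<Otimes>\<^sub>M lborel). D z) = (LINT x|lborel. LINT y|lborel. D (x, y))"
      using lborel_pair.integral_fst'[OF int] by simp
    moreover have "(LINT y|lborel. D (x, y)) = 0" for x
      unfolding D_def \<omega> fst_conv snd_conv
    proof (rule integral_dgmon_line)
      show "((\<lambda>y. Complex x y) has_vector_derivative \<i>) (at t)" for t
        by (auto simp: has_vector_derivative_complex_iff intro!: derivative_eq_intros)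
    qed (simp add: cmod_power2)
    ultimately show ?thesis by simp
  qed
  finally show ?thesis .
qed

text \<open>Integrating the Wirtinger derivatives of \<open>gmon a b\<close> gives the two recurrences.\<close>

lemma integral_gmon_rec:
  defines "J \<equiv> \<lambda>a b. LINT z|lborel. gmon a b z"
  shows "J (a + 1) b = of_nat b * J a (b - 1)" and "J a (b + 1) = of_nat a * J (a - 1) b"
proof -
  have "of_nat a * \<omega> * J (a - 1) b + of_nat b * cnj \<omega> * J a (b - 1)
      - cnj \<omega> * J (a + 1) b - \<omega> * J a (b + 1) = 0" if "\<omega> = 1 \<or> \<omega> = \<i>" for \<omega>
    using integral_dgmon[OF that, of a b] unfolding dgmon_def J_def
    by (simp add: integrable_gmon)
  note eqs = this[of 1] this[of \<i>]
  have "of_nat a * J (a - 1) b + of_nat b * J a (b - 1) - J (a + 1) b - J a (b + 1) = 0"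
    using eqs(1) by simp
  moreover have "\<i> * (of_nat a * J (a - 1) b - of_nat b * J a (b - 1) + J (a + 1) b - J a (b + 1)) = 0"
    using eqs(2) by (simp add: algebra_simps)
  then have "of_nat a * J (a - 1) b - of_nat b * J a (b - 1) + J (a + 1) b - J a (b + 1) = 0"
    by (simp del: of_nat_add)
  \<comment> \<open>Sum and difference of the two directional identities separate the derivative in
    \<open>z\<close> from the one in its conjugate.\<close>
  moreover have "R = Q \<and> S = P" if "P + Q - R - S = 0" "P - Q + R - S = 0" for P Q R S :: complex
    using that by (simp add: complex_eq_iff)
  ultimately show "J (a + 1) b = of_nat b * J a (b - 1)" "J a (b + 1) = of_nat a * J (a - 1) b"
    by blast+
qed

text \<open>The recurrence lowers both exponents together. Off the diagonal one of them reaches 0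
  first and the factor 0 appears; on the diagonal the product of the factors is the factorial and
  the Gaussian integral \<open>pi\<close> is left.\<close>

lemma integral_gmon: "(LINT z|lborel. gmon a b z) = (if a = b then of_real pi * fact a else 0)"
proof (induction a arbitrary: b)
  case 0
  show ?case
  proof (cases b)
    case 0
    have "(LINT z|(lborel \<Otimes>\<^sub>M lborel). exp (- (fst z)\<^sup>2) * exp (- (snd z)\<^sup>2)) = sqrt pi * sqrt pi"
      using integrable_lborel_pair_mult(2)[OF integral_exp_square(1) integral_exp_square(1)]
      unfolding integral_exp_square(2) .
    moreover have "(LINT z|lborel. gmon 0 0 z) =
        (LINT z|(lborel \<Otimes>\<^sub>M lborel). of_real (exp (- (fst z)\<^sup>2) * exp (- (snd z)\<^sup>2)))"
    proof -
      have m[measurable]: "(\<lambda>z. Complex (fst z) (snd z)) \<in> borel_measurable (lborel \<Otimes>\<^sub>M lborel)"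
        unfolding lborel_prod measurable_lborel2 by (intro borel_measurable_continuous_onI continuous_intros)
      have "gmon 0 0 (Complex x y) = of_real (exp (- x\<^sup>2) * exp (- y\<^sup>2))" for x y
        unfolding gmon_def complex_norm_square[symmetric]
        by (simp add: cmod_power2 exp_add[symmetric] exp_of_real[symmetric] del: of_real_mult)
      then show ?thesis by (subst lborel_complex_eq_distr, subst integral_distr) auto
    qed
    ultimately show ?thesis using 0 by (simp del: of_real_mult)
  next
    case (Suc b')
    then show ?thesis using integral_gmon_rec(2)[of 0 b'] by simp
  qed
next
  case (Suc a)
  show ?case
  proof (cases b)
    case 0
    then show ?thesis using integral_gmon_rec(1)[of a 0] by simp
  next
    case (Suc b')
    then show ?thesis using integral_gmon_rec(1)[of a b] Suc.IH[of b'] by simp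
  qed
qed

section \<open>Orthogonality of monomials in several variables\<close>

definition gdens :: "'a::euclidean_space \<Rightarrow> real"
  where "gdens z = pi powr (- (real DIM('a) / 2)) * exp (- (norm z)\<^sup>2)"

lemma gdens_nonneg: "0 \<le> gdens z" by (simp add: gdens_def)

lemma gdens_measurable[measurable]: "gdens \<in> borel_measurable borel"
  unfolding gdens_def by (intro borel_measurable_continuous_onI continuous_intros)

lemma gauss_eq: "gauss = density lborel gdens"
  unfolding gauss_def gdens_def ..

lemma integrable_gauss:
  fixes f :: "'a::euclidean_space \<Rightarrow> complex"
  assumes "f \<in> borel_measurable borel"
  shows "integrable gauss f \<longleftrightarrow> integrable lborel (\<lambda>z. gdens z *\<^sub>R f z)"
  unfolding gauss_eq using assms gdens_nonneg by (intro integrable_density) auto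

lemma integral_gauss:
  fixes f :: "'a::euclidean_space \<Rightarrow> complex"
  assumes "f \<in> borel_measurable borel"
  shows "(LINT z|gauss. f z) = (LINT z|lborel. gdens z *\<^sub>R f z)"
  unfolding gauss_eq using assms gdens_nonneg by (intro integral_density) auto

lemma continuous_monom_eval: "continuous_on A (monom_eval \<alpha>)"
  unfolding monom_eval_def by (intro continuous_intros)

lemma monom_eval_measurable[measurable]: "monom_eval \<alpha> \<in> borel_measurable borel"
  by (rule borel_measurable_continuous_onI[OF continuous_monom_eval])

lemma cnj_measurable[measurable]: "cnj \<in> borel_measurable borel"
  by (intro borel_measurable_continuous_onI continuous_intros)

text \<open>Half of the real dimension of \<open>complex ^ 'd\<close> is the number of coordinates,
  so each coordinate receives one factor \<open>1 / pi\<close>, which later cancels the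
  \<open>pi\<close> of \<open>integral_gmon\<close>.\<close>

lemma gdens_monom:
  fixes z :: "complex ^ 'd"
  shows "gdens z *\<^sub>R (monom_eval \<alpha> z * cnj (monom_eval \<beta> z)) =
    (\<Prod>i\<in>UNIV. of_real (1 / pi) * gmon (\<alpha> i) (\<beta> i) (z $ i))"
proof -
  have "exp (- (norm z)\<^sup>2) = (\<Prod>i\<in>UNIV. exp (- (norm (z $ i))\<^sup>2))"
    by (simp add: norm_vec_def L2_set_def sum_nonneg exp_sum[symmetric] sum_negf)
  moreover have "pi powr (- (real DIM(complex ^ 'd) / 2)) = (\<Prod>i\<in>(UNIV :: 'd set). 1 / pi)"
    by (simp add: powr_minus powr_realpow power_one_over inverse_eq_divide)
  ultimately have "gdens z = (\<Prod>i\<in>UNIV. 1 / pi * exp (- (norm (z $ i))\<^sup>2))"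
    unfolding gdens_def by (simp only: prod.distrib)
  moreover have "of_real (exp (- (norm x)\<^sup>2)) = exp (- (x * cnj x))" for x :: complex
    by (simp only: complex_norm_square[symmetric] of_real_minus[symmetric] exp_of_real)
  ultimately have "complex_of_real (gdens z) =
      (\<Prod>i\<in>UNIV. of_real (1 / pi) * exp (- (z $ i * cnj (z $ i))))"
    by (simp only: of_real_prod of_real_mult)
  then show ?thesis
    by (simp add: scaleR_conv_of_real monom_eval_def gmon_def prod.distrib[symmetric] ac_simps)
qed

lemma gauss_monom_aux:
  fixes \<alpha> \<beta> :: "'d::finite \<Rightarrow> nat"
  defines "f \<equiv> \<lambda>z :: complex ^ 'd. gdens z *\<^sub>R (monom_eval \<alpha> z * cnj (monom_eval \<beta> z))"
  shows integrable_gdens_monom: "integrable lborel f"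
    and integral_gdens_monom: "(LINT z|lborel. f z) = (if \<alpha> = \<beta> then of_real (mi_fact \<alpha>) else 0)"
proof -
  interpret product_sigma_finite "\<lambda>_ :: 'd. lborel :: complex measure" by standard
  let ?P = "Pi\<^sub>M UNIV (\<lambda>_ :: 'd. lborel :: complex measure)"
  note comp = borel_measurable_vec_lambda
  have f[measurable]: "f \<in> borel_measurable borel" unfolding f_def by measurable
  have int: "integrable lborel (\<lambda>z. of_real (1 / pi) * gmon (\<alpha> i) (\<beta> i) z)" for i
    by (intro integrable_mult_right integrable_gmon)
  have fP: "f (\<chi> i. x i) = (\<Prod>i\<in>UNIV. of_real (1 / pi) * gmon (\<alpha> i) (\<beta> i) (x i))" for x
    unfolding f_def gdens_monom by simp
  show "integrable lborel f"
    unfolding lborel_complex_vec_eq_distr using comp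
    by (subst integrable_distr_eq) (auto simp only: fP f intro!: product_integrable_prod[OF finite] int)
  have "(LINT z|lborel. f z) = (LINT x|?P. (\<Prod>i\<in>UNIV. of_real (1 / pi) * gmon (\<alpha> i) (\<beta> i) (x i)))"
    unfolding lborel_complex_vec_eq_distr using comp by (subst integral_distr) (auto simp only: fP f)
  also have "\<dots> = (\<Prod>i\<in>UNIV. LINT z|lborel. of_real (1 / pi) * gmon (\<alpha> i) (\<beta> i) z)"
    by (rule product_integral_prod[OF finite int])
  also have "\<dots> = (\<Prod>i\<in>UNIV. if \<alpha> i = \<beta> i then fact (\<alpha> i) else 0)"
    by (intro prod.cong refl) (simp add: integral_gmon)
  also have "\<dots> = (if \<alpha> = \<beta> then of_real (mi_fact \<alpha>) else 0)"
  proof (cases "\<alpha> = \<beta>")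
    case False
    then obtain i where "\<alpha> i \<noteq> \<beta> i" by auto
    then have "\<exists>i\<in>UNIV. (if \<alpha> i = \<beta> i then fact (\<alpha> i) else 0 :: complex) = 0" by auto
    then have "(\<Prod>i\<in>UNIV. if \<alpha> i = \<beta> i then fact (\<alpha> i) else 0 :: complex) = 0"
      by (rule prod_zero[OF finite])
    then show ?thesis using False by simp
  qed (simp add: mi_fact_def)
  finally show "(LINT z|lborel. f z) = (if \<alpha> = \<beta> then of_real (mi_fact \<alpha>) else 0)" .
qed

lemma integrable_gauss_monom:
  "integrable gauss (\<lambda>z. monom_eval \<alpha> z * cnj (monom_eval \<beta> z))"
  by (subst integrable_gauss) (measurable, rule integrable_gdens_monom)

lemma integral_gauss_monom:
  "(LINT z|gauss. monom_eval \<alpha> z * cnj (monom_eval \<beta> z)) = (if \<alpha> = \<beta> then of_real (mi_fact \<alpha>) else 0)"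
  by (subst integral_gauss) (measurable, rule integral_gdens_monom)

lemma gdens_prod: "gdens (x, y) = gdens x * gdens y"
  by (simp add: gdens_def norm_Pair exp_add[symmetric] powr_add[symmetric] add_divide_distrib
      mult.assoc mult.left_commute)

lemma gauss_monom_pair:
  fixes \<alpha>2 \<beta>2 :: "'d2::finite \<Rightarrow> nat" and \<alpha>1 \<beta>1 :: "'d1::finite \<Rightarrow> nat"
  defines "f \<equiv> \<lambda>z :: (complex ^ 'd2) \<times> (complex ^ 'd1).
    (monom_eval \<alpha>2 (fst z) * cnj (monom_eval \<beta>2 (fst z))) *
    (monom_eval \<alpha>1 (snd z) * cnj (monom_eval \<beta>1 (snd z)))"
  shows "integrable gauss f"
    and "(LINT z|gauss. f z) =
      (if \<alpha>2 = \<beta>2 then of_real (mi_fact \<alpha>2) else 0) * (if \<alpha>1 = \<beta>1 then of_real (mi_fact \<alpha>1) else 0)"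
proof -
  have f: "f \<in> borel_measurable borel"
    unfolding f_def
    by (intro borel_measurable_continuous_onI continuous_intros
        continuous_on_compose2[OF continuous_monom_eval[of UNIV]]) auto
  have eq: "gdens z *\<^sub>R f z =
      (gdens (fst z) *\<^sub>R (monom_eval \<alpha>2 (fst z) * cnj (monom_eval \<beta>2 (fst z)))) *
      (gdens (snd z) *\<^sub>R (monom_eval \<alpha>1 (snd z) * cnj (monom_eval \<beta>1 (snd z))))" for z
    using gdens_prod[of "fst z" "snd z"] by (simp add: f_def scaleR_conv_of_real)
  show "integrable gauss f"
    unfolding integrable_gauss[OF f] eq lborel_prod[symmetric]
    by (intro integrable_lborel_pair_mult(1) integrable_gdens_monom)
  show "(LINT z|gauss. f z) =
      (if \<alpha>2 = \<beta>2 then of_real (mi_fact \<alpha>2) else 0) * (if \<alpha>1 = \<beta>1 then of_real (mi_fact \<alpha>1) else 0)"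
    unfolding integral_gauss[OF f] eq lborel_prod[symmetric]
    by (subst integrable_lborel_pair_mult(2)) (simp_all only: integrable_gdens_monom integral_gdens_monom)
qed

section \<open>From the pairing to the matrix of coefficients\<close>

definition single :: "'a \<Rightarrow> 'a \<Rightarrow> complex"
  where "single \<beta> = (\<lambda>\<alpha>. if \<alpha> = \<beta> then 1 else 0)"

lemma peval_single: "peval (single \<beta>) = monom_eval \<beta>"
  by (rule ext) (simp add: peval_def single_def)

lemma A2_form_peval_monom:
  assumes "F \<in> finite_support"
  shows "A2_form (peval F) (monom_eval \<beta>) = F \<beta> * of_real (mi_fact \<beta>)"
proof -
  have fin: "finite {\<alpha>. F \<alpha> \<noteq> 0}" using assms by (simp add: finite_support_def)
  have "A2_form (peval F) (monom_eval \<beta>) =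
      (LINT z|gauss. (\<Sum>\<alpha>\<in>{\<alpha>. F \<alpha> \<noteq> 0}. F \<alpha> * (monom_eval \<alpha> z * cnj (monom_eval \<beta> z))))"
    by (simp add: A2_form_def peval_def sum_distrib_right mult.assoc)
  also have "\<dots> = (\<Sum>\<alpha> | F \<alpha> \<noteq> 0. F \<alpha> * (if \<alpha> = \<beta> then of_real (mi_fact \<alpha>) else 0))"
    by (simp add: integrable_gauss_monom integral_gauss_monom)
  also have "\<dots> = F \<beta> * of_real (mi_fact \<beta>)"
    using fin by (auto simp: if_distrib cong: if_cong)
  finally show ?thesis .
qed

lemma lim_eventually_const:
  assumes "\<And>N. N0 \<le> N \<Longrightarrow> f N = (c :: complex)" shows "lim f = c"
  using assms by (intro limI tendsto_eventually) (auto simp: eventually_sequentially)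

text \<open>By orthogonality only the coefficient at \<open>\<beta>\<close> contributes, so the
  values are constant once the truncation reaches the order of \<open>\<beta>\<close>.\<close>

lemma A2_pair_monom: "A2_pair F (monom_eval \<beta>) = F \<beta> * of_real (mi_fact \<beta>)"
  unfolding A2_pair_def
proof (rule lim_eventually_const)
  fix N assume N: "mi_abs \<beta> \<le> N"
  have "truncate_mi N F \<in> finite_support"
    unfolding finite_support_bounded by (intro exI[of _ N]) (simp add: truncate_mi_def)
  from A2_form_peval_monom[OF this, of \<beta>] N
  show "A2_form (peval (truncate_mi N F)) (monom_eval \<beta>) = F \<beta> * of_real (mi_fact \<beta>)"
    by (simp add: truncate_mi_def)
qed

text \<open>The conjugate in \<open>A2_form\<close> undoes the one in \<open>tensor_conj\<close>, so
  \<open>F\<close> itself meets the conjugated monomials of the kernel. This is why no conjugate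
  appears on the right.\<close>

lemma A2_form_keval_monom:
  fixes K :: "('d2::finite, 'd1::finite) kernel"
  assumes fin: "finite {(\<alpha>2, \<alpha>1). K \<alpha>2 \<alpha>1 \<noteq> 0}" and F: "F \<in> finite_support"
  shows "A2_form (keval K) (tensor_conj (single \<beta>) F) =
    (\<Sum>\<alpha> | F \<alpha> \<noteq> 0. K \<beta> \<alpha> * F \<alpha> * of_real (mi_fact \<beta>) * of_real (mi_fact \<alpha>))"
proof -
  let ?S = "{(\<alpha>2, \<alpha>1). K \<alpha>2 \<alpha>1 \<noteq> 0}" and ?R = "{\<alpha>. F \<alpha> \<noteq> 0}"
  have finF: "finite ?R" using F by (simp add: finite_support_def)
  have eq: "keval K z * cnj (tensor_conj (single \<beta>) F z) =
      (\<Sum>p\<in>?S. \<Sum>\<alpha>\<in>?R. (K (fst p) (snd p) * F \<alpha>) *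
        ((monom_eval (fst p) (fst z) * cnj (monom_eval \<beta> (fst z))) *
         (monom_eval \<alpha> (snd z) * cnj (monom_eval (snd p) (snd z)))))" for z
    unfolding keval_def tensor_conj_def peval_single case_prod_unfold peval_def
      complex_cnj_mult cnj_sum complex_cnj_cnj sum_distrib_left sum_distrib_right
    by (subst sum.swap) (intro sum.cong refl, simp add: ac_simps)
  have "A2_form (keval K) (tensor_conj (single \<beta>) F) =
      (\<Sum>p\<in>?S. \<Sum>\<alpha>\<in>?R. (K (fst p) (snd p) * F \<alpha>) *
        ((if fst p = \<beta> then of_real (mi_fact (fst p)) else 0) *
         (if \<alpha> = snd p then of_real (mi_fact \<alpha>) else 0)))"
    unfolding A2_form_def eq
    by (subst Bochner_Integration.integral_sum
          | intro Bochner_Integration.integrable_sum integrable_mult_right gauss_monom_pair(1) sum.cong refl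
          | simp only: integral_mult_right_zero gauss_monom_pair(2))+
  also have "\<dots> = (\<Sum>\<alpha>\<in>?R. \<Sum>p\<in>?S. if p = (\<beta>, \<alpha>)
      then K \<beta> \<alpha> * F \<alpha> * of_real (mi_fact \<beta>) * of_real (mi_fact \<alpha>) else 0)"
    by (subst sum.swap) (intro sum.cong refl, auto)
  also have "\<dots> = (\<Sum>\<alpha>\<in>?R. K \<beta> \<alpha> * F \<alpha> * of_real (mi_fact \<beta>) * of_real (mi_fact \<alpha>))"
    using fin by (intro sum.cong refl) auto
  finally show ?thesis .
qed

lemma A2_kpair_monom:
  fixes K :: "('d2::finite, 'd1::finite) kernel"
  assumes F: "F \<in> finite_support"
  shows "A2_kpair K (tensor_conj (single \<beta>) F) =
    (\<Sum>\<alpha> | F \<alpha> \<noteq> 0. K \<beta> \<alpha> * F \<alpha> * of_real (mi_fact \<beta>) * of_real (mi_fact \<alpha>))"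
proof -
  obtain M where M: "\<And>\<alpha>. mi_abs \<alpha> > M \<Longrightarrow> F \<alpha> = 0" using F finite_support_bounded by blast
  show ?thesis
    unfolding A2_kpair_def
  proof (rule lim_eventually_const)
    \<comment> \<open>From this order on, truncation keeps every entry in row \<open>\<beta>\<close>
      whose column meets the support of \<open>F\<close>.\<close>
    fix N assume N: "mi_abs \<beta> + M \<le> N"
    have "{(\<alpha>2, \<alpha>1). truncate_kernel N K \<alpha>2 \<alpha>1 \<noteq> 0} \<subseteq> {\<alpha>. mi_abs \<alpha> \<le> N} \<times> {\<alpha>. mi_abs \<alpha> \<le> N}"
      by (auto simp: truncate_kernel_def split: if_splits)
    then have fin: "finite {(\<alpha>2, \<alpha>1). truncate_kernel N K \<alpha>2 \<alpha>1 \<noteq> 0}"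
      by (rule finite_subset) (intro finite_cartesian_product finite_mi_abs_le)
    have "truncate_kernel N K \<beta> \<alpha> = K \<beta> \<alpha>" if "F \<alpha> \<noteq> 0" for \<alpha>
      using that M[of \<alpha>] N by (auto simp: truncate_kernel_def not_less)
    then show "A2_form (keval (truncate_kernel N K)) (tensor_conj (single \<beta>) F) =
        (\<Sum>\<alpha> | F \<alpha> \<noteq> 0. K \<beta> \<alpha> * F \<alpha> * of_real (mi_fact \<beta>) * of_real (mi_fact \<alpha>))"
      unfolding A2_form_keval_monom[OF fin F] by (intro sum.cong) auto
  qed
qed

lemma coef_finite_support: "coef F \<in> finite_support \<longleftrightarrow> F \<in> finite_support"
  by (simp add: finite_support_def coef_def less_imp_neq[OF mi_fact_pos, symmetric])

text \<open>Here \<open>H\<close> stands for the image of \<open>F\<close>. After division by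
  \<open>\<beta>!\<close> the pairing gives \<open>H \<beta>\<close> as the sum of
  \<open>K \<beta> \<alpha> * F \<alpha> * \<alpha>!\<close>. The factor \<open>\<alpha>!\<close>
  splits evenly between \<open>kcoef K\<close> and \<open>coef F\<close>, and \<open>H\<close> and
  the kernel each take a root of \<open>\<beta>!\<close>.\<close>

lemma coef_eq_kernel_op:
  fixes K :: "('d2::finite, 'd1::finite) kernel"
  assumes "F \<in> finite_support"
    and "A2_pair H (peval (single \<beta>)) = A2_kpair K (tensor_conj (single \<beta>) F)"
  shows "coef H \<beta> = kernel_op (\<lambda>\<beta> \<alpha>. kcoef K (case_sum \<beta> \<alpha>)) (coef F) \<beta>"
proof -
  have pos: "0 < mi_fact \<beta>" by (rule mi_fact_pos)
  have fin: "finite {\<alpha>. F \<alpha> \<noteq> 0}" using assms(1) by (simp add: finite_support_def)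
  have sq: "complex_of_real (sqrt (mi_fact \<alpha>)) * of_real (sqrt (mi_fact \<alpha>)) = of_real (mi_fact \<alpha>)"
    for \<alpha> :: "'d1 \<Rightarrow> nat"
    using mi_fact_pos[of \<alpha>] by (simp flip: of_real_mult)
  have sq': "complex_of_real (sqrt (mi_fact \<beta>)) * of_real (sqrt (mi_fact \<beta>)) = of_real (mi_fact \<beta>)"
    using pos by (simp flip: of_real_mult)
  have kc: "kcoef K (case_sum \<beta> \<alpha>) = K \<beta> \<alpha> * (of_real (sqrt (mi_fact \<beta>)) * of_real (sqrt (mi_fact \<alpha>)))" for \<alpha>
    by (simp add: kcoef_def o_def)
  have "H \<beta> * of_real (mi_fact \<beta>) =
      (\<Sum>\<alpha> | F \<alpha> \<noteq> 0. K \<beta> \<alpha> * F \<alpha> * of_real (mi_fact \<alpha>)) * of_real (mi_fact \<beta>)"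
    using assms(2) unfolding peval_single A2_pair_monom A2_kpair_monom[OF assms(1)] sum_distrib_right
    by (simp add: ac_simps)
  then have "H \<beta> = (\<Sum>\<alpha> | F \<alpha> \<noteq> 0. K \<beta> \<alpha> * F \<alpha> * of_real (mi_fact \<alpha>))" using pos by simp
  then have "coef H \<beta> = (\<Sum>\<alpha> | F \<alpha> \<noteq> 0. K \<beta> \<alpha> * F \<alpha> * of_real (mi_fact \<alpha>) * of_real (sqrt (mi_fact \<beta>)))"
    by (simp add: coef_def sum_distrib_right)
  also have "\<dots> = (\<Sum>\<alpha> | F \<alpha> \<noteq> 0. kcoef K (case_sum \<beta> \<alpha>) * coef F \<alpha>)"
    unfolding kc coef_def sq[symmetric] by (simp add: ac_simps)
  also have "\<dots> = (\<Sum>\<^sub>\<infinity>\<alpha>\<in>{\<alpha>. F \<alpha> \<noteq> 0}. kcoef K (case_sum \<beta> \<alpha>) * coef F \<alpha>)"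
    using fin by simp
  also have "\<dots> = kernel_op (\<lambda>\<beta> \<alpha>. kcoef K (case_sum \<beta> \<alpha>)) (coef F) \<beta>"
    unfolding kernel_op_def by (rule infsum_cong_neutral) (auto simp: coef_def)
  finally show ?thesis .
qed

section \<open>Extension of the operator\<close>

definition uncoef :: "(('d::finite \<Rightarrow> nat) \<Rightarrow> complex) \<Rightarrow> 'd pseries"
  where "uncoef c = (\<lambda>\<alpha>. c \<alpha> / of_real (sqrt (mi_fact \<alpha>)))"

lemma coef_uncoef[simp]: "coef (uncoef c) = c"
  by (rule ext) (simp add: coef_def uncoef_def less_imp_neq[OF mi_fact_pos, symmetric])

lemma uncoef_coef[simp]: "uncoef (coef F) = F"
  by (rule ext) (simp add: coef_def uncoef_def less_imp_neq[OF mi_fact_pos, symmetric])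

lemma coef_comb: "coef (\<lambda>i. a * F i + b * G i) = (\<lambda>i. a * coef F i + b * coef G i)"
  by (rule ext) (simp add: coef_def algebra_simps)

lemma uncoef_comb: "uncoef (\<lambda>i. a * x i + b * y i) = (\<lambda>i. a * uncoef x i + b * uncoef y i)"
  by (simp add: uncoef_def add_divide_distrib)

text \<open>\<open>coef\<close> is a linear bijection, so \<open>L\<close> is conjugated by it;
  \<open>restrict\<close> fixes the values off the domain. For uniqueness, each coordinate of two
  candidates is a continuous complex-valued map, and two such maps that agree on a dense set are
  equal.\<close>

lemma extends_uniquely_coef:
  fixes X :: "(('d1::finite \<Rightarrow> nat) \<Rightarrow> complex) topology"
    and Y :: "(('d2::finite \<Rightarrow> nat) \<Rightarrow> complex) topology"
  assumes L: "linear_continuous X Y L" and sub: "lin_subspace (topspace X)"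
    and fs: "finite_support \<subseteq> topspace X"
    and dense: "\<And>U x. openin X U \<Longrightarrow> x \<in> U \<Longrightarrow> \<exists>y\<in>finite_support. y \<in> U"
    and coord: "\<And>a. continuous_map Y euclidean (\<lambda>x. x a)"
    and T: "\<And>F. F \<in> finite_support \<Longrightarrow> coef (T F) = L (coef F)"
  shows "extends_uniquely finite_support T
    (pullback_topology UNIV coef X) (pullback_topology UNIV coef Y)"
proof -
  let ?X = "pullback_topology UNIV coef X" and ?Y = "pullback_topology UNIV coef Y"
  have tX: "F \<in> topspace ?X \<longleftrightarrow> coef F \<in> topspace X" for F
    by (simp add: topspace_pullback_topology)
  have D: "finite_support \<subseteq> topspace ?X"
  proof
    fix F :: "'d1 pseries" assume "F \<in> finite_support"
    then have "coef F \<in> finite_support" unfolding coef_finite_support .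
    then show "F \<in> topspace ?X" unfolding tX by (rule subsetD[OF fs])
  qed
  have Llin: "L (\<lambda>i. a * x i + b * y i) = (\<lambda>j. a * L x j + b * L y j)"
    if "x \<in> topspace X" "y \<in> topspace X" for x y a b
    using L that unfolding linear_continuous_def by blast
  define S where "S = restrict (\<lambda>F. uncoef (L (coef F))) (topspace ?X)"
  have S: "S F = uncoef (L (coef F))" if "F \<in> topspace ?X" for F using that by (simp add: S_def)
  have "linear_continuous ?X ?Y S"
    unfolding linear_continuous_def
  proof (intro conjI ballI allI)
    fix F G a b assume F: "F \<in> topspace ?X" and G: "G \<in> topspace ?X"
    then have "(\<lambda>i. a * F i + b * G i) \<in> topspace ?X"
      unfolding tX coef_comb by (intro lin_subspace_comb[OF sub])
    then show "S (\<lambda>i. a * F i + b * G i) = (\<lambda>j. a * S F j + b * S G j)"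
      using F G Llin unfolding tX by (simp add: S tX coef_comb uncoef_comb)
  next
    have "continuous_map ?X ?Y (\<lambda>F. uncoef (L (coef F)))"
    proof (rule continuous_map_pullback')
      have "continuous_map X Y L" using L unfolding linear_continuous_def by blast
      from continuous_map_pullback[OF this, of UNIV coef]
      show "continuous_map ?X Y (coef \<circ> (\<lambda>F. uncoef (L (coef F))))" by (simp add: o_def)
    qed simp
    then show "continuous_map ?X ?Y S" by (rule continuous_map_eq) (simp add: S)
  qed
  moreover have "S F = T F" if "F \<in> finite_support" for F
    using T[OF that, symmetric] D that by (simp add: S subset_iff)
  moreover have "S1 = S2" if S1: "S1 \<in> extensional (topspace ?X)" "linear_continuous ?X ?Y S1"
      "\<forall>F\<in>finite_support. S1 F = T F" and S2: "S2 \<in> extensional (topspace ?X)"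
      "linear_continuous ?X ?Y S2" "\<forall>F\<in>finite_support. S2 F = T F" for S1 S2
  proof (rule extensionalityI[OF S1(1) S2(1)])
    fix F assume F: "F \<in> topspace ?X"
    have cl: "F \<in> ?X closure_of finite_support"
      unfolding in_closure_of
    proof (intro conjI allI impI F)
      fix U assume "F \<in> U \<and> openin ?X U"
      then obtain V where V: "openin X V" "U = coef -` V" "coef F \<in> V"
        unfolding openin_pullback_topology by auto
      from dense[OF V(1,3)] obtain y where y: "y \<in> finite_support" "y \<in> V" by blast
      then show "\<exists>y. y \<in> finite_support \<and> y \<in> U"
        using V(2) coef_finite_support[of "uncoef y"] by (intro exI[of _ "uncoef y"]) simp
    qed
    have cont: "continuous_map ?X euclidean (\<lambda>F. coef (R F) a)"
      if "linear_continuous ?X ?Y R" for R a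
      using continuous_map_compose[of ?X ?Y R euclidean, OF _ continuous_map_pullback[OF coord[of a], of UNIV coef]]
        that unfolding linear_continuous_def by (simp add: o_def)
    have "coef (S1 F) a = coef (S2 F) a" for a
      by (rule forall_in_closure_of_eq[OF cl Hausdorff_space_euclidean cont[OF S1(2)] cont[OF S2(2)]])
        (simp add: S1(3) S2(3))
    then have "coef (S1 F) = coef (S2 F)" by (rule ext)
    then show "S1 F = S2 F" by (metis uncoef_coef)
  qed
  moreover have "S \<in> extensional (topspace ?X)" by (simp add: S_def)
  ultimately show ?thesis
    unfolding extends_uniquely_def using D by (intro conjI ex1I[of _ S]) blast+
qed

lemma extends_uniquely_projective_inductive:
  fixes S :: "'i \<Rightarrow> (('d1::finite \<Rightarrow> nat) \<Rightarrow> complex) set"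
    and S' :: "'j \<Rightarrow> (('d2::finite \<Rightarrow> nat) \<Rightarrow> complex) set"
  assumes P: "projective_steps I S q w" and N: "inductive_steps J S' q' w'"
    and "i \<in> I" "j \<in> J" "\<And>a b. w i a = 0 \<Longrightarrow> k b a = 0"
      "(\<lambda>(b, a). norm (k b a) * w' j b / w i a) summable_on UNIV"
      "\<And>x. x \<in> (\<Inter>i\<in>I. S i) \<Longrightarrow> kernel_op k x \<in> S' j"
    and T: "\<And>F. F \<in> finite_support \<Longrightarrow> coef (T F) = kernel_op k (coef F)"
  shows "extends_uniquely finite_support T
    (pullback_topology UNIV coef (seminorm_topology (\<Inter>i\<in>I. S i) (q ` I)))
    (pullback_topology UNIV coef (inductive_topology J (\<lambda>j. seminorm_topology (S' j) {q' j})))"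
proof -
  interpret P: projective_steps I S q w by (rule P)
  interpret N: inductive_steps J S' q' w' by (rule N)
  show ?thesis
    by (rule extends_uniquely_coef[OF
          linear_continuous_projective_inductive[OF P N assms(3-7)] _ _ P.dense N.continuous_coordinate T])
      (simp_all only: topspace_seminorm_topology P.limit_subspace P.finite_support_limit)
qed

lemma extends_uniquely_inductive_projective:
  fixes S :: "'i \<Rightarrow> (('d1::finite \<Rightarrow> nat) \<Rightarrow> complex) set"
    and S' :: "'j \<Rightarrow> (('d2::finite \<Rightarrow> nat) \<Rightarrow> complex) set"
  assumes N: "inductive_steps I S q w" and P: "projective_steps J S' q' w'"
    and "\<And>i x a. i \<in> I \<Longrightarrow> x \<in> S i \<Longrightarrow> a \<notin> A i \<Longrightarrow> x a = 0"
      "\<And>i j. i \<in> I \<Longrightarrow> j \<in> J \<Longrightarrow>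
        (\<lambda>(b, a). norm (k b a) * w' j b / w i a) summable_on (UNIV \<times> A i)"
    and T: "\<And>F. F \<in> finite_support \<Longrightarrow> coef (T F) = kernel_op k (coef F)"
  shows "extends_uniquely finite_support T
    (pullback_topology UNIV coef (inductive_topology I (\<lambda>i. seminorm_topology (S i) {q i})))
    (pullback_topology UNIV coef (seminorm_topology (\<Inter>j\<in>J. S' j) (q' ` J)))"
proof -
  interpret N: inductive_steps I S q w by (rule N)
  interpret P: projective_steps J S' q' w' by (rule P)
  have L: "linear_continuous N.limit_topology P.limit_topology (kernel_op k)"
    by (rule linear_continuous_inductive_projective[where A = A, OF N P]; fact assms)
  show ?thesis
    by (rule extends_uniquely_coef[OF L _ _ N.dense P.continuous_coordinate T])
      (simp_all only: N.topspace_limit N.limit_subspace N.finite_support_limit)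
qed

section \<open>Projective and inductive families of weights, and kernels\<close>

lemma weight_dual_ratio_summable:
  assumes "s \<in> R_flat" "0 < r" "r < r'"
  shows "(\<lambda>\<alpha> :: 'n::finite \<Rightarrow> nat. 1 / weight s r' \<alpha> / (1 / weight s r \<alpha>)) summable_on UNIV"
  using weight_ratio_summable[OF assms, where 'n = 'n] by simp

lemma projective_steps_weight:
  assumes "1 \<le> p" "s \<in> R_flat"
  shows "projective_steps {0<..} (\<lambda>r. wlp p (weight s r :: ('n::finite \<Rightarrow> nat) \<Rightarrow> real))
    (\<lambda>r. wlp_norm p (weight s r)) (weight s)"
proof (rule projective_steps_wlp[OF assms(1)])
  show "\<exists>j\<in>{0<..}. (\<lambda>\<alpha> :: 'n \<Rightarrow> nat. weight s i \<alpha> / weight s j \<alpha>) summable_on UNIV" if "i \<in> {0<..}" for i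
    using that assms(2) by (intro bexI[of _ "2 * i"] weight_ratio_summable) auto
qed (use weight_pos[OF assms(2)] in auto)

lemma projective_steps_weight_dual:
  assumes "1 \<le> p" "s \<in> R_flat"
  shows "projective_steps {0<..} (\<lambda>r. wlp p (\<lambda>\<alpha> :: 'n::finite \<Rightarrow> nat. 1 / weight s r \<alpha>))
    (\<lambda>r. wlp_norm p (\<lambda>\<alpha>. 1 / weight s r \<alpha>)) (\<lambda>r \<alpha>. 1 / weight s r \<alpha>)"
proof (rule projective_steps_wlp[OF assms(1)])
  show "\<exists>j\<in>{0<..}. (\<lambda>\<alpha> :: 'n \<Rightarrow> nat. 1 / weight s i \<alpha> / (1 / weight s j \<alpha>)) summable_on UNIV"
    if "i \<in> {0<..}" for i
    \<comment> \<open>Reciprocal weights decrease in the parameter, so the stronger step has the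
      smaller one.\<close>
    using that assms(2) by (intro bexI[of _ "i / 2"] weight_dual_ratio_summable) auto
qed (use weight_pos[OF assms(2)] in auto)

lemma inductive_steps_weight:
  assumes "1 \<le> p" "s \<in> R_flat"
  shows "inductive_steps {0<..} (\<lambda>r. wlp p (weight s r :: ('n::finite \<Rightarrow> nat) \<Rightarrow> real))
    (\<lambda>r. wlp_norm p (weight s r)) (weight s)"
proof (rule inductive_steps_wlp[OF assms(1)])
  show "\<exists>k\<in>{0<..}. (\<lambda>\<alpha> :: 'n \<Rightarrow> nat. weight s k \<alpha> / weight s i \<alpha>) summable_on UNIV \<and>
      (\<lambda>\<alpha> :: 'n \<Rightarrow> nat. weight s k \<alpha> / weight s j \<alpha>) summable_on UNIV"
    if "i \<in> {0<..}" "j \<in> {0<..}" for i j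
    \<comment> \<open>The minimum serves both steps; halving it makes the quotients
      summable.\<close>
    using that assms(2) by (intro bexI[of _ "min i j / 2"] conjI weight_ratio_summable) auto
qed (use weight_pos[OF assms(2)] in auto)

lemma inductive_steps_weight_dual:
  assumes "1 \<le> p" "s \<in> R_flat"
  shows "inductive_steps {0<..} (\<lambda>r. wlp p (\<lambda>\<alpha> :: 'n::finite \<Rightarrow> nat. 1 / weight s r \<alpha>))
    (\<lambda>r. wlp_norm p (\<lambda>\<alpha>. 1 / weight s r \<alpha>)) (\<lambda>r \<alpha>. 1 / weight s r \<alpha>)"
proof (rule inductive_steps_wlp[OF assms(1)])
  show "\<exists>k\<in>{0<..}. (\<lambda>\<alpha> :: 'n \<Rightarrow> nat. 1 / weight s k \<alpha> / (1 / weight s i \<alpha>)) summable_on UNIV \<and>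
      (\<lambda>\<alpha> :: 'n \<Rightarrow> nat. 1 / weight s k \<alpha> / (1 / weight s j \<alpha>)) summable_on UNIV"
    if "i \<in> {0<..}" "j \<in> {0<..}" for i j
    using that assms(2) by (intro bexI[of _ "2 * max i j"] conjI weight_dual_ratio_summable) auto
qed (use weight_pos[OF assms(2)] in auto)

lemma summable_on_case_sum:
  fixes g :: "('m + 'n \<Rightarrow> 'c) \<Rightarrow> real"
  shows "(\<lambda>(b, a). g (case_sum b a)) summable_on UNIV \<longleftrightarrow> g summable_on UNIV"
proof -
  have "bij_betw (\<lambda>(b, a). case_sum b a :: 'm + 'n \<Rightarrow> 'c) UNIV UNIV"
    by (rule bij_betwI[where g = "\<lambda>\<gamma>. (\<gamma> \<circ> Inl, \<gamma> \<circ> Inr)"])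
      (auto simp: fun_eq_iff split: sum.split)
  from summable_on_reindex_bij_betw[OF this, of g] show ?thesis by (simp add: case_prod_unfold)
qed

lemma weight_mono:
  assumes "s \<in> R_flat" "0 < r" "r \<le> r'"
  shows "weight s r \<alpha> \<le> weight s r' \<alpha>"
  using assms by (auto simp: R_flat_def intro!: mult_right_mono power_mono)

text \<open>The weight on the sum of the index types is traded for a product of weights, at the
  price of a change of parameter. A decaying kernel then admits all sufficiently small
  \<open>i\<close> and \<open>j\<close>, a growing one all sufficiently large ones.\<close>

lemma kernel_summable:
  fixes \<kappa> :: "('m::finite + 'n::finite \<Rightarrow> nat) \<Rightarrow> complex"
  assumes "1 \<le> p" and s: "s \<in> R_flat"
  obtains c where "0 < c"
    "\<And>r i j. 0 < i \<Longrightarrow> 0 < j \<Longrightarrow> c * i \<le> r \<Longrightarrow> c * j \<le> r \<Longrightarrow> \<kappa> \<in> wlp p (weight s r) \<Longrightarrow>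
      (\<lambda>(b, a). norm (\<kappa> (case_sum b a)) * weight s j b / (1 / weight s i a)) summable_on UNIV"
    "\<And>r i j. 0 < r \<Longrightarrow> c * r \<le> i \<Longrightarrow> c * r \<le> j \<Longrightarrow> \<kappa> \<in> wlp p (\<lambda>\<gamma>. 1 / weight s r \<gamma>) \<Longrightarrow>
      (\<lambda>(b, a). norm (\<kappa> (case_sum b a)) * (1 / weight s j b) / weight s i a) summable_on UNIV"
proof -
  obtain c where c: "1 \<le> c"
    "\<And>r (\<gamma> :: 'm + 'n \<Rightarrow> nat). 0 < r \<Longrightarrow> weight s r \<gamma> \<le> weight s (c * r) (\<gamma> \<circ> Inl) * weight s (c * r) (\<gamma> \<circ> Inr)"
    "\<And>r (\<gamma> :: 'm + 'n \<Rightarrow> nat). 0 < r \<Longrightarrow> weight s r (\<gamma> \<circ> Inl) * weight s r (\<gamma> \<circ> Inr) \<le> weight s (c * r) \<gamma>"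
    using weight_Plus[OF s, where 'm = 'm and 'n = 'n] by blast
  have pos1: "0 < weight s r \<alpha>" if "0 < r" for r and \<alpha> :: "'m \<Rightarrow> nat" using weight_pos[OF s that] .
  have pos2: "0 < weight s r \<alpha>" if "0 < r" for r and \<alpha> :: "'n \<Rightarrow> nat" using weight_pos[OF s that] .
  have pos3: "0 < weight s r \<alpha>" if "0 < r" for r and \<alpha> :: "'m + 'n \<Rightarrow> nat" using weight_pos[OF s that] .
  show ?thesis
  \<comment> \<open>\<open>c\<close> comes from \<open>weight_Plus\<close>; the additional 2 leaves
    a gap between the parameters, as \<open>wlp_summable\<close> requires a summable
    quotient.\<close>
  proof (rule that[of "2 * c"])
    show "0 < 2 * c" using c(1) by simp
    fix r i j :: real
    assume ij: "0 < i" "0 < j" "2 * c * i \<le> r" "2 * c * j \<le> r" and \<kappa>: "\<kappa> \<in> wlp p (weight s r)"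
    define t where "t = max i j"
    have t: "0 < t" "2 * (c * t) \<le> r" "0 < c * t" using ij c(1) by (auto simp: t_def max_def)
    have "(\<lambda>\<gamma>. norm (\<kappa> \<gamma>) * weight s (c * t) \<gamma>) summable_on UNIV"
      using t weight_pos[OF s] by (intro wlp_summable[OF assms(1) \<kappa>] weight_ratio_summable[OF s]) auto
    then have "(\<lambda>\<gamma>. norm (\<kappa> \<gamma>) * (weight s j (\<gamma> \<circ> Inl) * weight s i (\<gamma> \<circ> Inr))) summable_on UNIV"
    proof (rule summable_on_comparison_test)
      fix \<gamma> :: "'m + 'n \<Rightarrow> nat"
      have "weight s j (\<gamma> \<circ> Inl) * weight s i (\<gamma> \<circ> Inr) \<le> weight s t (\<gamma> \<circ> Inl) * weight s t (\<gamma> \<circ> Inr)"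
        using ij t(1) pos1 pos2 by (intro mult_mono weight_mono[OF s]) (auto simp: t_def less_imp_le)
      also have "\<dots> \<le> weight s (c * t) \<gamma>" by (rule c(3)[OF t(1)])
      finally show "norm (\<kappa> \<gamma>) * (weight s j (\<gamma> \<circ> Inl) * weight s i (\<gamma> \<circ> Inr)) \<le> norm (\<kappa> \<gamma>) * weight s (c * t) \<gamma>"
        by (intro mult_left_mono) auto
      show "0 \<le> norm (\<kappa> \<gamma>) * (weight s j (\<gamma> \<circ> Inl) * weight s i (\<gamma> \<circ> Inr))"
        using ij pos1 pos2 by (simp add: less_imp_le)
    qed
    then show "(\<lambda>(b, a). norm (\<kappa> (case_sum b a)) * weight s j b / (1 / weight s i a)) summable_on UNIV"
      unfolding summable_on_case_sum[symmetric] by (simp add: o_def ac_simps)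
  next
    fix r i j :: real
    assume ij: "0 < r" "2 * c * r \<le> i" "2 * c * r \<le> j" and \<kappa>: "\<kappa> \<in> wlp p (\<lambda>\<gamma>. 1 / weight s r \<gamma>)"
    have cr: "c * (2 * r) \<le> i" "c * (2 * r) \<le> j" "0 < c * (2 * r)" using ij c(1) by (auto simp: ac_simps)
    have ij0: "0 < i" "0 < j" using cr by linarith+
    have "(\<lambda>\<gamma>. norm (\<kappa> \<gamma>) * (1 / weight s (2 * r) \<gamma>)) summable_on UNIV"
      using ij(1) weight_pos[OF s] by (intro wlp_summable[OF assms(1) \<kappa>] weight_dual_ratio_summable[OF s]) auto
    then have "(\<lambda>\<gamma>. norm (\<kappa> \<gamma>) * (1 / (weight s j (\<gamma> \<circ> Inl) * weight s i (\<gamma> \<circ> Inr)))) summable_on UNIV"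
    proof (rule summable_on_comparison_test)
      fix \<gamma> :: "'m + 'n \<Rightarrow> nat"
      have "weight s (2 * r) \<gamma> \<le> weight s (c * (2 * r)) (\<gamma> \<circ> Inl) * weight s (c * (2 * r)) (\<gamma> \<circ> Inr)"
        using ij(1) by (intro c(2)) simp
      also have "\<dots> \<le> weight s j (\<gamma> \<circ> Inl) * weight s i (\<gamma> \<circ> Inr)"
        using cr ij0 pos1 pos2 by (intro mult_mono weight_mono[OF s]) (auto simp: less_imp_le)
      finally show "norm (\<kappa> \<gamma>) * (1 / (weight s j (\<gamma> \<circ> Inl) * weight s i (\<gamma> \<circ> Inr))) \<le>
          norm (\<kappa> \<gamma>) * (1 / weight s (2 * r) \<gamma>)"
        using ij(1) pos3 by (intro mult_left_mono divide_left_mono mult_pos_pos) (auto intro!: pos1 pos2 ij0)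
      show "0 \<le> norm (\<kappa> \<gamma>) * (1 / (weight s j (\<gamma> \<circ> Inl) * weight s i (\<gamma> \<circ> Inr)))"
        using ij0 pos1 pos2 by (simp add: less_imp_le)
    qed
    then show "(\<lambda>(b, a). norm (\<kappa> (case_sum b a)) * (1 / weight s j b) / weight s i a) summable_on UNIV"
      unfolding summable_on_case_sum[symmetric] by (simp add: o_def)
  qed
qed

lemma kernel_op_in_wlp:
  assumes P: "projective_steps I S q w" and "i \<in> I" "\<And>a. 0 < w i a" "1 \<le> p" "\<And>b. 0 < v b"
    and sm: "(\<lambda>(b, a). norm (k b a) * v b / w i a) summable_on UNIV"
    and x: "x \<in> (\<Inter>i\<in>I. S i)"
  shows "kernel_op k x \<in> wlp p v"
proof -
  interpret projective_steps I S q w by (rule P)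
  have "x \<in> S i" using x assms(2) by blast
  note bound = coord_le[OF assms(2) this]
  have "(\<lambda>b. norm (kernel_op k x b) * v b) summable_on UNIV"
    by (rule kernel_op_summable[where w = "w i", OF _ _ _ sm bound])
      (use assms(3,5) less_imp_neq[OF assms(3)] in \<open>auto intro: less_imp_le\<close>)
  then show ?thesis using assms(4,5) less_imp_le by (intro wlp_of_summable(1)) auto
qed

text \<open>The trivial intersection and the image over \<open>UNIV\<close> give the topology the
  shape of a limit of \<open>projective_steps\<close>.\<close>

lemma ell_dual_Zero: "ell_dual p Zero =
    seminorm_topology (\<Inter>N\<in>(UNIV :: nat set). UNIV) ((\<lambda>N c. lp_norm p (truncate_mi N c)) ` UNIV)"
  by (simp add: ell_dual_def)

lemma ell_Zero: "ell p Zero = inductive_topology (UNIV :: nat set)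
    (\<lambda>N. seminorm_topology {c. \<forall>\<alpha>. mi_abs \<alpha> > N \<longrightarrow> c \<alpha> = 0} {lp_norm p})"
  by (simp add: ell_def)

lemma ell_R_flat: "s \<in> R_flat \<Longrightarrow> ell p s = inductive_topology {0<..}
    (\<lambda>r. seminorm_topology (wlp p (weight s r)) {wlp_norm p (weight s r)})"
  by (auto simp: ell_def R_flat_def wlp_topology_def)

lemma ell_dual_R_flat: "s \<in> R_flat \<Longrightarrow> ell_dual p s =
    seminorm_topology (\<Inter>r\<in>{0<..}. wlp p (\<lambda>\<alpha>. 1 / weight s r \<alpha>))
      ((\<lambda>r. wlp_norm p (\<lambda>\<alpha>. 1 / weight s r \<alpha>)) ` {0<..})"
  by (auto simp: ell_dual_def R_flat_def)

lemma topspace_ell_Zero: "1 \<le> p \<Longrightarrow> topspace (ell p Zero) = finite_support"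
  unfolding ell_Zero
  by (subst inductive_steps.topspace_limit[OF inductive_steps_truncate]) (simp_all add: set_eq_iff finite_support_bounded)

lemma topspace_ell_R_flat:
  "1 \<le> p \<Longrightarrow> s \<in> R_flat \<Longrightarrow> topspace (ell p s) = (\<Union>r\<in>{0<..}. wlp p (weight s r))"
  unfolding ell_R_flat by (rule inductive_steps.topspace_limit[OF inductive_steps_weight])

lemma topspace_ell0_dual:
  "1 \<le> p \<Longrightarrow> s \<in> R_flat \<Longrightarrow> topspace (ell0_dual p s) = (\<Union>r\<in>{0<..}. wlp p (\<lambda>\<alpha>. 1 / weight s r \<alpha>))"
  unfolding ell0_dual_def wlp_topology_def
  by (rule inductive_steps.topspace_limit[OF inductive_steps_weight_dual])

theorem proposition3p3:
  fixes K :: "('d2::finite, 'd1::finite) kernel"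
    and T :: "'d1 pseries \<Rightarrow> 'd2 pseries"
    and p :: ereal and s :: flat_index
  assumes "1 \<le> p"
    and "K \<in> topspace (At_dual p Zero)"
    and "s \<in> R_flat_bar"
    and "linear_continuous (A_space p Zero) (A_space_dual p Zero) T"
    and "\<forall>F \<in> topspace (A_space p Zero). \<forall>G \<in> topspace (A_space p Zero).
           A2_pair (T F) (peval G) = A2_kpair K (tensor_conj G F)"
  shows "(K \<in> topspace (At p s) \<longrightarrow>
            extends_uniquely (topspace (A_space p Zero)) T (A_space_dual p s) (A_space p s)) \<and>
         (K \<in> topspace (At_dual p s) \<longrightarrow>
            extends_uniquely (topspace (A_space p Zero)) T (A_space p s) (A_space_dual p s)) \<and>
         (s \<in> R_flat \<longrightarrow>
           (K \<in> topspace (At0 p s) \<longrightarrow>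
              extends_uniquely (topspace (A_space p Zero)) T (A0_space_dual p s) (A0_space p s)) \<and>
           (K \<in> topspace (At0_dual p s) \<longrightarrow>
              extends_uniquely (topspace (A_space p Zero)) T (A0_space p s) (A0_space_dual p s)))"
proof -
  note p = assms(1)
  define k where "k \<beta> \<alpha> = kcoef K (case_sum \<beta> \<alpha>)" for \<beta> \<alpha>
  have top1: "topspace (A_space p Zero) = (finite_support :: 'd1 pseries set)"
    and top2: "topspace (A_space p Zero) = (finite_support :: 'd2 pseries set)"
    by (auto simp: A_space_def topspace_pullback_topology topspace_ell_Zero[OF p] coef_finite_support)
  \<comment> \<open>Single monomials as \<open>G\<close> turn the hypothesis on the pairing into the
    matrix formula through which \<open>T\<close> enters from here on.\<close>
  have T: "coef (T F) = kernel_op k (coef F)" if "F \<in> finite_support" for F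
  proof
    fix \<beta>
    have "single \<beta> \<in> (finite_support :: 'd2 pseries set)"
      by (simp add: finite_support_def single_def)
    then have "A2_pair (T F) (peval (single \<beta>)) = A2_kpair K (tensor_conj (single \<beta>) F)"
      using assms(5) that unfolding top1 top2 by blast
    from coef_eq_kernel_op[OF that this] show "coef (T F) \<beta> = kernel_op k (coef F) \<beta>"
      unfolding k_def[abs_def] .
  qed
  show ?thesis
  proof (cases "s = Zero")
    case True
    have "extends_uniquely finite_support T (A_space_dual p Zero) (A_space p Zero)"
      if "K \<in> topspace (At p Zero)"
    proof -
      from that obtain N where N: "\<And>\<gamma>. mi_abs \<gamma> > N \<Longrightarrow> kcoef K \<gamma> = 0"
        by (auto simp: At_def topspace_pullback_topology topspace_ell_Zero[OF p] finite_support_bounded)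
      have k0: "k b a = 0" if "mi_abs b + mi_abs a > N" for b a
        unfolding k_def using that by (intro N) (simp add: mi_abs_Plus o_def)
      then have kN: "mi_abs b \<le> N \<and> mi_abs a \<le> N" if "k b a \<noteq> 0" for b a
        using that by (meson not_le trans_less_add1 trans_less_add2)
      show ?thesis
        unfolding A_space_dual_def A_space_def ell_dual_Zero ell_Zero
      \<comment> \<open>All nonzero entries have row and column of order at most \<open>N\<close>,
        so the same \<open>N\<close> serves as source seminorm and as target step.\<close>
      proof (rule extends_uniquely_projective_inductive[OF projective_steps_truncate[OF p]
            inductive_steps_truncate[OF p], of N N])
        show "(\<lambda>(b, a). norm (k b a) * 1 / (if mi_abs a \<le> N then 1 else 0)) summable_on UNIV"
        proof -
          have "(\<lambda>(b, a). norm (k b a) * 1 / (if mi_abs a \<le> N then 1 else 0))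
              summable_on ({b. mi_abs b \<le> N} \<times> {a. mi_abs a \<le> N})"
            by (intro summable_on_finite finite_cartesian_product finite_mi_abs_le)
          also have "?this \<longleftrightarrow> ?thesis"
            by (rule summable_on_cong_neutral) (auto dest: kN split: if_splits)
          finally show ?thesis .
        qed
        show "k b a = 0" if "(if mi_abs a \<le> N then 1 else 0 :: real) = 0" for b a
          using that by (intro k0) (auto split: if_splits)
        show "kernel_op k x \<in> {c. \<forall>\<alpha>. mi_abs \<alpha> > N \<longrightarrow> c \<alpha> = 0}" for x
          by (simp add: kernel_op_def k0)
      qed (auto intro: T)
    qed
    moreover have "extends_uniquely finite_support T (A_space p Zero) (A_space_dual p Zero)"
      unfolding A_space_dual_def A_space_def ell_dual_Zero ell_Zero
    \<comment> \<open>Finiteness comes from both ends: step \<open>i\<close> meets finitely many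
      columns, and seminorm \<open>j\<close> sees finitely many rows.\<close>
    proof (rule extends_uniquely_inductive_projective[where A = "\<lambda>N. {a. mi_abs a \<le> N}",
          OF inductive_steps_truncate[OF p] projective_steps_truncate[OF p]])
      show "(\<lambda>(b, a). norm (k b a) * (if mi_abs b \<le> j then 1 else 0) / 1)
          summable_on UNIV \<times> {a. mi_abs a \<le> i}" for i j
      proof -
        have "(\<lambda>(b, a). norm (k b a) * (if mi_abs b \<le> j then 1 else 0) / 1)
            summable_on ({b. mi_abs b \<le> j} \<times> {a. mi_abs a \<le> i})"
          by (intro summable_on_finite finite_cartesian_product finite_mi_abs_le)
        also have "?this \<longleftrightarrow> ?thesis"
          by (rule summable_on_cong_neutral) (auto split: if_splits)
        finally show ?thesis .
      qed
    qed (auto intro: T)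
    ultimately show ?thesis unfolding top1 using True by (auto simp: R_flat_def)
  next
    case False
    then have s: "s \<in> R_flat" using assms(3) by (simp add: R_flat_bar_def)
    note P = projective_steps_weight[OF p s] and Pd = projective_steps_weight_dual[OF p s]
      and N = inductive_steps_weight[OF p s] and Nd = inductive_steps_weight_dual[OF p s]
    have pos1: "0 < weight s r \<alpha>" if "0 < r" for r and \<alpha> :: "'d1 \<Rightarrow> nat" by (rule weight_pos[OF s that])
    have pos2: "0 < weight s r \<alpha>" if "0 < r" for r and \<alpha> :: "'d2 \<Rightarrow> nat" by (rule weight_pos[OF s that])
    obtain c where c: "0 < c"
      and up: "\<And>r i j. 0 < i \<Longrightarrow> 0 < j \<Longrightarrow> c * i \<le> r \<Longrightarrow> c * j \<le> r \<Longrightarrow> kcoef K \<in> wlp p (weight s r) \<Longrightarrow>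
        (\<lambda>(b, a). norm (k b a) * weight s j b / (1 / weight s i a)) summable_on UNIV"
      and dn: "\<And>r i j. 0 < r \<Longrightarrow> c * r \<le> i \<Longrightarrow> c * r \<le> j \<Longrightarrow> kcoef K \<in> wlp p (\<lambda>\<gamma>. 1 / weight s r \<gamma>) \<Longrightarrow>
        (\<lambda>(b, a). norm (k b a) * (1 / weight s j b) / weight s i a) summable_on UNIV"
      using kernel_summable[OF p s, of "kcoef K"] unfolding k_def by blast
    have "extends_uniquely finite_support T (A_space_dual p s) (A_space p s)"
      if "K \<in> topspace (At p s)"
    proof -
      from that obtain r where r: "0 < r" "kcoef K \<in> wlp p (weight s r)"
        by (auto simp: At_def topspace_pullback_topology topspace_ell_R_flat[OF p s])
      \<comment> \<open>The largest parameter that \<open>up\<close> allows for the given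
        \<open>r\<close>; it is used at both ends.\<close>
      then have i: "0 < r / c" "c * (r / c) \<le> r" using c by auto
      note sm = up[OF i(1) i(1) i(2) i(2) r(2)]
      show ?thesis
        unfolding A_space_dual_def A_space_def ell_dual_R_flat[OF s] ell_R_flat[OF s]
      proof (rule extends_uniquely_projective_inductive[OF Pd N _ _ _ sm _ T])
        show "kernel_op k x \<in> wlp p (weight s (r / c))"
          if "x \<in> (\<Inter>r\<in>{0<..}. wlp p (\<lambda>\<alpha>. 1 / weight s r \<alpha>))" for x
          using i pos1 pos2 by (intro kernel_op_in_wlp[OF Pd _ _ p _ sm that]) auto
      qed (use i pos1[OF i(1)] in \<open>auto simp: less_imp_neq[symmetric]\<close>)
    qed
    moreover have "extends_uniquely finite_support T (A_space p s) (A_space_dual p s)"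
      if "K \<in> topspace (At_dual p s)"
    proof -
      have K: "kcoef K \<in> wlp p (\<lambda>\<gamma>. 1 / weight s r \<gamma>)" if "0 < r" for r
        using \<open>K \<in> topspace (At_dual p s)\<close> that
        by (auto simp: At_dual_def topspace_pullback_topology ell_dual_R_flat[OF s] topspace_seminorm_topology)
      show ?thesis
        unfolding A_space_dual_def A_space_def ell_dual_R_flat[OF s] ell_R_flat[OF s]
      proof (rule extends_uniquely_inductive_projective[where A = "\<lambda>_. UNIV", OF N Pd _ _ T])
        fix i j :: real assume "i \<in> {0<..}" "j \<in> {0<..}"
        \<comment> \<open>The kernel satisfies the bound for every \<open>r\<close>, so
          \<open>r\<close> may be taken as small as \<open>i\<close> and \<open>j\<close> require in
          \<open>dn\<close>.\<close>
        then have r: "0 < min i j / c" "c * (min i j / c) \<le> i" "c * (min i j / c) \<le> j" using c by auto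
        show "(\<lambda>(b, a). norm (k b a) * (1 / weight s j b) / weight s i a) summable_on UNIV \<times> UNIV"
          unfolding UNIV_Times_UNIV by (rule dn[OF r K[OF r(1)]])
      qed auto
    qed
    moreover have "extends_uniquely finite_support T (A0_space_dual p s) (A0_space p s)"
      if "K \<in> topspace (At0 p s)"
    proof -
      have K: "kcoef K \<in> wlp p (weight s r)" if "0 < r" for r
        using \<open>K \<in> topspace (At0 p s)\<close> that
        by (auto simp: At0_def topspace_pullback_topology ell0_def topspace_seminorm_topology)
      show ?thesis
        unfolding A0_space_dual_def A0_space_def ell0_dual_def ell0_def wlp_topology_def
      proof (rule extends_uniquely_inductive_projective[where A = "\<lambda>_. UNIV", OF Nd P _ _ T])
        fix i j :: real assume ij: "i \<in> {0<..}" "j \<in> {0<..}"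
        \<comment> \<open>The kernel decays at every rate, so \<open>c * max i j\<close> is an
          admissible parameter for any \<open>i\<close> and \<open>j\<close>.\<close>
        then have r: "c * i \<le> c * max i j" "c * j \<le> c * max i j" "0 < c * max i j"
          using c by (auto simp: less_max_iff_disj)
        show "(\<lambda>(b, a). norm (k b a) * weight s j b / (1 / weight s i a)) summable_on UNIV \<times> UNIV"
          unfolding UNIV_Times_UNIV using ij by (intro up[OF _ _ r(1,2) K[OF r(3)]]) auto
      qed auto
    qed
    moreover have "extends_uniquely finite_support T (A0_space p s) (A0_space_dual p s)"
      if "K \<in> topspace (At0_dual p s)"
    proof -
      from that obtain r where r: "0 < r" "kcoef K \<in> wlp p (\<lambda>\<gamma>. 1 / weight s r \<gamma>)"
        by (auto simp: At0_dual_def topspace_pullback_topology topspace_ell0_dual[OF p s])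
      then have i: "0 < c * r" using c by auto
      \<comment> \<open>Equality in the conditions of \<open>dn\<close>: \<open>c * r\<close> is the
        smallest parameter it allows, at both ends.\<close>
      note sm = dn[OF r(1) order_refl order_refl r(2)]
      show ?thesis
        unfolding A0_space_dual_def A0_space_def ell0_dual_def ell0_def wlp_topology_def
      proof (rule extends_uniquely_projective_inductive[OF P Nd _ _ _ sm _ T])
        show "kernel_op k x \<in> wlp p (\<lambda>\<alpha>. 1 / weight s (c * r) \<alpha>)"
          if "x \<in> (\<Inter>r\<in>{0<..}. wlp p (weight s r))" for x
          using i pos1 pos2 by (intro kernel_op_in_wlp[OF P _ _ p _ sm that]) auto
      qed (use i pos1[OF i(1)] in \<open>auto simp: less_imp_neq[symmetric]\<close>)
    qed
    ultimately show ?thesis unfolding top1 by blast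
  qed
qed

end
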